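(* Let $K$ and $L$ be convex bodies in $\mathbb{R}^n$ of class $C^2_+$ with centroid at the origin. If $p\ge0$ and $0\le i\le n$ are real numbers, then $$as_{p,i}(K,L)\,as_{p,i}(K^\circ,L^\circ)\le as_p(B_2^n)^2,$$ with equality if $K$ and $L$ are ellipsoids that are dilates of each other.
   Context: $K\in C^2_+$ means that $\partial K$ is of class $C^2$ with everywhere strictly positive Gauss curvature. $K^\circ=\{y:\langle x,y\rangle\le1\ \forall x\in K\}$ is the polar body (again of class $C^2_+$ with the origin in its interior). For a body $M\in C^2_+$ with the origin in its interior, $f_p(M,u)=h_M(u)^{1-p}f_M(u)$, where $h_M$ is the support function and $f_M(u)$ is the reciprocal of the Gauss curvature of $\partial M$ at the unique boundary point with outer unit normal $u\in S^{n-1}$. For real $p\ne-n$ and real $i$, the $i$-th mixed $p$-affine surface area is $$as_{p,i}(K,L)=\int_{S^{n-1}}f_p(K,u)^{\frac{n-i}{n+p}}f_p(L,u)^{\frac{i}{n+p}}\,d\sigma(u),$$ with $\sigma$ the surface area measure on $S^{n-1}$, and $as_p(K)=as_{p,0}(K,L)=\int_{S^{n-1}}f_p(K,u)^{\frac n{n+p}}d\sigma(u)$. $B_2^n$ is the Euclidean unit ball. Bodies with centroid at the origin are dilates of each other if they are positive multiples of each other. *)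

theory Defs
  imports "HOL-Analysis.Analysis"
begin

definition convex_body :: "'a::euclidean_space set \<Rightarrow> bool" where
  "convex_body K \<longleftrightarrow> convex K \<and> compact K \<and> interior K \<noteq> {}"

definition centroid :: "'a::euclidean_space set \<Rightarrow> 'a" where
  "centroid K = (1 / measure lborel K) *\<^sub>R (LINT x:K|lborel. x)"

definition support_fun :: "'a::real_inner set \<Rightarrow> 'a \<Rightarrow> real" where
  "support_fun K u = (SUP x\<in>K. x \<bullet> u)"

definition polar_body :: "'a::real_inner set \<Rightarrow> 'a set" where
  "polar_body K = {y. \<forall>x\<in>K. x \<bullet> y \<le> 1}"

definition ellipsoid :: "'a::euclidean_space set \<Rightarrow> bool" where
  "ellipsoid E \<longleftrightarrow> (\<exists>(T :: 'a \<Rightarrow> 'a) a. linear T \<and> bij T \<and> E = (\<lambda>x. a + T x) ` cball 0 1)"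

definition dilates :: "'a::real_vector set \<Rightarrow> 'a set \<Rightarrow> bool" where
  "dilates K L \<longleftrightarrow> (\<exists>r>0. K = (\<lambda>x. r *\<^sub>R x) ` L)"

(* Embedded C^2 hypersurface: locally the zero set of a C^2 function g without critical
   points; G and H are the gradient and the Hessian of g. *)
definition C2_hypersurface :: "'a::euclidean_space set \<Rightarrow> bool" where
  "C2_hypersurface M \<longleftrightarrow>
     (\<forall>x\<in>M. \<exists>U (g :: 'a \<Rightarrow> real) G (H :: 'a \<Rightarrow> 'a \<Rightarrow>\<^sub>L 'a).
        open U \<and> x \<in> U \<and> M \<inter> U = {y \<in> U. g y = 0} \<and>
        (\<forall>y\<in>U. GDERIV g y :> G y \<and> G y \<noteq> 0 \<and> (G has_derivative blinfun_apply (H y)) (at y)) \<and>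
        continuous_on U H)"

definition outer_unit_normal :: "'a::real_inner set \<Rightarrow> 'a \<Rightarrow> 'a \<Rightarrow> bool" where
  "outer_unit_normal K x u \<longleftrightarrow> x \<in> frontier K \<and> norm u = 1 \<and> (\<forall>y\<in>K. (y - x) \<bullet> u \<le> 0)"

definition gauss_map :: "'a::real_inner set \<Rightarrow> 'a \<Rightarrow> 'a" where
  "gauss_map K x = (THE u. outer_unit_normal K x u)"

(* Determinant of the Weingarten map, the differential of the Gauss map on the tangent space
   at x, i.e. the orthogonal complement of u. It is computed as a determinant on the whole space
   by extending the Weingarten map by the identity on the normal line. The derivative along the
   boundary is determined only on tangent vectors, and only its values there are used. Since u
   is the outer normal, the unit sphere has curvature +1. *)
definition gauss_curvature :: "(real^'n) set \<Rightarrow> real^'n \<Rightarrow> real" where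
  "gauss_curvature K x =
     (let u = gauss_map K x;
          W = frechet_derivative (gauss_map K) (at x within frontier K)
      in det (matrix (\<lambda>v. W (v - (v \<bullet> u) *\<^sub>R u) + (v \<bullet> u) *\<^sub>R u)))"

definition C2_plus :: "(real^'n) set \<Rightarrow> bool" where
  "C2_plus K \<longleftrightarrow> convex_body K \<and> C2_hypersurface (frontier K) \<and>
     (\<forall>x\<in>frontier K. gauss_curvature K x > 0)"

definition curvature_fun :: "(real^'n) set \<Rightarrow> real^'n \<Rightarrow> real" where
  "curvature_fun K u = 1 / gauss_curvature K (THE x. outer_unit_normal K x u)"

definition p_curvature_fun :: "real \<Rightarrow> (real^'n) set \<Rightarrow> real^'n \<Rightarrow> real" where
  "p_curvature_fun p K u = support_fun K u powr (1 - p) * curvature_fun K u"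

(* Surface area measure of the unit sphere S, normalised by polar coordinates: a Borel set
   A of S has measure n * vol {r u | 0 < r <= 1, u in A}. *)
definition sphere_measure :: "(real^'n) measure" where
  "sphere_measure =
     scale_measure (of_nat CARD('n))
       (distr (restrict_space lborel (cball 0 1 - {0})) (restrict_space borel (sphere 0 1)) sgn)"

definition mixed_p_affine_surface_area ::
    "real \<Rightarrow> real \<Rightarrow> (real^'n) set \<Rightarrow> (real^'n) set \<Rightarrow> real" where
  "mixed_p_affine_surface_area p i K L =
     (LINT u|sphere_measure.
        p_curvature_fun p K u powr ((real CARD('n) - i) / (real CARD('n) + p)) *
        p_curvature_fun p L u powr (i / (real CARD('n) + p)))"

definition p_affine_surface_area :: "real \<Rightarrow> (real^'n) set \<Rightarrow> real" where
  "p_affine_surface_area p K =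
     (LINT u|sphere_measure. p_curvature_fun p K u powr (real CARD('n) / (real CARD('n) + p)))"

end

theory Submission
  imports Defs "HOL-Probability.Distributions" "HOL-Probability.Distribution_Functions"
begin

text \<open>
  For a body \<open>K\<close> with support function \<open>h\<close> and reciprocal curvature \<open>f\<close>, the maps
  \<open>z \<mapsto> \<bar>z\<bar> \<nabla>h(z)\<close> and \<open>z \<mapsto> (\<bar>z\<bar> / h(z)) z\<close> carry the unit ball onto \<open>K\<close> and onto \<open>K\<degree>\<close>, and their
  Jacobians on the sphere are \<open>h f\<close> and \<open>h\<^sup>-\<^sup>n\<close>; hence the spherical integrals of \<open>h f\<close> and \<open>h\<^sup>-\<^sup>n\<close> are
  \<open>n \<bar>K\<bar>\<close> and \<open>n \<bar>K\<degree>\<bar>\<close>. The integrand of the mixed affine surface area is a weighted geometric mean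
  of these functions for \<open>K\<close> and \<open>L\<close> (this uses \<open>p \<ge> 0\<close>), so the weighted AM-GM inequality bounds it
  by the same geometric mean of volumes. In the product for the bodies and for their polars the
  exponents combine to a geometric mean of the volume products \<open>\<bar>K\<bar> \<bar>K\<degree>\<bar>\<close> and \<open>\<bar>L\<bar> \<bar>L\<degree>\<bar>\<close>, and the
  Blaschke-Santalo inequality applies. The latter follows from its functional form, which Lehec
  proves by induction on the dimension from the one-dimensional Prekopa-Leindler inequality.
  For ellipsoids \<open>h f\<close> is a multiple of \<open>h\<^sup>-\<^sup>n\<close>, and dilates have proportional support functions, so
  AM-GM is an equality.
\<close>

section \<open>The Prekopa-Leindler inequality on the line\<close>

text \<open>Two obstacles shape the development. Smoothness is assumed of the boundary of
  \<open>K\<close> and \<open>L\<close>, whereas the changes of variables need derivatives of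
  support functions, for the polar bodies too. They come from the relation between a point
  \<open>z\<close> and a normal \<open>w\<close> given by equality in
  \<open>z \<bullet> w \<le> k z * h w\<close> (gauge \<open>k\<close>, support function
  \<open>h\<close>) together with \<open>k z = h w\<close>. This relation is symmetric under
  polarity; a \<open>C2\<close> boundary makes \<open>w\<close> a differentiable function of
  \<open>z\<close>, and positive curvature makes that function invertible with differentiable
  inverse. The other obstacle is the centre in the Blaschke-Santalo inequality: the functions are
  split at a median hyperplane, and the halves are not centred. The induction therefore alternates
  between a centred form and a form whose origin may be chosen. In the inequality, the centroid
  hypotheses put the origin inside the bodies and permit Blaschke-Santalo for \<open>K\<close> and
  \<open>L\<close>. The polar bodies enter it only through the volume products, which are symmetric,
  so their centroids do not matter.\<close>

lemma emeasure_sum_set_compact: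
  fixes A B C :: "real set"
  assumes A: "compact A" "A \<noteq> {}" and B: "compact B" "B \<noteq> {}"
    and C: "C \<in> sets borel" and sum: "\<And>a b. a \<in> A \<Longrightarrow> b \<in> B \<Longrightarrow> a + b \<in> C"
  shows "emeasure lebesgue A + emeasure lebesgue B \<le> emeasure lebesgue C"
proof (cases "emeasure lebesgue C = \<infinity>")
  case False
  obtain a where a: "a \<in> A" "\<And>x. x \<in> A \<Longrightarrow> x \<le> a"
    using compact_attains_sup[OF A] by blast
  obtain b where b: "b \<in> B" "\<And>x. x \<in> B \<Longrightarrow> b \<le> x"
    using compact_attains_inf[OF B] by blast
  have C': "C \<in> lmeasurable"
    using C False by (auto simp: fmeasurable_def less_top)
  have "compact ((+) b ` A)" "compact ((+) a ` B)"
    using A B by (auto intro: compact_translation)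
  then have m: "(+) b ` A \<in> lmeasurable" "(+) a ` B \<in> lmeasurable" "A \<in> lmeasurable" "B \<in> lmeasurable"
    using A B by (auto intro: lmeasurable_compact)
  \<comment> \<open>With \<open>a\<close> the largest point of \<open>A\<close> and \<open>b\<close>
    the smallest of \<open>B\<close>, the translate \<open>b + A\<close> lies left of
    \<open>a + b\<close> and \<open>a + B\<close> lies right of it. Inside the sum set they share
    one point, so their lengths add.\<close>
  have "(+) b ` A \<inter> (+) a ` B \<subseteq> {a + b}"
    using a b by force
  then have 0: "measure lebesgue ((+) b ` A \<inter> (+) a ` B) = 0"
    by (metis negligible_imp_measure0 negligible_sing negligible_subset)
  have "measure lebesgue A + measure lebesgue B = measure lebesgue ((+) b ` A \<union> (+) a ` B)"
    using measure_Un3[OF m(1,2)] 0 by (simp add: measure_translation)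
  also have "\<dots> \<le> measure lebesgue C"
    using a b m C'
    by (intro measure_mono_fmeasurable) (auto simp: fmeasurable.Un fmeasurableD intro: sum sum[OF _ b(1), unfolded add.commute[of _ b]] sum[OF a(1)])
  finally show ?thesis
    using m C' by (simp add: emeasure_eq_measure2 flip: ennreal_plus)
qed simp

text \<open>Inner approximation by compact sets, with error \<open>e/2\<close> for each of the two
  summands.\<close>

lemma emeasure_sum_set_bounded:
  fixes A B C :: "real set"
  assumes A: "bounded A" "A \<in> sets borel" "A \<noteq> {}" and B: "bounded B" "B \<in> sets borel" "B \<noteq> {}"
    and C: "C \<in> sets borel" and sum: "\<And>a b. a \<in> A \<Longrightarrow> b \<in> B \<Longrightarrow> a + b \<in> C"
  shows "emeasure lborel A + emeasure lborel B \<le> emeasure lborel C"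
proof -
  have approx: "\<exists>T. compact T \<and> T \<noteq> {} \<and> T \<subseteq> S \<and> emeasure lebesgue S \<le> emeasure lebesgue T + ennreal e"
    if S: "bounded S" "S \<in> sets borel" "S \<noteq> {}" and e: "e > 0" for S :: "real set" and e
  proof -
    obtain T where T: "closed T" "T \<subseteq> S" "S - T \<in> lmeasurable" "emeasure lebesgue (S - T) < ennreal e"
      using sets_lebesgue_inner_closed[of S e] S e by auto
    obtain s where s: "s \<in> S" using S by auto
    \<comment> \<open>The extra point keeps the approximating set nonempty; with an empty summand
      the inequality for sum sets would fail.\<close>
    define T' where "T' = insert s T"
    have "emeasure lebesgue S \<le> emeasure lebesgue (T' \<union> (S - T))"
      using T S by (intro emeasure_mono) (auto simp: T'_def)
    also have "\<dots> \<le> emeasure lebesgue T' + emeasure lebesgue (S - T)"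
      using T by (intro emeasure_subadditive) (auto simp: T'_def)
    also have "\<dots> \<le> emeasure lebesgue T' + ennreal e"
      using T by (intro add_left_mono) simp
    finally have "emeasure lebesgue S \<le> emeasure lebesgue T' + ennreal e" .
    moreover have "compact T'"
      unfolding T'_def using T S bounded_subset by (auto simp: compact_eq_bounded_closed)
    ultimately show ?thesis
      using T s by (intro exI[of _ T']) (auto simp: T'_def)
  qed
  have "emeasure lebesgue A + emeasure lebesgue B \<le> emeasure lebesgue C + ennreal e" if e: "e > 0" for e
  proof -
    obtain T where T: "compact T" "T \<noteq> {}" "T \<subseteq> A" "emeasure lebesgue A \<le> emeasure lebesgue T + ennreal (e/2)"
      using approx[OF A, of "e/2"] e by auto
    obtain U where U: "compact U" "U \<noteq> {}" "U \<subseteq> B" "emeasure lebesgue B \<le> emeasure lebesgue U + ennreal (e/2)"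
      using approx[OF B, of "e/2"] e by auto
    have "emeasure lebesgue A + emeasure lebesgue B
        \<le> (emeasure lebesgue T + ennreal (e/2)) + (emeasure lebesgue U + ennreal (e/2))"
      using T U by (intro add_mono)
    also have "\<dots> = (emeasure lebesgue T + emeasure lebesgue U) + (ennreal (e/2) + ennreal (e/2))"
      by (simp add: ac_simps)
    also have "ennreal (e/2) + ennreal (e/2) = ennreal e"
      using e by (simp flip: ennreal_plus)
    also have "emeasure lebesgue T + emeasure lebesgue U \<le> emeasure lebesgue C"
      using T U C sum by (intro emeasure_sum_set_compact) auto
    finally show ?thesis by (simp add: add_right_mono)
  qed
  then have "emeasure lebesgue A + emeasure lebesgue B \<le> emeasure lebesgue C"
    by (metis ennreal_le_epsilon)
  then show ?thesis
    using A B C by (simp add: emeasure_completion)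
qed

text \<open>Tonelli for the region under the graph: its vertical sections have length
  \<open>f x\<close>, its horizontal sections are the superlevel sets.\<close>

lemma nn_integral_layer_cake:
  fixes f :: "'a \<Rightarrow> real"
  assumes "sigma_finite_measure M" and f[measurable]: "f \<in> borel_measurable M"
    and nn: "\<And>x. 0 \<le> f x"
  shows "(\<integral>\<^sup>+x. ennreal (f x) \<partial>M) = (\<integral>\<^sup>+r. indicator {0<..} r * emeasure M {x\<in>space M. f x > r} \<partial>lborel)"
proof -
  interpret sigma_finite_measure M by fact
  interpret P: pair_sigma_finite M lborel ..
  have "(\<integral>\<^sup>+x. ennreal (f x) \<partial>M) = (\<integral>\<^sup>+x. \<integral>\<^sup>+r. indicator {p. 0 < snd p \<and> snd p < f (fst p)} (x, r) \<partial>lborel \<partial>M)"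
  proof (intro nn_integral_cong)
    fix x
    have "(\<integral>\<^sup>+r. indicator {p. 0 < snd p \<and> snd p < f (fst p)} (x, r) \<partial>lborel) = (\<integral>\<^sup>+r. indicator {0<..<f x} r \<partial>lborel)"
      by (intro nn_integral_cong) (auto simp: indicator_def)
    also have "\<dots> = ennreal (f x)" using nn by simp
    finally show "ennreal (f x) = (\<integral>\<^sup>+r. indicator {p. 0 < snd p \<and> snd p < f (fst p)} (x, r) \<partial>lborel)" by simp
  qed
  also have "\<dots> = (\<integral>\<^sup>+r. \<integral>\<^sup>+x. indicator {p. 0 < snd p \<and> snd p < f (fst p)} (x, r) \<partial>M \<partial>lborel)"
    by (intro P.Fubini'[symmetric]) measurable
  also have "\<dots> = (\<integral>\<^sup>+r. indicator {0<..} r * emeasure M {x\<in>space M. f x > r} \<partial>lborel)"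
  proof (intro nn_integral_cong)
    fix r :: real
    have "(\<integral>\<^sup>+x. indicator {p. 0 < snd p \<and> snd p < f (fst p)} (x, r) \<partial>M)
        = (\<integral>\<^sup>+x. indicator {0<..} r * indicator {x\<in>space M. f x > r} x \<partial>M)"
      by (intro nn_integral_cong) (auto simp: indicator_def)
    also have "\<dots> = indicator {0<..} r * emeasure M {x\<in>space M. f x > r}"
      by (simp add: nn_integral_cmult)
    finally show "(\<integral>\<^sup>+x. indicator {p. 0 < snd p \<and> snd p < f (fst p)} (x, r) \<partial>M)
      = indicator {0<..} r * emeasure M {x\<in>space M. f x > r}" .
  qed
  finally show ?thesis .
qed

text \<open>With both suprema equal to 1, the superlevel sets of \<open>f\<close> and
  \<open>g\<close> are nonempty at the same heights \<open>0 < r < 1\<close>, so the length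
  inequality for sum sets applies height by height. Integration over \<open>r\<close> gives a bound
  on the sum of the integrals, which is stronger than one on their product.\<close>

lemma prekopa_leindler_normalized:
  fixes f g h :: "real \<Rightarrow> real"
  assumes [measurable]: "f \<in> borel_measurable borel" "g \<in> borel_measurable borel" "h \<in> borel_measurable borel"
    and nn: "\<And>x. 0 \<le> f x" "\<And>x. 0 \<le> g x" "\<And>x. 0 \<le> h x"
    and supp: "\<And>x. f x \<noteq> 0 \<Longrightarrow> \<bar>x\<bar> \<le> m" "\<And>x. g x \<noteq> 0 \<Longrightarrow> \<bar>x\<bar> \<le> m"
    and le1: "\<And>x. f x \<le> 1" "\<And>x. g x \<le> 1"
    and sup1: "\<And>r. r < 1 \<Longrightarrow> \<exists>x. f x > r" "\<And>r. r < 1 \<Longrightarrow> \<exists>x. g x > r"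
    and le: "\<And>x y. f x * g y \<le> (h ((x + y) / 2))\<^sup>2"
  shows "(\<integral>\<^sup>+x. f x \<partial>lborel) + (\<integral>\<^sup>+x. g x \<partial>lborel) \<le> 2 * (\<integral>\<^sup>+x. h x \<partial>lborel)"
proof -
  have *: "indicator {0<..} r * emeasure lborel {x. f x > r} + indicator {0<..} r * emeasure lborel {x. g x > r}
       \<le> indicator {0<..} r * (2 * emeasure lborel {x. h x > r})" (is "?l \<le> ?r") for r
  proof (cases "0 < r \<and> r < 1")
    case True
    \<comment> \<open>The sum set lies in the doubled superlevel set of \<open>h\<close>; the
      substitution \<open>c = 2 * x\<close> then produces the factor 2.\<close>
    have "emeasure lborel {x. f x > r} + emeasure lborel {x. g x > r} \<le> emeasure lborel {c. h (c/2) > r}"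
    proof (rule emeasure_sum_set_bounded)
      show "bounded {x. r < f x}" "bounded {x. r < g x}"
        using True supp nn by (intro boundedI[of _ m]; fastforce)+
      show "{x. r < f x} \<noteq> {}" "{x. r < g x} \<noteq> {}" using sup1 True by auto
      fix a b assume "a \<in> {x. r < f x}" "b \<in> {x. r < g x}"
      then have "r\<^sup>2 < f a * g b"
        using True by (auto simp: power2_eq_square intro!: mult_strict_mono)
      also have "\<dots> \<le> (h ((a + b) / 2))\<^sup>2" by (rule le)
      finally show "a + b \<in> {c. r < h (c / 2)}"
        using nn(3) power2_less_imp_less by auto
    qed measurable
    also have "\<dots> = (\<integral>\<^sup>+c. indicator {c. h (c/2) > r} c \<partial>lborel)" by simp
    also have "\<dots> = 2 * (\<integral>\<^sup>+x. indicator {c. h (c/2) > r} (0 + 2 * x) \<partial>lborel)"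
      by (subst nn_integral_real_affine[where c=2 and t=0]) auto
    also have "(\<integral>\<^sup>+x. indicator {c. h (c/2) > r} (0 + 2 * x) \<partial>lborel) = (\<integral>\<^sup>+x. indicator {x. h x > r} x \<partial>lborel)"
      by (intro nn_integral_cong) (auto simp: indicator_def)
    finally show ?thesis using True by simp
  next
    case False
    moreover have "{x. f x > r} = {}" "{x. g x > r} = {}" if "r \<ge> 1"
      using le1 that by (auto simp: not_less intro: order_trans)
    ultimately show ?thesis by (cases "r \<ge> 1") auto
  qed
  have "(\<integral>\<^sup>+x. f x \<partial>lborel) + (\<integral>\<^sup>+x. g x \<partial>lborel)
    = (\<integral>\<^sup>+r. indicator {0<..} r * emeasure lborel {x. f x > r} + indicator {0<..} r * emeasure lborel {x. g x > r} \<partial>lborel)"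
    using nn by (simp add: nn_integral_layer_cake[OF sigma_finite_lborel] nn_integral_add)
  also have "\<dots> \<le> (\<integral>\<^sup>+r. 2 * (indicator {0<..} r * emeasure lborel {x. h x > r}) \<partial>lborel)"
    using * by (intro nn_integral_mono) (simp add: ac_simps)
  also have "\<dots> = 2 * (\<integral>\<^sup>+x. h x \<partial>lborel)"
    using nn by (simp add: nn_integral_layer_cake[OF sigma_finite_lborel] nn_integral_cmult)
  finally show ?thesis .
qed

text \<open>AM-GM for extended reals; it turns the bound on a sum from
  \<open>prekopa_leindler_normalized\<close> into one on a product.\<close>

lemma ennreal_four_mult_le_power2:
  fixes a b c :: ennreal
  assumes "a + b \<le> 2 * c"
  shows "a * b \<le> c\<^sup>2"
proof (cases "c = top")
  case False
  then obtain c' where c': "c = ennreal c'" "0 \<le> c'" by (metis ennreal_cases)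
  have "2 * c < top" using c' by (simp add: ennreal_mult_less_top)
  then have "a \<noteq> top" "b \<noteq> top" using assms by (auto simp: top_unique)
  then obtain a' b' where ab: "a = ennreal a'" "0 \<le> a'" "b = ennreal b'" "0 \<le> b'"
    by (metis ennreal_cases)
  have "ennreal (a' + b') \<le> ennreal (2 * c')"
    using assms ab c' by (simp add: ennreal_mult)
  then have "a' + b' \<le> 2 * c'" using c' by (subst (asm) ennreal_le_iff) auto
  moreover have "4 * (a' * b') \<le> (a' + b')\<^sup>2"
    using zero_le_power2[of "a' - b'"] by (simp add: power2_eq_square algebra_simps)
  moreover have "(a' + b')\<^sup>2 \<le> (2 * c')\<^sup>2" using ab \<open>a' + b' \<le> 2 * c'\<close> by (intro power_mono) auto
  ultimately have "a' * b' \<le> c'\<^sup>2" by (simp add: power_mult_distrib)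
  then show ?thesis using ab c'
    by (simp add: ennreal_power flip: ennreal_mult)
qed (simp add: power2_eq_square ennreal_top_mult)

text \<open>Dividing \<open>f\<close>, \<open>g\<close>, \<open>h\<close> by \<open>a\<close>,
  \<open>b\<close>, \<open>sqrt (a * b)\<close>, with \<open>a\<close> and \<open>b\<close> the
  suprema of \<open>f\<close> and \<open>g\<close>, preserves the midpoint hypothesis and reaches
  the normalised case. If a supremum is 0, that function vanishes.\<close>

lemma prekopa_leindler_real:
  fixes f g h :: "real \<Rightarrow> real"
  assumes [measurable]: "f \<in> borel_measurable borel" "g \<in> borel_measurable borel" "h \<in> borel_measurable borel"
    and nn: "\<And>x. 0 \<le> f x" "\<And>x. 0 \<le> g x" "\<And>x. 0 \<le> h x"
    and supp: "\<And>x. f x \<noteq> 0 \<Longrightarrow> \<bar>x\<bar> \<le> m" "\<And>x. g x \<noteq> 0 \<Longrightarrow> \<bar>x\<bar> \<le> m"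
    and bdd: "\<And>x. f x \<le> F" "\<And>x. g x \<le> G"
    and le: "\<And>x y. f x * g y \<le> (h ((x + y) / 2))\<^sup>2"
  shows "(\<integral>\<^sup>+x. f x \<partial>lborel) * (\<integral>\<^sup>+x. g x \<partial>lborel) \<le> (\<integral>\<^sup>+x. h x \<partial>lborel)\<^sup>2"
proof -
  define a where "a = (SUP x. f x)"
  define b where "b = (SUP x. g x)"
  have bd: "bdd_above (range f)" "bdd_above (range g)" using bdd bdd_aboveI2 by metis+
  have fa: "f x \<le> a" "g x \<le> b" for x
    unfolding a_def b_def using bd by (auto intro: cSUP_upper)
  show ?thesis
  proof (cases "a > 0 \<and> b > 0")
    case True
    define c where "c = sqrt (a * b)"
    have c: "c > 0" "c\<^sup>2 = a * b" using True by (auto simp: c_def)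
    have ex: "\<exists>x. f x / a > r" if "r < 1" for r
    proof -
      have "r * a < a" using that True by simp
      then obtain x where "r * a < f x" unfolding a_def using bd
        by (auto simp: less_cSUP_iff)
      then show ?thesis using True by (auto simp: field_simps)
    qed
    have ex': "\<exists>x. g x / b > r" if "r < 1" for r
    proof -
      have "r * b < b" using that True by simp
      then obtain x where "r * b < g x" unfolding b_def using bd
        by (auto simp: less_cSUP_iff)
      then show ?thesis using True by (auto simp: field_simps)
    qed
    have "(\<integral>\<^sup>+x. f x / a \<partial>lborel) + (\<integral>\<^sup>+x. g x / b \<partial>lborel) \<le> 2 * (\<integral>\<^sup>+x. h x / c \<partial>lborel)"
    proof (rule prekopa_leindler_normalized[where m=m])
      fix x y
      have "f x / a * (g y / b) = f x * g y / c\<^sup>2" by (simp add: c)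
      also have "\<dots> \<le> (h ((x + y) / 2))\<^sup>2 / c\<^sup>2" using le by (intro divide_right_mono) auto
      finally show "f x / a * (g y / b) \<le> (h ((x + y) / 2) / c)\<^sup>2" by (simp add: power_divide)
    qed (use nn True c supp fa ex ex' in auto)
    then have "(\<integral>\<^sup>+x. f x / a \<partial>lborel) * (\<integral>\<^sup>+x. g x / b \<partial>lborel) \<le> (\<integral>\<^sup>+x. h x / c \<partial>lborel)\<^sup>2"
      by (rule ennreal_four_mult_le_power2)
    then have "(ennreal a * (\<integral>\<^sup>+x. f x / a \<partial>lborel)) * (ennreal b * (\<integral>\<^sup>+x. g x / b \<partial>lborel))
        \<le> (ennreal c * (\<integral>\<^sup>+x. h x / c \<partial>lborel))\<^sup>2"
      using c True
      by (simp add: power_mult_distrib ennreal_power ennreal_mult ac_simps mult_left_mono)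
    then show ?thesis
      using True c nn by (simp flip: nn_integral_cmult ennreal_mult')
  next
    case False
    then have "(\<forall>x. f x = 0) \<or> (\<forall>x. g x = 0)"
      using fa nn by (meson leD le_less_trans less_le_not_le linorder_not_less order_antisym)
    then show ?thesis by auto
  qed
qed


text \<open>The substitution \<open>s = exp x\<close>, \<open>t = exp y\<close> turns the geometric
  mean \<open>sqrt (s * t)\<close> into the midpoint \<open>(x + y) / 2\<close>. The cut-off to
  \<open>{exp (-m)..exp m}\<close> supplies the bounded supports and heights that
  \<open>prekopa_leindler_real\<close> asks for.\<close>

lemma prekopa_leindler_exp_truncated:
  fixes f g :: "real \<Rightarrow> real" and m c :: real
  assumes [measurable]: "f \<in> borel_measurable borel" "g \<in> borel_measurable borel"
    and nn: "\<And>x. 0 \<le> f x" "\<And>x. 0 \<le> g x" "c \<ge> 0" "m \<ge> 0"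
    and bdd: "\<And>x. f x \<le> m" "\<And>x. g x \<le> m"
    and le: "\<And>s t. s > 0 \<Longrightarrow> t > 0 \<Longrightarrow> f s * g t \<le> c * exp (- (s * t))"
  shows "(\<integral>\<^sup>+s. f s * indicator {exp (-m)..exp m} s \<partial>lborel) * (\<integral>\<^sup>+t. g t * indicator {exp (-m)..exp m} t \<partial>lborel)
     \<le> ennreal c * (\<integral>\<^sup>+r. ennreal (exp (- (r\<^sup>2 / 2))) * indicator {0<..} r \<partial>lborel)\<^sup>2"
proof -
  define I where "I = (indicator {-m..m} :: real \<Rightarrow> real)"
  have I[measurable]: "I \<in> borel_measurable borel" by (simp add: I_def)
  have I01: "0 \<le> I x" "I x \<le> 1" "I x \<noteq> 0 \<longleftrightarrow> \<bar>x\<bar> \<le> m" for x by (auto simp: I_def indicator_def)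
  \<comment> \<open>The square root of \<open>c * r\<^sup>2 * exp (- r\<^sup>2)\<close> at
    \<open>r = exp x\<close>: this is the hypothesis at \<open>s * t = r\<^sup>2\<close>, multiplied
    by the two Jacobians \<open>s\<close> and \<open>t\<close>.\<close>
  define h where "h x = sqrt c * (exp x * exp (- ((exp x)\<^sup>2 / 2)))" for x :: real
  have [measurable]: "h \<in> borel_measurable borel" by (simp add: h_def[abs_def])
  have sub: "(\<integral>\<^sup>+s. u s * indicator {exp (-m)..exp m} s \<partial>lborel) = (\<integral>\<^sup>+x. u (exp x) * exp x * I x \<partial>lborel)"
    if [measurable]: "u \<in> borel_measurable borel" for u :: "real \<Rightarrow> real"
    using nn(4) unfolding I_def
    by (intro nn_integral_substitution) (auto intro!: derivative_eq_intros continuous_intros simp: set_borel_measurable_def)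
  have "(\<integral>\<^sup>+x. f (exp x) * exp x * I x \<partial>lborel) * (\<integral>\<^sup>+x. g (exp x) * exp x * I x \<partial>lborel)
      \<le> (\<integral>\<^sup>+x. h x * I x \<partial>lborel)\<^sup>2"
  proof (rule prekopa_leindler_real[where m=m and F="m * exp m" and G="m * exp m"])
    fix x :: real
    have "f (exp x) * (exp x * I x) \<le> m * exp m" "g (exp x) * (exp x * I x) \<le> m * exp m"
      using bdd nn by (intro mult_mono; auto simp: I_def indicator_def)+
    then show "f (exp x) * exp x * I x \<le> m * exp m" "g (exp x) * exp x * I x \<le> m * exp m"
      by (auto simp: ac_simps)
  next
    fix x y :: real
    let ?z = "(x + y) / 2"
    have sq: "exp x * exp y = (exp ?z)\<^sup>2"
      by (simp add: power2_eq_square field_simps flip: exp_add)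
    have "f (exp x) * g (exp y) * (exp x * exp y) \<le> c * exp (- (exp x * exp y)) * (exp x * exp y)"
      using le[of "exp x" "exp y"] by (intro mult_right_mono) auto
    also have "\<dots> = (h ?z)\<^sup>2"
      unfolding sq h_def using nn(3) by (simp add: power_mult_distrib flip: exp_double)
    finally have *: "f (exp x) * g (exp y) * (exp x * exp y) \<le> (h ?z)\<^sup>2" .
    show "f (exp x) * exp x * I x * (g (exp y) * exp y * I y) \<le> (h ?z * I ?z)\<^sup>2"
    proof (cases "\<bar>x\<bar> \<le> m \<and> \<bar>y\<bar> \<le> m")
      case True
      then have "I x = 1" "I y = 1" "I ?z = 1" by (auto simp: I_def indicator_def abs_le_iff field_simps)
      then show ?thesis using * by (simp add: ac_simps)
    next
      case False
      then have "I x = 0 \<or> I y = 0" using I01(3) by blast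
      then show ?thesis by auto
    qed
  qed (use nn I01 in \<open>auto simp: h_def\<close>)
  also have "(\<integral>\<^sup>+x. h x * I x \<partial>lborel) = (\<integral>\<^sup>+r. sqrt c * exp (- (r\<^sup>2 / 2)) * indicator {exp (-m)..exp m} r \<partial>lborel)"
    by (subst sub) (auto simp: h_def ac_simps)
  also have "\<dots> \<le> (\<integral>\<^sup>+r. ennreal (sqrt c) * (ennreal (exp (- (r\<^sup>2 / 2))) * indicator {0<..} r) \<partial>lborel)"
  proof (intro nn_integral_mono)
    fix r :: real
    have "0 < exp (-m)" by simp
    then show "ennreal (sqrt c * exp (- (r\<^sup>2 / 2)) * indicator {exp (-m)..exp m} r)
       \<le> ennreal (sqrt c) * (ennreal (exp (- (r\<^sup>2 / 2))) * indicator {0<..} r)"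
      using nn(3) by (auto simp: indicator_def ennreal_mult simp del: exp_gt_zero)
  qed
  also have "\<dots> = ennreal (sqrt c) * (\<integral>\<^sup>+r. ennreal (exp (- (r\<^sup>2 / 2))) * indicator {0<..} r \<partial>lborel)"
    by (simp add: nn_integral_cmult)
  finally have "(\<integral>\<^sup>+x. f (exp x) * exp x * I x \<partial>lborel) * (\<integral>\<^sup>+x. g (exp x) * exp x * I x \<partial>lborel)
      \<le> (ennreal (sqrt c) * (\<integral>\<^sup>+r. ennreal (exp (- (r\<^sup>2 / 2))) * indicator {0<..} r \<partial>lborel))\<^sup>2"
    by (simp add: power_mono)
  then show ?thesis
    using nn(3) by (simp add: sub power_mult_distrib ennreal_power)
qed

lemma prekopa_leindler_exp:
  fixes f g :: "real \<Rightarrow> ennreal" and c :: real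
  assumes [measurable]: "f \<in> borel_measurable borel" "g \<in> borel_measurable borel"
    and c: "c \<ge> 0"
    and le: "\<And>s t. s > 0 \<Longrightarrow> t > 0 \<Longrightarrow> f s * g t \<le> ennreal (c * exp (- (s * t)))"
  shows "(\<integral>\<^sup>+s. f s * indicator {0<..} s \<partial>lborel) * (\<integral>\<^sup>+t. g t * indicator {0<..} t \<partial>lborel)
     \<le> ennreal c * (\<integral>\<^sup>+r. ennreal (exp (- (r\<^sup>2 / 2))) * indicator {0<..} r \<partial>lborel)\<^sup>2" (is "_ \<le> ?K")
proof -
  define T where "T u (m::nat) s = min (u s) (of_nat m) * indicator {exp (- real m)..exp (real m)} s"
    for u :: "real \<Rightarrow> ennreal" and m s
  have T_meas[measurable]: "T u m \<in> borel_measurable borel" if [measurable]: "u \<in> borel_measurable borel" for u m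
    unfolding T_def[abs_def] by measurable
  have T_inc: "incseq (T u)" for u
  proof (rule incseq_SucI, rule le_funI)
    fix m s
    have "exp (- real (Suc m)) \<le> exp (- real m)" "exp (real m) \<le> exp (real (Suc m))" by auto
    then have "(indicator {exp (- real m)..exp (real m)} s :: ennreal) \<le> indicator {exp (- real (Suc m))..exp (real (Suc m))} s"
      unfolding indicator_def by (auto simp del: exp_le_cancel_iff)
    moreover have "min (u s) (of_nat m) \<le> min (u s) (of_nat (Suc m))"
      by (intro min.mono order_refl) (simp add: le_iff_add ac_simps)
    ultimately show "T u m s \<le> T u (Suc m) s"
      unfolding T_def by (intro mult_mono) auto
  qed
  have T_sup: "(SUP m. T u m s) = u s * indicator {0<..} s" for u s
  proof (cases "s > 0")
    case True
    obtain N :: nat where N: "real N \<ge> \<bar>ln s\<bar>" using real_arch_simple by blast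
    have "s \<in> {exp (- real m)..exp (real m)}" if "m \<ge> N" for m
    proof -
      have "- real m \<le> ln s" "ln s \<le> real m" using N that by auto
      then show ?thesis using True by (simp add: ln_ge_iff) (metis exp_le_cancel_iff exp_ln)
    qed
    then have "eventually (\<lambda>m. T u m s = min (u s) (of_nat m)) sequentially"
      unfolding eventually_sequentially T_def by (auto intro!: exI[of _ N])
    \<comment> \<open>The limit is \<open>min (u s) top\<close>, so points where \<open>u\<close> is
      infinite are covered as well.\<close>
    moreover have "(\<lambda>m. min (u s) (of_nat m :: ennreal)) \<longlonglongrightarrow> min (u s) top"
      by (intro tendsto_min tendsto_const of_nat_tendsto_top_ennreal)
    ultimately have "(\<lambda>m. T u m s) \<longlonglongrightarrow> u s"
      by (simp add: tendsto_cong)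
    moreover have "(\<lambda>m. T u m s) \<longlonglongrightarrow> (SUP m. T u m s)"
      using T_inc[of u] by (intro LIMSEQ_SUP) (auto simp: incseq_def le_fun_def)
    ultimately show ?thesis using True LIMSEQ_unique by auto
  next
    case False
    then have "T u m s = 0" for m
      by (auto simp: T_def indicator_def not_less intro: order_trans)
         (meson exp_gt_zero less_le_trans not_less)
    then show ?thesis using False by simp
  qed
  have trunc: "integral\<^sup>N lborel (T f m) * integral\<^sup>N lborel (T g m) \<le> ?K" for m :: nat
  proof -
    define f' where "f' s = enn2real (min (f s) (of_nat m))" for s
    define g' where "g' s = enn2real (min (g s) (of_nat m))" for s
    have lt: "min (f s) (of_nat m) < top" "min (g s) (of_nat m) < top" for s
      by (auto simp: min_less_iff_disj of_nat_less_top)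
    have fg: "ennreal (f' s) = min (f s) (of_nat m)" "ennreal (g' s) = min (g s) (of_nat m)" for s
      unfolding f'_def g'_def using lt by (auto simp: ennreal_enn2real)
    have [measurable]: "f' \<in> borel_measurable borel" "g' \<in> borel_measurable borel"
      unfolding f'_def[abs_def] g'_def[abs_def] by measurable
    have nn: "0 \<le> f' s" "0 \<le> g' s" for s by (auto simp: f'_def g'_def)
    have "(\<integral>\<^sup>+s. f' s * indicator {exp (- real m)..exp m} s \<partial>lborel) * (\<integral>\<^sup>+t. g' t * indicator {exp (- real m)..exp m} t \<partial>lborel) \<le> ?K"
    proof (rule prekopa_leindler_exp_truncated)
      fix s
      have "ennreal (f' s) \<le> ennreal m" "ennreal (g' s) \<le> ennreal m"
        unfolding fg by (simp_all add: ennreal_of_nat_eq_real_of_nat)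
      then show "f' s \<le> m" "g' s \<le> m" by (auto simp: ennreal_le_iff)
    next
      fix s t :: real assume st: "s > 0" "t > 0"
      have "ennreal (f' s * g' t) = min (f s) (of_nat m) * min (g t) (of_nat m)"
        by (simp add: ennreal_mult nn fg)
      also have "\<dots> \<le> f s * g t" by (intro mult_mono) auto
      also have "\<dots> \<le> ennreal (c * exp (- (s * t)))" by (rule le[OF st])
      finally show "f' s * g' t \<le> c * exp (- (s * t))"
        using c by (subst (asm) ennreal_le_iff) auto
    qed (use nn c in auto)
    moreover have "(\<integral>\<^sup>+s. f' s * indicator {exp (- real m)..exp m} s \<partial>lborel) = integral\<^sup>N lborel (T f m)"
      "(\<integral>\<^sup>+s. g' s * indicator {exp (- real m)..exp m} s \<partial>lborel) = integral\<^sup>N lborel (T g m)"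
      using nn by (auto intro!: nn_integral_cong simp: T_def fg ennreal_mult ennreal_indicator)
    ultimately show ?thesis by simp
  qed
  have conv: "(\<integral>\<^sup>+s. u s * indicator {0<..} s \<partial>lborel) = (SUP m. integral\<^sup>N lborel (T u m))"
    if [measurable]: "u \<in> borel_measurable borel" for u
    unfolding T_sup[symmetric] using T_inc by (intro nn_integral_monotone_convergence_SUP) auto
  \<comment> \<open>A product of two suprema involves independent indices; the truncation at the
    larger one bounds both factors.\<close>
  have "integral\<^sup>N lborel (T f m) * integral\<^sup>N lborel (T g k) \<le> ?K" for m k
  proof -
    have "integral\<^sup>N lborel (T f m) \<le> integral\<^sup>N lborel (T f (max m k))"
      "integral\<^sup>N lborel (T g k) \<le> integral\<^sup>N lborel (T g (max m k))"
      using T_inc[unfolded incseq_def le_fun_def] by (auto intro!: nn_integral_mono)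
    then show ?thesis using trunc[of "max m k"] by (meson mult_mono order_trans zero_le)
  qed
  then show ?thesis
    by (simp add: conv SUP_mult_left_ennreal SUP_mult_right_ennreal SUP_le_iff)
qed

section \<open>The functional Santalo inequality\<close>

lemma nn_integral_half_gaussian:
  "(\<integral>\<^sup>+r. ennreal (exp (- (r\<^sup>2 / 2))) * indicator {0<..} r \<partial>lborel) = ennreal (sqrt (pi / 2))"
proof -
  have "(\<integral>\<^sup>+x. ennreal (indicator {0..} x * exp (- x\<^sup>2)) \<partial>lborel) = ennreal (sqrt pi / 2)"
    using gaussian_moment_0 by (subst nn_integral_eq_integral) (auto simp: has_bochner_integral_iff)
  moreover have "(\<integral>\<^sup>+r. ennreal (exp (- (r\<^sup>2 / 2))) * indicator {0<..} r \<partial>lborel)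
      = ennreal (sqrt 2) * (\<integral>\<^sup>+x. ennreal (exp (- ((0 + sqrt 2 * x)\<^sup>2 / 2))) * indicator {0<..} (0 + sqrt 2 * x) \<partial>lborel)"
    by (subst nn_integral_real_affine[where c="sqrt 2" and t=0]) auto
  moreover have "(\<integral>\<^sup>+x. ennreal (exp (- ((0 + sqrt 2 * x)\<^sup>2 / 2))) * indicator {0<..} (0 + sqrt 2 * x) \<partial>lborel)
      = (\<integral>\<^sup>+x. ennreal (indicator {0..} x * exp (- x\<^sup>2)) \<partial>lborel)"
  proof (rule nn_integral_cong_AE)
    have "AE x in lborel. x \<noteq> (0::real)" by (rule AE_lborel_singleton)
    then show "AE x in lborel. ennreal (exp (- ((0 + sqrt 2 * x)\<^sup>2 / 2))) * indicator {0<..} (0 + sqrt 2 * x)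
      = ennreal (indicator {0..} x * exp (- x\<^sup>2))"
      by eventually_elim (auto simp: indicator_def power_mult_distrib zero_less_mult_iff)
  qed
  moreover have "sqrt 2 * (sqrt pi / 2) = sqrt (pi / 2)"
    by (simp add: real_sqrt_divide field_simps)
  ultimately show ?thesis by (simp flip: ennreal_mult)
qed

text \<open>The induction on the dimension runs over finite index sets. Functions on an index set
  can lose or gain a coordinate, which vectors of a type with built-in dimension cannot.\<close>

abbreviation lborel_on :: "'i set \<Rightarrow> ('i \<Rightarrow> real) measure"
  where "lborel_on I \<equiv> Pi\<^sub>M I (\<lambda>_. lborel)"

interpretation lborel_prod: product_sigma_finite "\<lambda>_. lborel :: real measure"
  by standard

text \<open>Boxes determine the product measure. The restricted abstraction
  \<open>\<lambda>i\<in>I\<close> is required because points of the product space are extensional,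
  that is, \<open>undefined\<close> outside \<open>I\<close>.\<close>

lemma distr_lborel_on_translate:
  assumes I: "finite I"
  shows "distr (lborel_on I) (lborel_on I) (\<lambda>x. \<lambda>i\<in>I. a i + x i) = lborel_on I"
proof (rule lborel_prod.PiM_eqI[OF I])
  fix A :: "'a \<Rightarrow> real set" assume A: "\<And>i. i \<in> I \<Longrightarrow> A i \<in> sets lborel"
  have "emeasure (distr (lborel_on I) (lborel_on I) (\<lambda>x. \<lambda>i\<in>I. a i + x i)) (Pi\<^sub>E I A)
      = emeasure (lborel_on I) ((\<lambda>x. \<lambda>i\<in>I. a i + x i) -` (Pi\<^sub>E I A) \<inter> space (lborel_on I))"
    using A I by (intro emeasure_distr sets_PiM_I_finite) auto
  also have "(\<lambda>x. \<lambda>i\<in>I. a i + x i) -` (Pi\<^sub>E I A) \<inter> space (lborel_on I) = Pi\<^sub>E I (\<lambda>i. (+) (a i) -` A i)"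
    by (auto simp: space_PiM PiE_iff)
  also have "emeasure (lborel_on I) \<dots> = (\<Prod>i\<in>I. emeasure lborel ((+) (a i) -` A i))"
  proof (intro lborel_prod.emeasure_PiM I)
    fix i assume "i \<in> I"
    then show "(+) (a i) -` A i \<in> sets lborel"
      using measurable_sets[of "(+) (a i)" borel borel "A i"] A by simp
  qed
  also have "\<dots> = (\<Prod>i\<in>I. emeasure lborel (A i))"
  proof (intro prod.cong refl)
    fix i assume "i \<in> I"
    then have "emeasure (distr lborel borel ((+) (a i))) (A i) = emeasure lborel ((+) (a i) -` A i)"
      using A by (subst emeasure_distr) auto
    then show "emeasure lborel ((+) (a i) -` A i) = emeasure lborel (A i)"
      by (simp add: lborel_distr_plus)
  qed
  finally show "emeasure (distr (lborel_on I) (lborel_on I) (\<lambda>x. \<lambda>i\<in>I. a i + x i)) (Pi\<^sub>E I A)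
      = (\<Prod>i\<in>I. emeasure lborel (A i))" .
qed simp

lemma nn_integral_lborel_on_translate:
  assumes I: "finite I" and [measurable]: "f \<in> borel_measurable (lborel_on I)"
  shows "(\<integral>\<^sup>+x. f (\<lambda>i\<in>I. a i + x i) \<partial>lborel_on I) = (\<integral>\<^sup>+x. f x \<partial>lborel_on I)"
proof -
  have "(\<integral>\<^sup>+x. f (\<lambda>i\<in>I. a i + x i) \<partial>lborel_on I)
     = (\<integral>\<^sup>+x. f x \<partial>distr (lborel_on I) (lborel_on I) (\<lambda>x. \<lambda>i\<in>I. a i + x i))"
    by (subst nn_integral_distr) auto
  then show ?thesis by (simp add: distr_lborel_on_translate[OF I])
qed

lemma pair_sigma_finite_lborel_on: "finite I \<Longrightarrow> pair_sigma_finite (lborel_on I) (lborel :: real measure)"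
  by (intro pair_sigma_finite.intro lborel_prod.sigma_finite sigma_finite_lborel)

lemma shear_measurable:
  "(\<lambda>p. (\<lambda>i\<in>I. z i + fst p i + snd p * w i, snd p)) \<in> measurable (lborel_on I \<Otimes>\<^sub>M (lborel::real measure)) (lborel_on I \<Otimes>\<^sub>M lborel)"
  by measurable

text \<open>For a fixed last coordinate \<open>s\<close> the map is the translation by
  \<open>z + s * w\<close>; Tonelli over \<open>s\<close> gives the invariance.\<close>

lemma distr_shear:
  assumes I: "finite I"
  shows "distr (lborel_on I \<Otimes>\<^sub>M lborel) (lborel_on I \<Otimes>\<^sub>M lborel) (\<lambda>p. (\<lambda>i\<in>I. z i + fst p i + snd p * w i, snd p))
    = lborel_on I \<Otimes>\<^sub>M (lborel :: real measure)" (is "distr ?P ?P ?T = ?P")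
proof (rule measure_eqI)
  interpret pair_sigma_finite "lborel_on I" "lborel :: real measure" by (rule pair_sigma_finite_lborel_on[OF I])
  fix A assume "A \<in> sets (distr ?P ?P ?T)"
  then have A[measurable]: "A \<in> sets ?P" by simp
  have "(\<integral>\<^sup>+p. indicator A p \<partial>distr ?P ?P ?T) = (\<integral>\<^sup>+p. indicator A (?T p) \<partial>?P)"
    by (intro nn_integral_distr shear_measurable) auto
  then have "emeasure (distr ?P ?P ?T) A = (\<integral>\<^sup>+p. indicator A (?T p) \<partial>?P)"
    using A by simp
  also have "\<dots> = (\<integral>\<^sup>+s. \<integral>\<^sup>+x. indicator A (?T (x, s)) \<partial>lborel_on I \<partial>lborel)"
    by (subst nn_integral_snd[symmetric]) auto
  also have "\<dots> = (\<integral>\<^sup>+s. \<integral>\<^sup>+x. indicator A (x, s) \<partial>lborel_on I \<partial>lborel)"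
  proof (rule nn_integral_cong)
    fix s :: real
    have "(\<lambda>x. indicator A (x, s) :: ennreal) \<in> borel_measurable (lborel_on I)" by measurable
    from nn_integral_lborel_on_translate[OF I this, of "\<lambda>i. z i + s * w i"]
    show "(\<integral>\<^sup>+x. indicator A (?T (x, s)) \<partial>lborel_on I) = (\<integral>\<^sup>+x. indicator A (x, s) \<partial>lborel_on I)"
      by (simp add: ac_simps)
  qed
  also have "\<dots> = (\<integral>\<^sup>+p. indicator A p \<partial>?P)"
    by (subst nn_integral_snd[symmetric]) auto
  finally show "emeasure (distr ?P ?P ?T) A = emeasure ?P A" using A by simp
qed simp

text \<open>The two cases of the induction: the barycentre of \<open>f\<close> is at the origin, or the origin of the
  duality is chosen depending on \<open>f\<close> alone.\<close>

definition santalo_centered :: "'i set \<Rightarrow> bool" where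
  "santalo_centered I \<longleftrightarrow> (\<forall>(f :: ('i \<Rightarrow> real) \<Rightarrow> real) (g :: ('i \<Rightarrow> real) \<Rightarrow> ennreal) (c::real).
     integrable (lborel_on I) f \<longrightarrow> (\<forall>x. 0 \<le> f x) \<longrightarrow>
     (\<forall>i\<in>I. integrable (lborel_on I) (\<lambda>x. x i * f x) \<and> (LINT x|lborel_on I. x i * f x) = 0) \<longrightarrow>
     g \<in> borel_measurable (lborel_on I) \<longrightarrow> 0 \<le> c \<longrightarrow>
     (\<forall>x\<in>space (lborel_on I). \<forall>y\<in>space (lborel_on I). ennreal (f x) * g y \<le> ennreal (c * exp (- (\<Sum>i\<in>I. x i * y i)))) \<longrightarrow>
     (\<integral>\<^sup>+x. ennreal (f x) \<partial>lborel_on I) * (\<integral>\<^sup>+y. g y \<partial>lborel_on I) \<le> ennreal (c * (2 * pi) ^ card I))"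

definition santalo_some_point :: "'i set \<Rightarrow> bool" where
  "santalo_some_point I \<longleftrightarrow> (\<forall>(f :: ('i \<Rightarrow> real) \<Rightarrow> real) (C::real) (R::real).
     f \<in> borel_measurable (lborel_on I) \<longrightarrow> (\<forall>x. 0 \<le> f x \<and> f x \<le> C) \<longrightarrow>
     (\<forall>x. f x \<noteq> 0 \<longrightarrow> (\<forall>i\<in>I. \<bar>x i\<bar> \<le> R)) \<longrightarrow>
     (\<exists>z. \<forall>(g :: ('i \<Rightarrow> real) \<Rightarrow> ennreal) (c::real).
     g \<in> borel_measurable (lborel_on I) \<longrightarrow> 0 \<le> c \<longrightarrow>
     (\<forall>x\<in>space (lborel_on I). \<forall>y\<in>space (lborel_on I).
        ennreal (f (\<lambda>i\<in>I. z i + x i)) * g y \<le> ennreal (c * exp (- (\<Sum>i\<in>I. x i * y i)))) \<longrightarrow>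
     (\<integral>\<^sup>+x. ennreal (f x) \<partial>lborel_on I) * (\<integral>\<^sup>+y. g y \<partial>lborel_on I) \<le> ennreal (c * (2 * pi) ^ card I)))"

text \<open>The induction step on one side of a hyperplane. \<open>F x\<close> integrates
  \<open>f\<close> over the half-line from \<open>z + x\<close> in direction \<open>(w, 1)\<close>,
  and \<open>G y\<close> integrates \<open>g\<close> along the last axis after the dual shear. On
  such a pair of half-lines the exponent separates into \<open>x \<bullet> y\<close> and
  \<open>s * r\<close>, so \<open>prekopa_leindler_exp\<close> bounds \<open>F x * G y\<close>. The
  hypothesis \<open>bary\<close> says that \<open>F\<close> is centred, which allows the statement
  in one dimension less to be applied to \<open>F\<close> and \<open>G\<close>.\<close>

lemma santalo_half:
  fixes f :: "('i \<Rightarrow> real) \<Rightarrow> real \<Rightarrow> real" and g :: "('i \<Rightarrow> real) \<Rightarrow> real \<Rightarrow> ennreal"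
  assumes I: "finite I" and IH: "santalo_centered I"
    and f[measurable]: "case_prod f \<in> borel_measurable (lborel_on I \<Otimes>\<^sub>M lborel)"
    and g[measurable]: "case_prod g \<in> borel_measurable (lborel_on I \<Otimes>\<^sub>M lborel)"
    and bdd: "\<And>x s. 0 \<le> f x s" "\<And>x s. f x s \<le> C" and supp: "\<And>x s. f x s \<noteq> 0 \<Longrightarrow> \<bar>s\<bar> \<le> R"
    and int: "integrable (lborel_on I \<Otimes>\<^sub>M lborel) (case_prod f)"
    and intx: "\<And>i. i \<in> I \<Longrightarrow> integrable (lborel_on I \<Otimes>\<^sub>M lborel) (\<lambda>(x, s). x i * f x s)"
    and ints: "integrable (lborel_on I \<Otimes>\<^sub>M lborel) (\<lambda>(x, s). s * f x s)"
    and bary: "\<And>i. i \<in> I \<Longrightarrow>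
       (LINT (x, s)|(lborel_on I \<Otimes>\<^sub>M lborel). indicator {0<..} s * ((x i - z i - s * w i) * f x s)) = 0"
    and c: "0 \<le> c"
    and le: "\<And>x y s r. x \<in> space (lborel_on I) \<Longrightarrow> y \<in> space (lborel_on I) \<Longrightarrow> s > 0 \<Longrightarrow> r > 0 \<Longrightarrow>
       f (\<lambda>i\<in>I. z i + x i + s * w i) s * g y (r - (\<Sum>i\<in>I. w i * y i))
         \<le> ennreal (c * exp (- ((\<Sum>i\<in>I. x i * y i) + s * r)))"
  shows "(\<integral>\<^sup>+s. (\<integral>\<^sup>+x. f x s \<partial>lborel_on I) * indicator {0<..} s \<partial>lborel) *
      (\<integral>\<^sup>+y. (\<integral>\<^sup>+r. g y (r - (\<Sum>i\<in>I. w i * y i)) * indicator {0<..} r \<partial>lborel) \<partial>lborel_on I)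
      \<le> ennreal (c * (pi / 2) * (2 * pi) ^ card I)"
proof -
  interpret P: pair_sigma_finite "lborel_on I" "lborel :: real measure" by (rule pair_sigma_finite_lborel_on[OF I])
  let ?P = "lborel_on I \<Otimes>\<^sub>M (lborel :: real measure)"
  let ?T = "\<lambda>p. (\<lambda>i\<in>I. z i + fst p i + snd p * w i, snd p :: real)"
  define J where "J = (indicator {0<..} :: real \<Rightarrow> real)"
  have [measurable]: "J \<in> borel_measurable borel" by (simp add: J_def)
  have J01: "0 \<le> J s" "J s \<le> 1" for s by (auto simp: J_def indicator_def)
  have eJ: "ennreal (J s) = indicator {0<..} s" for s by (simp add: J_def ennreal_indicator)
  define U where "U x s = J s * f (\<lambda>i\<in>I. z i + x i + s * w i) s" for x s
  have U[measurable]: "case_prod U \<in> borel_measurable ?P"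
    unfolding U_def by measurable
  have Jint: "integrable ?P (\<lambda>p. J (snd p) * h p)" if "integrable ?P h" for h
    using that by (rule Bochner_Integration.integrable_bound)
      (use that J01 in \<open>auto simp: abs_mult intro!: mult_left_le_one_le\<close>)
  have shear_int: "integrable ?P (\<lambda>p. h (?T p))" and shear_eq: "(LINT p|?P. h (?T p)) = (LINT p|?P. h p)"
    if h: "integrable ?P h" for h :: "('i \<Rightarrow> real) \<times> real \<Rightarrow> real"
  proof -
    have [measurable]: "h \<in> borel_measurable ?P" using h by auto
    show "integrable ?P (\<lambda>p. h (?T p))"
      using integrable_distr[OF shear_measurable[where I=I and z=z and w=w], where f=h] h by (simp add: distr_shear[OF I])
    show "(LINT p|?P. h (?T p)) = (LINT p|?P. h p)"
      using integral_distr[OF shear_measurable[where I=I and z=z and w=w], where f=h] by (simp add: distr_shear[OF I])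
  qed
  have Uint: "integrable ?P (case_prod U)"
    using shear_int[OF Jint[OF int]] by (simp add: U_def split_beta')
  define F where "F x = (LINT s|lborel. U x s)" for x
  have Fint: "integrable (lborel_on I) F"
    unfolding F_def using P.integrable_fst[OF Uint] by simp
  have Usec: "integrable lborel (U x)" if "x \<in> space (lborel_on I)" for x
  proof (rule integrableI_bounded_set[where A="{-R..R}" and B=C])
    show "U x \<in> borel_measurable lborel" using that by measurable
    show "AE s\<in>{- R..R} in lborel. norm (U x s) \<le> C"
      using bdd J01 unfolding U_def
      by (intro AE_I2 impI) (simp add: abs_mult order_trans[OF mult_left_le_one_le])
    show "AE s in lborel. s \<notin> {- R..R} \<longrightarrow> U x s = 0"
    proof (intro AE_I2 impI)
      fix s assume "s \<notin> {- R..R}"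
      then have "\<not> \<bar>s\<bar> \<le> R" by auto
      then show "U x s = 0" using supp by (auto simp: U_def)
    qed
  qed (auto simp: emeasure_lborel_Icc_eq)
  have Unn: "0 \<le> U x s" for x s using bdd J01 by (auto simp: U_def)
  have Fnn: "ennreal (F x) = (\<integral>\<^sup>+s. U x s \<partial>lborel)" if "x \<in> space (lborel_on I)" for x
    unfolding F_def using Usec[OF that] Unn by (subst nn_integral_eq_integral) auto
  have F0: "0 \<le> F x" for x unfolding F_def using Unn by (intro integral_nonneg_AE) auto
  have xF: "integrable (lborel_on I) (\<lambda>x. x i * F x) \<and> (LINT x|lborel_on I. x i * F x) = 0" if i: "i \<in> I" for i
  proof -
    have zint: "integrable ?P (\<lambda>(x, s). (x i - z i - s * w i) * f x s)"
    proof -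
      have "integrable ?P (\<lambda>p. (case p of (x, s) \<Rightarrow> x i * f x s) - z i * (case p of (x, s) \<Rightarrow> f x s) - w i * (case p of (x, s) \<Rightarrow> s * f x s))"
        using intx[OF i] int ints by (intro Bochner_Integration.integrable_diff integrable_mult_right) auto
      then show ?thesis by (simp add: split_beta' algebra_simps)
    qed
    define h where "h p = J (snd p) * (case p of (x, s) \<Rightarrow> (x i - z i - s * w i) * f x s)" for p
    have hint: "integrable ?P h" unfolding h_def by (rule Jint[OF zint])
    have h0: "(LINT p|?P. h p) = 0"
      using bary[OF i] by (simp add: h_def J_def split_beta')
    \<comment> \<open>The shear turns \<open>x i - z i - s * w i\<close> into \<open>x i\<close>, so
      \<open>bary\<close> becomes the vanishing of the first moments of \<open>U\<close>, and hence
      of \<open>F\<close>.\<close>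
    have hT: "h (?T p) = (case p of (x, s) \<Rightarrow> x i * U x s)" for p
      using i by (auto simp: h_def U_def split: prod.split)
    have 1: "integrable ?P (\<lambda>(x, s). x i * U x s)" using shear_int[OF hint] by (simp add: hT)
    have 2: "(LINT p|?P. (case p of (x, s) \<Rightarrow> x i * U x s)) = 0" using shear_eq[OF hint] h0 by (simp add: hT)
    show ?thesis
      using P.integrable_fst[OF 1] P.integral_fst[OF 1] 2 by (simp add: F_def)
  qed
  define G where "G y = (\<integral>\<^sup>+r. g y (r - (\<Sum>i\<in>I. w i * y i)) * indicator {0<..} r \<partial>lborel)" for y
  have [measurable]: "G \<in> borel_measurable (lborel_on I)"
    unfolding G_def by measurable
  \<comment> \<open>The factor \<open>pi / 2\<close> is the square of the Gaussian integral over the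
    half-line.\<close>
  have FG: "F x * G y \<le> ennreal (c * (pi / 2) * exp (- (\<Sum>i\<in>I. x i * y i)))"
    if x: "x \<in> space (lborel_on I)" and y: "y \<in> space (lborel_on I)" for x y
  proof -
    have Fx: "ennreal (F x) = (\<integral>\<^sup>+s. ennreal (f (\<lambda>i\<in>I. z i + x i + s * w i) s) * indicator {0<..} s \<partial>lborel)"
      unfolding Fnn[OF x] by (intro nn_integral_cong) (auto simp: U_def ennreal_mult bdd J01 eJ ac_simps)
    have "F x * G y \<le> ennreal (c * exp (- (\<Sum>i\<in>I. x i * y i))) *
        (\<integral>\<^sup>+r. ennreal (exp (- (r\<^sup>2 / 2))) * indicator {0<..} r \<partial>lborel)\<^sup>2"
      unfolding Fx G_def
    proof (rule prekopa_leindler_exp)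
      show "(\<lambda>s. ennreal (f (\<lambda>i\<in>I. z i + x i + s * w i) s)) \<in> borel_measurable borel" using x by measurable
      show "(\<lambda>t. g y (t - (\<Sum>i\<in>I. w i * y i))) \<in> borel_measurable borel" using y by measurable
    next
      fix s t :: real assume "0 < s" "0 < t"
      from le[OF x y this]
      show "ennreal (f (\<lambda>i\<in>I. z i + x i + s * w i) s) * g y (t - (\<Sum>i\<in>I. w i * y i))
         \<le> ennreal (c * exp (- (\<Sum>i\<in>I. x i * y i)) * exp (- (s * t)))"
        by (simp add: mult.assoc flip: exp_add)
    qed (use c in simp)
    also have "(\<integral>\<^sup>+r. ennreal (exp (- (r\<^sup>2 / 2))) * indicator {0<..} r \<partial>lborel)\<^sup>2 = ennreal (pi / 2)"
      by (simp add: nn_integral_half_gaussian ennreal_power)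
    finally show ?thesis using c by (simp add: ac_simps flip: ennreal_mult)
  qed
  have "(\<integral>\<^sup>+x. F x \<partial>lborel_on I) * (\<integral>\<^sup>+y. G y \<partial>lborel_on I) \<le> ennreal (c * (pi / 2) * (2 * pi) ^ card I)"
    using IH[unfolded santalo_centered_def, rule_format, of F G "c * (pi / 2)"] Fint F0 xF FG c by auto
  moreover have "(\<integral>\<^sup>+x. F x \<partial>lborel_on I) = (\<integral>\<^sup>+s. (\<integral>\<^sup>+x. f x s \<partial>lborel_on I) * indicator {0<..} s \<partial>lborel)"
  proof -
    have "(\<integral>\<^sup>+x. F x \<partial>lborel_on I) = (\<integral>\<^sup>+x. (\<integral>\<^sup>+s. U x s \<partial>lborel) \<partial>lborel_on I)"
      by (intro nn_integral_cong) (rule Fnn)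
    also have "\<dots> = (\<integral>\<^sup>+s. (\<integral>\<^sup>+x. U x s \<partial>lborel_on I) \<partial>lborel)"
      by (rule P.Fubini'[symmetric]) measurable
    also have "\<dots> = (\<integral>\<^sup>+s. (\<integral>\<^sup>+x. f x s \<partial>lborel_on I) * indicator {0<..} s \<partial>lborel)"
    proof (intro nn_integral_cong)
      fix s :: real
      have [measurable]: "(\<lambda>x. ennreal (f x s)) \<in> borel_measurable (lborel_on I)" by measurable
      have "(\<integral>\<^sup>+x. U x s \<partial>lborel_on I) = (\<integral>\<^sup>+x. ennreal (f (\<lambda>i\<in>I. (z i + s * w i) + x i) s) * indicator {0<..} s \<partial>lborel_on I)"
        by (intro nn_integral_cong) (auto simp: U_def ennreal_mult bdd J01 eJ ac_simps)
      also have "\<dots> = (\<integral>\<^sup>+x. ennreal (f (\<lambda>i\<in>I. (z i + s * w i) + x i) s) \<partial>lborel_on I) * indicator {0<..} s"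
        by (rule nn_integral_multc) measurable
      also have "(\<integral>\<^sup>+x. ennreal (f (\<lambda>i\<in>I. (z i + s * w i) + x i) s) \<partial>lborel_on I) = (\<integral>\<^sup>+x. f x s \<partial>lborel_on I)"
        by (rule nn_integral_lborel_on_translate[OF I]) measurable
      finally show "(\<integral>\<^sup>+x. U x s \<partial>lborel_on I) = (\<integral>\<^sup>+x. f x s \<partial>lborel_on I) * indicator {0<..} s" .
    qed
    finally show ?thesis .
  qed
  ultimately show ?thesis by (simp add: G_def)
qed


lemma integrable_lborel_on_box:
  fixes f :: "('i \<Rightarrow> real) \<Rightarrow> real"
  assumes I: "finite I" and f: "f \<in> borel_measurable (lborel_on I)"
    and bdd: "\<And>x. x \<in> space (lborel_on I) \<Longrightarrow> (\<And>i. i \<in> I \<Longrightarrow> \<bar>x i\<bar> \<le> R) \<Longrightarrow> \<bar>f x\<bar> \<le> C"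
    and supp: "\<And>x i. f x \<noteq> 0 \<Longrightarrow> i \<in> I \<Longrightarrow> \<bar>x i\<bar> \<le> R"
  shows "integrable (lborel_on I) f"
proof (rule integrableI_bounded_set[where A="Pi\<^sub>E I (\<lambda>_. {-R..R})" and B=C])
  show "emeasure (lborel_on I) (Pi\<^sub>E I (\<lambda>_. {-R..R})) < \<infinity>"
    using I by (subst lborel_prod.emeasure_PiM) (auto simp: emeasure_lborel_Icc_eq power_less_top_ennreal)
  show "AE x\<in>Pi\<^sub>E I (\<lambda>_. {-R..R}) in lborel_on I. norm (f x) \<le> C"
  proof (intro AE_I2 impI)
    fix x assume x: "x \<in> space (lborel_on I)" "x \<in> Pi\<^sub>E I (\<lambda>_. {-R..R})"
    then have "\<bar>x i\<bar> \<le> R" if "i \<in> I" for i using that by (fastforce simp: PiE_iff abs_le_iff)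
    then show "norm (f x) \<le> C" using bdd x by simp
  qed
  show "AE x in lborel_on I. x \<notin> Pi\<^sub>E I (\<lambda>_. {-R..R}) \<longrightarrow> f x = 0"
  proof (intro AE_I2 impI)
    fix x assume x: "x \<in> space (lborel_on I)" "x \<notin> Pi\<^sub>E I (\<lambda>_. {-R..R})"
    have "\<not> (\<forall>i\<in>I. \<bar>x i\<bar> \<le> R)"
    proof
      assume *: "\<forall>i\<in>I. \<bar>x i\<bar> \<le> R"
      then have "- R \<le> x i" "x i \<le> R" if "i \<in> I" for i using that by (auto dest!: bspec)
      then show False using x by (auto simp: space_PiM PiE_iff)
    qed
    then show "f x = 0" using supp by metis
  qed
qed (use I f in \<open>auto intro: sets_PiM_I_finite\<close>)

lemma integrable_pair_box:
  fixes f :: "('i \<Rightarrow> real) \<times> real \<Rightarrow> real"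
  assumes I: "finite I" and f: "f \<in> borel_measurable (lborel_on I \<Otimes>\<^sub>M lborel)"
    and bdd: "\<And>x s. (\<And>i. i \<in> I \<Longrightarrow> \<bar>x i\<bar> \<le> R) \<Longrightarrow> \<bar>s\<bar> \<le> R \<Longrightarrow> \<bar>f (x, s)\<bar> \<le> C"
    and supp: "\<And>x s i. f (x, s) \<noteq> 0 \<Longrightarrow> i \<in> I \<Longrightarrow> \<bar>x i\<bar> \<le> R" "\<And>x s. f (x, s) \<noteq> 0 \<Longrightarrow> \<bar>s\<bar> \<le> R"
  shows "integrable (lborel_on I \<Otimes>\<^sub>M lborel) f"
proof (rule integrableI_bounded_set[where A="Pi\<^sub>E I (\<lambda>_. {-R..R}) \<times> {-R..R}" and B=C])
  interpret pair_sigma_finite "lborel_on I" "lborel :: real measure" by (rule pair_sigma_finite_lborel_on[OF I])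
  have m: "Pi\<^sub>E I (\<lambda>_. {-R..R}) \<in> sets (lborel_on I)" using I by (auto intro: sets_PiM_I_finite)
  then show "Pi\<^sub>E I (\<lambda>_. {-R..R}) \<times> {-R..R} \<in> sets (lborel_on I \<Otimes>\<^sub>M lborel)" by auto
  show "emeasure (lborel_on I \<Otimes>\<^sub>M lborel) (Pi\<^sub>E I (\<lambda>_. {-R..R}) \<times> {-R..R}) < \<infinity>"
    using I m by (subst lborel.emeasure_pair_measure_Times, simp, simp, subst lborel_prod.emeasure_PiM)
      (auto simp: emeasure_lborel_Icc_eq ennreal_mult_less_top power_less_top_ennreal)
  show "AE p\<in>Pi\<^sub>E I (\<lambda>_. {-R..R}) \<times> {-R..R} in lborel_on I \<Otimes>\<^sub>M lborel. norm (f p) \<le> C"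
  proof (intro AE_I2 impI)
    fix p assume p: "p \<in> Pi\<^sub>E I (\<lambda>_. {-R..R}) \<times> {-R..R}"
    obtain x s where ps: "p = (x, s)" by fastforce
    have "\<bar>x i\<bar> \<le> R" if "i \<in> I" for i using that p by (fastforce simp: ps PiE_iff abs_le_iff)
    moreover have "\<bar>s\<bar> \<le> R" using p by (auto simp: ps)
    ultimately show "norm (f p) \<le> C" using bdd ps by simp
  qed
  show "AE p in lborel_on I \<Otimes>\<^sub>M lborel. p \<notin> Pi\<^sub>E I (\<lambda>_. {-R..R}) \<times> {-R..R} \<longrightarrow> f p = 0"
  proof (intro AE_I2 impI)
    fix p assume p: "p \<in> space (lborel_on I \<Otimes>\<^sub>M lborel)" "p \<notin> Pi\<^sub>E I (\<lambda>_. {-R..R}) \<times> {-R..R}"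
    obtain x s where ps: "p = (x, s)" by fastforce
    have "\<not> (\<bar>s\<bar> \<le> R \<and> (\<forall>i\<in>I. \<bar>x i\<bar> \<le> R))"
    proof
      assume *: "\<bar>s\<bar> \<le> R \<and> (\<forall>i\<in>I. \<bar>x i\<bar> \<le> R)"
      then have "- R \<le> x i" "x i \<le> R" if "i \<in> I" for i using that by (auto dest!: bspec)
      then show False using p * by (auto simp: ps space_pair_measure space_PiM PiE_iff)
    qed
    then show "f p = 0" using supp ps by metis
  qed
qed (use f in auto)

text \<open>A measure with a density has no atoms, so its distribution function is continuous and
  takes the value \<open>m / 2\<close>; for the same reason both open half-lines carry exactly half
  of the mass.\<close>

lemma exists_median:
  fixes \<phi> :: "real \<Rightarrow> ennreal"
  assumes [measurable]: "\<phi> \<in> borel_measurable borel" and tot: "(\<integral>\<^sup>+s. \<phi> s \<partial>lborel) = ennreal m" and m: "0 < m"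
  obtains t where "(\<integral>\<^sup>+s. \<phi> s * indicator {..<t} s \<partial>lborel) = ennreal (m / 2)"
    "(\<integral>\<^sup>+s. \<phi> s * indicator {t<..} s \<partial>lborel) = ennreal (m / 2)"
proof -
  define D where "D = density lborel \<phi>"
  have [simp]: "sets D = sets borel" "space D = UNIV" by (auto simp: D_def)
  have eD: "emeasure D A = (\<integral>\<^sup>+s. \<phi> s * indicator A s \<partial>lborel)" if "A \<in> sets borel" for A
    unfolding D_def using that by (subst emeasure_density) auto
  have "emeasure D UNIV = ennreal m" by (subst eD) (auto simp: tot)
  then have mD: "measure D UNIV = m" using m by (simp add: measure_def)
  have "finite_measure D" using \<open>emeasure D UNIV = ennreal m\<close> by (intro finite_measureI) auto
  then interpret D: finite_measure D .
  interpret D: finite_borel_measure D by unfold_locales simp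
  have sing: "measure D {x} = 0" for x
  proof -
    have "emeasure D {x} = 0" using eD[of "{x}"] by simp
    then show ?thesis by (simp add: measure_def)
  qed
  have cont: "isCont (cdf D) x" for x
    using sing by (simp add: D.isCont_cdf)
  have "eventually (\<lambda>x. cdf D x < m / 2) at_bot"
    using D.cdf_lim_at_bot m by (intro order_tendstoD) auto
  then obtain a where a: "cdf D a < m / 2"
    by (auto simp: eventually_at_bot_linorder)
  have "eventually (\<lambda>x. m / 2 < cdf D x) at_top"
    using D.cdf_lim_at_top m mD by (intro order_tendstoD) auto
  then obtain b where b: "m / 2 < cdf D b"
    by (auto simp: eventually_at_top_linorder)
  have "a \<le> b" using D.cdf_nondecreasing[of b a] a b by linarith
  then obtain t where t: "cdf D t = m / 2"
    using IVT[of "cdf D" a "m/2" b] a b cont by auto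
  have "measure D {..t} = measure D {..<t} + measure D {t}"
    by (subst D.finite_measure_Union[symmetric]) (auto simp: ivl_disj_un intro!: arg_cong[of _ _ "measure D"])
  then have 1: "measure D {..<t} = m / 2" using t sing by (simp add: cdf_def)
  have "measure D (space D - {..t}) = m - m / 2"
    using t mD by (subst D.finite_measure_compl) (auto simp: cdf_def)
  moreover have "space D - {..t} = {t<..}" by auto
  ultimately have 2: "measure D {t<..} = m / 2" by simp
  show ?thesis
  proof
    show "(\<integral>\<^sup>+s. \<phi> s * indicator {..<t} s \<partial>lborel) = ennreal (m / 2)"
      using eD[of "{..<t}"] 1 by (simp add: D.emeasure_eq_measure)
    show "(\<integral>\<^sup>+s. \<phi> s * indicator {t<..} s \<partial>lborel) = ennreal (m / 2)"
      using eD[of "{t<..}"] 2 by (simp add: D.emeasure_eq_measure)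
  qed
qed

text \<open>The hyperplane at the median \<open>t\<close> of coordinate \<open>k\<close> halves the
  mass of \<open>f\<close>. The line through the barycentres of the two halves meets this hyperplane
  in \<open>z(k := t)\<close>, the origin sought, and a shear along the line centres each half. The
  dual function is cut by the hyperplane orthogonal to that line, and \<open>santalo_half\<close>
  treats the two sides separately.\<close>

lemma santalo_step:
  fixes k :: 'i
  assumes I: "finite I" and k: "k \<notin> I" and IH: "santalo_centered I"
  shows "santalo_some_point (insert k I)"
  unfolding santalo_some_point_def
proof (intro allI impI)
  fix f :: "('i \<Rightarrow> real) \<Rightarrow> real" and C R :: real
  assume f[measurable]: "f \<in> borel_measurable (lborel_on (insert k I))"
    and bdd': "\<forall>x. 0 \<le> f x \<and> f x \<le> C" and supp': "\<forall>x. f x \<noteq> 0 \<longrightarrow> (\<forall>i\<in>insert k I. \<bar>x i\<bar> \<le> R)"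
  interpret P: pair_sigma_finite "lborel_on I" "lborel :: real measure" by (rule pair_sigma_finite_lborel_on[OF I])
  let ?P = "lborel_on I \<Otimes>\<^sub>M (lborel :: real measure)"
  let ?N = "lborel_on (insert k I)"
  show "\<exists>z. \<forall>g c. g \<in> borel_measurable ?N \<longrightarrow> 0 \<le> c \<longrightarrow>
     (\<forall>x\<in>space ?N. \<forall>y\<in>space ?N. ennreal (f (\<lambda>i\<in>insert k I. z i + x i)) * g y
           \<le> ennreal (c * exp (- (\<Sum>i\<in>insert k I. x i * y i)))) \<longrightarrow>
     (\<integral>\<^sup>+x. f x \<partial>?N) * (\<integral>\<^sup>+y. g y \<partial>?N) \<le> ennreal (c * (2 * pi) ^ card (insert k I))"
  proof (cases "(\<integral>\<^sup>+x. f x \<partial>?N) = 0")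
    case True
    then show ?thesis by simp
  next
    case False
    \<comment> \<open>Measurability with coordinate \<open>k\<close> singled out as a separate
      argument, in a form that serves \<open>f1\<close> and \<open>g1\<close> alike.\<close>
    have upd: "(\<lambda>p. h (a p) (b p)) \<in> borel_measurable M"
      if "h = (\<lambda>x s. u (x(k := s)))" "u \<in> borel_measurable ?N" "a \<in> measurable M (lborel_on I)" "b \<in> borel_measurable M"
      for h :: "_ \<Rightarrow> _ \<Rightarrow> 'z::topological_space" and u a b and M :: "'x measure"
    proof -
      have "(\<lambda>p. (a p)(k := b p)) \<in> measurable M ?N"
        using measurable_compose[OF measurable_Pair[OF that(3), of b lborel] measurable_add_dim[of k I "\<lambda>_. lborel"]] that(4)
        by (simp add: split_beta')
      from measurable_compose[OF this that(2)] show ?thesis by (simp add: that(1))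
    qed
    define f1 where "f1 x s = f (x(k := s))" for x s
    note f1_meas = upd[of f1 f, OF _ f, unfolded f1_def[abs_def], OF refl, folded f1_def]
    have f1_nn: "0 \<le> f1 x s" "f1 x s \<le> C" for x s using bdd' by (auto simp: f1_def)
    have f1_supp: "\<bar>s\<bar> \<le> R" "i \<in> I \<Longrightarrow> \<bar>x i\<bar> \<le> R" if "f1 x s \<noteq> 0" for x s i
      using supp'[rule_format, OF that[unfolded f1_def], of k] supp'[rule_format, OF that[unfolded f1_def], of i] k by (auto split: if_splits)
    have tot: "(\<integral>\<^sup>+x. f x \<partial>?N) = (\<integral>\<^sup>+s. \<integral>\<^sup>+x. f1 x s \<partial>lborel_on I \<partial>lborel)"
      unfolding f1_def by (rule lborel_prod.product_nn_integral_insert_rev[OF I k]) measurable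
    have "integrable ?N f"
      proof (rule integrable_lborel_on_box[where R=R and C=C])
      show "\<bar>f x\<bar> \<le> C" for x using bdd'[rule_format, of x] by simp
      show "\<bar>x i\<bar> \<le> R" if "f x \<noteq> 0" "i \<in> insert k I" for x i using supp' that by blast
    qed (use I f in simp_all)
    define m where "m = (LINT x|?N. f x)"
    have m: "(\<integral>\<^sup>+x. f x \<partial>?N) = ennreal m"
      unfolding m_def using \<open>integrable ?N f\<close> bdd' by (intro nn_integral_eq_integral) auto
    then have m0: "m > 0" using False by (cases "m > 0") (auto simp: not_less ennreal_neg)
    define \<phi> where "\<phi> s = (\<integral>\<^sup>+x. f1 x s \<partial>lborel_on I)" for s
    have pm: "(\<lambda>p. f1 (fst p) (snd p)) \<in> borel_measurable ?P" by (rule f1_meas) auto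
    have pm': "(\<lambda>p. f1 (snd p) (fst p)) \<in> borel_measurable (lborel \<Otimes>\<^sub>M lborel_on I)" by (rule f1_meas) auto
    have [measurable]: "\<phi> \<in> borel_measurable borel"
    proof -
      have "(\<lambda>s. \<integral>\<^sup>+x. f1 x s \<partial>lborel_on I) \<in> borel_measurable lborel"
        using pm' by (intro P.M1.borel_measurable_nn_integral) (simp add: split_beta')
      then show ?thesis by (simp add: \<phi>_def[abs_def])
    qed
    obtain t where t: "(\<integral>\<^sup>+s. \<phi> s * indicator {..<t} s \<partial>lborel) = ennreal (m / 2)"
      "(\<integral>\<^sup>+s. \<phi> s * indicator {t<..} s \<partial>lborel) = ennreal (m / 2)"
      using exists_median[of \<phi> m] tot m m0 by (auto simp: \<phi>_def)
    \<comment> \<open>\<open>\<epsilon> = 1\<close> and \<open>\<epsilon> = -1\<close> stand for the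
      two sides of the hyperplane, both parametrised by the distance \<open>s > 0\<close> from
      it.\<close>
    define h where "h \<epsilon> x s = f1 x (t + \<epsilon> * s)" for \<epsilon> x s
    define R' where "R' = \<bar>R\<bar> + \<bar>t\<bar>"
    have h_nn: "0 \<le> h \<epsilon> x s" "h \<epsilon> x s \<le> C" for \<epsilon> x s by (auto simp: h_def f1_nn)
    have h_supp: "\<bar>s\<bar> \<le> R'" "i \<in> I \<Longrightarrow> \<bar>x i\<bar> \<le> R'" if "h \<epsilon> x s \<noteq> 0" "\<bar>\<epsilon>\<bar> = 1" for \<epsilon> x s i
    proof -
      have "\<bar>\<epsilon> * s\<bar> = \<bar>s\<bar>" using that by (simp add: abs_mult)
      then show "\<bar>s\<bar> \<le> R'" using f1_supp(1)[of x "t + \<epsilon> * s"] that by (auto simp: h_def R'_def)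
      show "\<bar>x i\<bar> \<le> R'" if "i \<in> I" using f1_supp(2)[of x "t + \<epsilon> * s" i] that \<open>h \<epsilon> x s \<noteq> 0\<close>
        by (auto simp: h_def R'_def)
    qed
    have h_meas: "case_prod (h \<epsilon>) \<in> borel_measurable ?P" for \<epsilon>
    proof -
      have "(\<lambda>p. f1 (fst p) (t + \<epsilon> * snd p)) \<in> borel_measurable ?P" by (rule f1_meas) auto
      then show ?thesis by (simp add: h_def split_beta')
    qed
    have h_int: "integrable ?P (\<lambda>p. u p * (case p of (x, s) \<Rightarrow> h \<epsilon> x s))"
      if \<epsilon>: "\<bar>\<epsilon>\<bar> = 1" and u[measurable]: "u \<in> borel_measurable ?P"
        and ub: "\<And>x s. (\<And>i. i \<in> I \<Longrightarrow> \<bar>x i\<bar> \<le> R') \<Longrightarrow> \<bar>s\<bar> \<le> R' \<Longrightarrow> \<bar>u (x, s)\<bar> \<le> B" for u \<epsilon> B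
    proof (rule integrable_pair_box[OF I, where R=R' and C="B * C"])
      show "(\<lambda>p. u p * (case p of (x, s) \<Rightarrow> h \<epsilon> x s)) \<in> borel_measurable ?P"
        using h_meas[of \<epsilon>] by measurable
      show "\<bar>u (x, s) * (case (x, s) of (x, s) \<Rightarrow> h \<epsilon> x s)\<bar> \<le> B * C"
        if that: "\<And>i. i \<in> I \<Longrightarrow> \<bar>x i\<bar> \<le> R'" "\<bar>s\<bar> \<le> R'" for x s
      proof -
        have uB: "\<bar>u (x, s)\<bar> \<le> B" by (rule ub) (fact that)+
        then have "0 \<le> B" by linarith
        then show ?thesis using uB h_nn[of \<epsilon> x s] by (simp add: abs_mult mult_mono)
      qed
    qed (use h_supp[OF _ \<epsilon>] in auto)
    have R'0: "0 \<le> R'" by (simp add: R'_def)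
    have int1: "integrable ?P (case_prod (h \<epsilon>))" if "\<bar>\<epsilon>\<bar> = 1" for \<epsilon>
      using h_int[OF that, of "\<lambda>_. 1" 1] by simp
    have ints: "integrable ?P (\<lambda>(x, s). s * h \<epsilon> x s)" if "\<bar>\<epsilon>\<bar> = 1" for \<epsilon>
      using h_int[OF that, of snd R'] by (simp add: split_beta')
    have intx: "integrable ?P (\<lambda>(x, s). x i * h \<epsilon> x s)" if "\<bar>\<epsilon>\<bar> = 1" "i \<in> I" for \<epsilon> i
      using h_int[OF that(1), of "\<lambda>p. fst p i" R'] that(2) by (simp add: split_beta')
    define J where "J = (indicator {0<..} :: real \<Rightarrow> real)"
    have [measurable]: "J \<in> borel_measurable borel" by (simp add: J_def)
    have J01: "0 \<le> J s" "J s \<le> 1" for s by (auto simp: J_def indicator_def)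
    have Jint: "integrable ?P (\<lambda>(x, s). J s * u x s)" if "integrable ?P (case_prod u)" for u
      using that by (rule Bochner_Integration.integrable_bound)
        (use that J01 in \<open>auto simp: split_beta' abs_mult intro!: AE_I2 mult_left_le_one_le\<close>)
    have half: "(\<integral>\<^sup>+s. (\<integral>\<^sup>+x. h \<epsilon> x s \<partial>lborel_on I) * indicator {0<..} s \<partial>lborel) = ennreal (m / 2)"
      if \<epsilon>: "\<epsilon> = 1 \<or> \<epsilon> = -1" for \<epsilon> :: real
    proof -
      define A where "A = (if \<epsilon> = 1 then {t<..} else {..<t})"
      have [measurable]: "A \<in> sets borel" by (simp add: A_def)
      have "ennreal (m / 2) = (\<integral>\<^sup>+s. \<phi> s * indicator A s \<partial>lborel)" using t by (simp add: A_def)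
      also have "\<dots> = \<bar>\<epsilon>\<bar> * (\<integral>\<^sup>+s. \<phi> (t + \<epsilon> * s) * indicator A (t + \<epsilon> * s) \<partial>lborel)"
        using \<epsilon> by (intro nn_integral_real_affine) auto
      also have "\<dots> = (\<integral>\<^sup>+s. (\<integral>\<^sup>+x. h \<epsilon> x s \<partial>lborel_on I) * indicator {0<..} s \<partial>lborel)"
        using \<epsilon> by (auto simp: \<phi>_def h_def A_def indicator_def intro!: nn_integral_cong)
      finally show ?thesis by simp
    qed
    \<comment> \<open>First moments of a half, not divided by its mass \<open>m / 2\<close>:
      \<open>b\<close> in the coordinates of \<open>I\<close>, \<open>\<sigma>\<close> in the
      distance from the hyperplane.\<close>
    define b where "b \<epsilon> i = (LINT (x, s)|?P. J s * (x i * h \<epsilon> x s))" for \<epsilon> i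
    define \<sigma> where "\<sigma> \<epsilon> = (LINT (x, s)|?P. J s * (s * h \<epsilon> x s))" for \<epsilon>
    have mass: "(LINT (x, s)|?P. J s * h \<epsilon> x s) = m / 2" if \<epsilon>: "\<epsilon> = 1 \<or> \<epsilon> = -1" for \<epsilon>
    proof -
      have "\<bar>\<epsilon>\<bar> = 1" using \<epsilon> by auto
      have "ennreal (LINT (x, s)|?P. J s * h \<epsilon> x s) = (\<integral>\<^sup>+p. (case p of (x, s) \<Rightarrow> J s * h \<epsilon> x s) \<partial>?P)"
        using Jint[OF int1[OF \<open>\<bar>\<epsilon>\<bar> = 1\<close>]] J01 h_nn by (intro nn_integral_eq_integral[symmetric]) auto
      also have "\<dots> = (\<integral>\<^sup>+s. \<integral>\<^sup>+x. J s * h \<epsilon> x s \<partial>lborel_on I \<partial>lborel)"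
        using h_meas[of \<epsilon>] by (subst P.nn_integral_snd[symmetric]) auto
      also have "\<dots> = (\<integral>\<^sup>+s. (\<integral>\<^sup>+x. h \<epsilon> x s \<partial>lborel_on I) * indicator {0<..} s \<partial>lborel)"
        by (intro nn_integral_cong) (auto simp: J_def indicator_def)
      also have "\<dots> = ennreal (m / 2)" by (rule half[OF \<epsilon>])
      finally show ?thesis
        using m0 J01 h_nn by (subst (asm) ennreal_inj) (auto intro!: integral_nonneg_AE)
    qed
    \<comment> \<open>For \<open>s > 0\<close> the integrand of \<open>\<sigma>\<close> vanishes
      only where \<open>h\<close> does, so \<open>\<sigma> \<epsilon> = 0\<close> would leave this
      half without mass.\<close>
    have \<sigma>0: "\<sigma> \<epsilon> > 0" if \<epsilon>: "\<epsilon> = 1 \<or> \<epsilon> = -1" for \<epsilon>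
    proof (rule ccontr)
      assume neg: "\<not> \<sigma> \<epsilon> > 0"
      have "\<bar>\<epsilon>\<bar> = 1" using \<epsilon> by auto
      have nn: "0 \<le> (case p of (x, s) \<Rightarrow> J s * (s * h \<epsilon> x s))" for p
        using h_nn by (auto simp: J_def indicator_def split: prod.split)
      have "\<sigma> \<epsilon> = 0" using neg nn by (auto simp: \<sigma>_def not_less intro!: antisym integral_nonneg_AE)
      then have "AE p in ?P. (case p of (x, s) \<Rightarrow> J s * (s * h \<epsilon> x s)) = 0"
        unfolding \<sigma>_def using integral_nonneg_eq_0_iff_AE[OF Jint[OF ints[OF \<open>\<bar>\<epsilon>\<bar> = 1\<close>]]] nn by auto
      then have "AE p in ?P. (case p of (x, s) \<Rightarrow> J s * h \<epsilon> x s) = 0"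
        by eventually_elim (auto simp: J_def indicator_def split: prod.splits if_splits)
      then have "(LINT (x, s)|?P. J s * h \<epsilon> x s) = 0"
        by (rule integral_eq_zero_AE)
      then show False using mass[OF \<epsilon>] m0 by simp
    qed
    \<comment> \<open>The solution of \<open>b \<epsilon> i = z i * (m / 2) + \<epsilon> * w i *
      \<sigma> \<epsilon>\<close> for \<open>\<epsilon> = 1\<close> and
      \<open>\<epsilon> = -1\<close>: \<open>w\<close> is the slope of the line through the two
      barycentres, \<open>z\<close> its intersection with the hyperplane.\<close>
    define w where "w i = (b 1 i - b (-1) i) / (\<sigma> 1 + \<sigma> (-1))" for i
    define z where "z i = (b 1 i - w i * \<sigma> 1) / (m / 2)" for i
    have bary0: "b \<epsilon> i - z i * (m / 2) - \<epsilon> * w i * \<sigma> \<epsilon> = 0" if \<epsilon>: "\<epsilon> = 1 \<or> \<epsilon> = -1" for \<epsilon> i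
    proof -
      have "\<sigma> 1 + \<sigma> (-1) > 0" using \<sigma>0[of 1] \<sigma>0[of "-1"] by simp
      then have w: "w i * \<sigma> 1 + w i * \<sigma> (-1) = b 1 i - b (-1) i"
        unfolding w_def by (simp add: field_simps flip: add_divide_distrib)
      have "z i * (m / 2) = b 1 i - w i * \<sigma> 1" using m0 by (simp add: z_def)
      then show ?thesis using \<epsilon> w by (auto simp: field_simps)
    qed
    have bary: "(LINT (x, s)|?P. indicator {0<..} s * ((x i - z i - s * (\<epsilon> * w i)) * h \<epsilon> x s)) = 0"
      if \<epsilon>: "\<epsilon> = 1 \<or> \<epsilon> = -1" and i: "i \<in> I" for \<epsilon> i
    proof -
      have e1: "\<bar>\<epsilon>\<bar> = 1" using \<epsilon> by auto
      have "(LINT (x, s)|?P. indicator {0<..} s * ((x i - z i - s * (\<epsilon> * w i)) * h \<epsilon> x s))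
        = (LINT p|?P. (case p of (x, s) \<Rightarrow> J s * (x i * h \<epsilon> x s)) - z i * (case p of (x, s) \<Rightarrow> J s * h \<epsilon> x s)
            - (\<epsilon> * w i) * (case p of (x, s) \<Rightarrow> J s * (s * h \<epsilon> x s)))"
        by (intro Bochner_Integration.integral_cong) (auto simp: J_def algebra_simps)
      also have "\<dots> = b \<epsilon> i - z i * (m / 2) - \<epsilon> * w i * \<sigma> \<epsilon>"
        using Jint[OF intx[OF e1 i]] Jint[OF int1[OF e1]] Jint[OF ints[OF e1]]
        by (simp add: b_def \<sigma>_def mass[OF \<epsilon>])
      finally show ?thesis using bary0[OF \<epsilon>] by simp
    qed
    show ?thesis
    proof (intro exI[of _ "z(k := t)"] allI impI)
      fix g :: "('i \<Rightarrow> real) \<Rightarrow> ennreal" and c :: real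
      assume g[measurable]: "g \<in> borel_measurable ?N" and c: "0 \<le> c"
        and le: "\<forall>x\<in>space ?N. \<forall>y\<in>space ?N. ennreal (f (\<lambda>i\<in>insert k I. (z(k := t)) i + x i)) * g y
           \<le> ennreal (c * exp (- (\<Sum>i\<in>insert k I. x i * y i)))"
      define g1 where "g1 y r = g (y(k := r))" for y r
      note g1_meas = upd[of g1 g, OF _ g, unfolded g1_def[abs_def], OF refl, folded g1_def]
      define W where "W y = (\<Sum>i\<in>I. w i * y i)" for y
      have [measurable]: "W \<in> borel_measurable (lborel_on I)" unfolding W_def by measurable
      define G where "G \<epsilon> = (\<integral>\<^sup>+y. (\<integral>\<^sup>+r. g1 y (\<epsilon> * r - W y) * indicator {0<..} r \<partial>lborel) \<partial>lborel_on I)" for \<epsilon>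
      have GK: "ennreal (m / 2) * G \<epsilon> \<le> ennreal (c * (pi / 2) * (2 * pi) ^ card I)"
        if \<epsilon>: "\<epsilon> = 1 \<or> \<epsilon> = -1" for \<epsilon>
      proof -
        have e1: "\<bar>\<epsilon>\<bar> = 1" "\<epsilon> * \<epsilon> = 1" using \<epsilon> by auto
        have "(\<integral>\<^sup>+s. (\<integral>\<^sup>+x. h \<epsilon> x s \<partial>lborel_on I) * indicator {0<..} s \<partial>lborel) *
          (\<integral>\<^sup>+y. (\<integral>\<^sup>+r. g1 y (\<epsilon> * (r - (\<Sum>i\<in>I. (\<epsilon> * w i) * y i))) * indicator {0<..} r \<partial>lborel) \<partial>lborel_on I)
          \<le> ennreal (c * (pi / 2) * (2 * pi) ^ card I)"
        proof (rule santalo_half[OF I IH, where C=C and R=R' and z=z])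
          show "case_prod (h \<epsilon>) \<in> borel_measurable ?P" by (rule h_meas)
          have "(\<lambda>p. g1 (fst p) (\<epsilon> * snd p)) \<in> borel_measurable ?P" by (rule g1_meas) auto
          then show "(\<lambda>(y, r). g1 y (\<epsilon> * r)) \<in> borel_measurable ?P" by (simp add: split_beta')
          show "integrable ?P (case_prod (h \<epsilon>))" by (rule int1[OF e1(1)])
          fix x y :: "'i \<Rightarrow> real" and s r :: real
          assume x: "x \<in> space (lborel_on I)" and y: "y \<in> space (lborel_on I)"
          \<comment> \<open>The sheared point and the dual coordinate at which \<open>le\<close> is
            applied. The terms in \<open>w\<close> cancel because
            \<open>\<epsilon> * \<epsilon> = 1\<close>, which leaves the exponent that
            \<open>santalo_half\<close> expects.\<close>
          define X where "X = (\<lambda>i\<in>insert k I. if i = k then \<epsilon> * s else x i + s * (\<epsilon> * w i))"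
          define q where "q = \<epsilon> * (r - (\<Sum>i\<in>I. (\<epsilon> * w i) * y i))"
          have "X \<in> space ?N" "y(k := q) \<in> space ?N"
            using x y by (auto simp: X_def space_PiM PiE_iff extensional_def)
          from le[rule_format, OF this]
          have "ennreal (f (\<lambda>i\<in>insert k I. (z(k := t)) i + X i)) * g (y(k := q))
             \<le> ennreal (c * exp (- (\<Sum>i\<in>insert k I. X i * (y(k := q)) i)))" .
          also have "(\<lambda>i\<in>insert k I. (z(k := t)) i + X i) = (\<lambda>i\<in>I. z i + x i + s * (\<epsilon> * w i))(k := t + \<epsilon> * s)"
            using k by (auto simp: X_def fun_eq_iff)
          also have "(\<Sum>i\<in>insert k I. X i * (y(k := q)) i) = \<epsilon> * s * q + (\<Sum>i\<in>I. (x i + s * (\<epsilon> * w i)) * y i)"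
            using I k by (subst sum.insert) (auto simp: X_def intro!: sum.cong)
          also have "\<dots> = (\<Sum>i\<in>I. x i * y i) + s * r"
          proof -
            have "\<epsilon> * s * q = (\<epsilon> * \<epsilon>) * s * (r - (\<Sum>i\<in>I. (\<epsilon> * w i) * y i))" by (simp add: q_def)
            also have "\<dots> = s * r - (\<Sum>i\<in>I. s * (\<epsilon> * w i) * y i)"
              by (simp add: e1 algebra_simps sum_distrib_left)
            finally show ?thesis by (simp add: algebra_simps sum.distrib)
          qed
          finally show "ennreal (h \<epsilon> (\<lambda>i\<in>I. z i + x i + s * (\<epsilon> * w i)) s) *
              g1 y (\<epsilon> * (r - (\<Sum>i\<in>I. (\<epsilon> * w i) * y i))) \<le> ennreal (c * exp (- ((\<Sum>i\<in>I. x i * y i) + s * r)))"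
            by (simp only: h_def f1_def g1_def q_def)
        qed (use h_nn h_supp(1)[OF _ e1(1)] intx[OF e1(1)] ints[OF e1(1)] bary[OF \<epsilon>] c in auto)
        moreover have "\<epsilon> * (r - (\<Sum>i\<in>I. (\<epsilon> * w i) * y i)) = \<epsilon> * r - W y" for r y
        proof -
          have "\<epsilon> * (r - (\<Sum>i\<in>I. (\<epsilon> * w i) * y i)) = \<epsilon> * r - (\<Sum>i\<in>I. (\<epsilon> * \<epsilon>) * (w i * y i))"
            by (simp add: right_diff_distrib sum_distrib_left mult.assoc)
          then show ?thesis by (simp add: e1 W_def)
        qed
        ultimately show ?thesis by (simp add: half[OF \<epsilon>] G_def)
      qed
      have "(\<integral>\<^sup>+y. g y \<partial>?N) = (\<integral>\<^sup>+y. (\<integral>\<^sup>+r. g1 y r \<partial>lborel) \<partial>lborel_on I)"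
        unfolding g1_def by (rule lborel_prod.product_nn_integral_insert[OF I k]) measurable
      \<comment> \<open>Translating \<open>r\<close> by \<open>W y\<close> and cutting at 0 amounts
        to cutting the dual space along \<open>r + W y = 0\<close>.\<close>
      also have "\<dots> = (\<integral>\<^sup>+y. (\<integral>\<^sup>+r. g1 y (1 * r - W y) * indicator {0<..} r \<partial>lborel)
         + (\<integral>\<^sup>+r. g1 y (-1 * r - W y) * indicator {0<..} r \<partial>lborel) \<partial>lborel_on I)"
      proof (rule nn_integral_cong)
        fix y assume y: "y \<in> space (lborel_on I)"
        have [measurable]: "g1 y \<in> borel_measurable borel"
          by (rule g1_meas) (use y in auto)
        have "(\<integral>\<^sup>+r. g1 y r \<partial>lborel) = (\<integral>\<^sup>+r. g1 y (1 * r - W y) \<partial>lborel)"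
          using nn_integral_real_affine[of "g1 y" 1 "- W y"] by simp
        also have "\<dots> = (\<integral>\<^sup>+r. g1 y (1 * r - W y) * indicator {0<..} r + g1 y (1 * r - W y) * indicator {..<0} r \<partial>lborel)"
        proof (rule nn_integral_cong_AE)
          have "AE r in lborel. r \<noteq> (0::real)" by (rule AE_lborel_singleton)
          then show "AE r in lborel. g1 y (1 * r - W y) =
             g1 y (1 * r - W y) * indicator {0<..} r + g1 y (1 * r - W y) * indicator {..<0} r"
            by eventually_elim (auto simp: indicator_def)
        qed
        also have "\<dots> = (\<integral>\<^sup>+r. g1 y (1 * r - W y) * indicator {0<..} r \<partial>lborel)
           + (\<integral>\<^sup>+r. g1 y (1 * r - W y) * indicator {..<0} r \<partial>lborel)"
          by (rule nn_integral_add) measurable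
        also have "(\<integral>\<^sup>+r. g1 y (1 * r - W y) * indicator {..<0} r \<partial>lborel)
          = (\<integral>\<^sup>+r. g1 y (-1 * r - W y) * indicator {0<..} r \<partial>lborel)"
          by (subst nn_integral_real_affine[where c="-1" and t=0])
             (auto intro!: nn_integral_cong simp: indicator_def)
        finally show "(\<integral>\<^sup>+r. g1 y r \<partial>lborel) = (\<integral>\<^sup>+r. g1 y (1 * r - W y) * indicator {0<..} r \<partial>lborel)
         + (\<integral>\<^sup>+r. g1 y (-1 * r - W y) * indicator {0<..} r \<partial>lborel)" .
      qed
      also have "\<dots> = G 1 + G (-1)"
      proof -
        have "(\<lambda>y. \<integral>\<^sup>+r. g1 y (\<epsilon> * r - W y) * indicator {0<..} r \<partial>lborel) \<in> borel_measurable (lborel_on I)" for \<epsilon>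
        proof -
          have [measurable]: "(\<lambda>p. g1 (fst p) (\<epsilon> * snd p - W (fst p))) \<in> borel_measurable ?P"
            by (rule g1_meas) auto
          show ?thesis by (rule lborel.borel_measurable_nn_integral) (simp add: split_beta')
        qed
        then show ?thesis unfolding G_def by (intro nn_integral_add)
      qed
      finally have "(\<integral>\<^sup>+x. f x \<partial>?N) * (\<integral>\<^sup>+y. g y \<partial>?N) = ennreal m * (G 1 + G (-1))"
        using m by simp
      also have "ennreal m = ennreal 2 * ennreal (m / 2)" using m0 by (subst ennreal_mult[symmetric]) auto
      also have "ennreal 2 * ennreal (m / 2) * (G 1 + G (-1)) = ennreal 2 * (ennreal (m / 2) * G 1 + ennreal (m / 2) * G (-1))"
        by (simp add: algebra_simps)
      also have "\<dots> \<le> ennreal 2 * (ennreal (c * (pi / 2) * (2 * pi) ^ card I) + ennreal (c * (pi / 2) * (2 * pi) ^ card I))"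
        by (intro mult_left_mono add_mono GK) auto
      \<comment> \<open>Each half contributes \<open>c * (pi / 2) * (2 * pi) ^ card I\<close>. The
        two halves, and the factor 2 between \<open>m\<close> and \<open>m / 2\<close>, together
        give one more factor \<open>2 * pi\<close>.\<close>
      also have "\<dots> = ennreal (c * (2 * pi) ^ card (insert k I))"
        using c I k by (simp only: ennreal_mult[symmetric] ennreal_plus[symmetric] mult_nonneg_nonneg zero_le_power add_nonneg_nonneg
          pi_ge_zero divide_nonneg_nonneg zero_le_numeral) (simp add: field_simps)
      finally show "(\<integral>\<^sup>+x. f x \<partial>?N) * (\<integral>\<^sup>+y. g y \<partial>?N) \<le> ennreal (c * (2 * pi) ^ card (insert k I))" .
    qed
  qed
qed


text \<open>Exchanging the roles of the two functions moves the freedom of choosing the origin into a tilt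
  \<open>exp \<langle>z, \<cdot>\<rangle>\<close> of the centred function, which can only increase its integral.\<close>

lemma santalo_centered_if_some_point:
  fixes I :: "'i set"
  assumes I: "finite I" and A: "santalo_some_point I"
  shows "santalo_centered I"
  unfolding santalo_centered_def
proof (intro allI impI)
  fix f :: "('i \<Rightarrow> real) \<Rightarrow> real" and g :: "('i \<Rightarrow> real) \<Rightarrow> ennreal" and c :: real
  let ?N = "lborel_on I"
  assume fint: "integrable ?N f" and fnn: "\<forall>x. 0 \<le> f x"
    and bary: "\<forall>i\<in>I. integrable ?N (\<lambda>x. x i * f x) \<and> (LINT x|?N. x i * f x) = 0"
    and g[measurable]: "g \<in> borel_measurable ?N" and c: "0 \<le> c"
    and le: "\<forall>x\<in>space ?N. \<forall>y\<in>space ?N. ennreal (f x) * g y \<le> ennreal (c * exp (- (\<Sum>i\<in>I. x i * y i)))"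
  have [measurable]: "f \<in> borel_measurable ?N" using fint by auto
  let ?K = "ennreal (c * (2 * pi) ^ card I)"
  define B where "B m = Pi\<^sub>E I (\<lambda>_. {- real m..real m})" for m
  have B[measurable]: "B m \<in> sets ?N" for m
    unfolding B_def using I by (intro sets_PiM_I_finite) auto
  \<comment> \<open>The cut-off makes \<open>g\<close> bounded with support in a box, as
    \<open>santalo_some_point\<close> demands of the function that determines the origin.\<close>
  define T where "T m y = min (g y) (of_nat m) * indicator (B m) y" for m y
  have [measurable]: "T m \<in> borel_measurable ?N" for m unfolding T_def[abs_def] by measurable
  have T_inc: "incseq T"
  proof (rule incseq_SucI, rule le_funI)
    fix m y
    have "B m \<subseteq> B (Suc m)" unfolding B_def by (intro PiE_mono) auto
    then have "(indicator (B m) y :: ennreal) \<le> indicator (B (Suc m)) y"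
      by (auto simp: indicator_def)
    moreover have "min (g y) (of_nat m) \<le> min (g y) (of_nat (Suc m))"
      by (intro min.mono order_refl) (simp add: le_iff_add ac_simps)
    ultimately show "T m y \<le> T (Suc m) y" unfolding T_def by (intro mult_mono) auto
  qed
  have T_sup: "(SUP m. T m y) = g y" if y: "y \<in> space ?N" for y
  proof -
    obtain N :: nat where N: "(\<Sum>i\<in>I. \<bar>y i\<bar>) \<le> real N" using real_arch_simple by blast
    have "y \<in> B m" if "m \<ge> N" for m
    proof -
      have y_le: "\<bar>y i\<bar> \<le> real m" if "i \<in> I" for i
        using member_le_sum[OF that, of "\<lambda>i. \<bar>y i\<bar>"] I N \<open>m \<ge> N\<close> by auto
      then have "- real m \<le> y i" "y i \<le> real m" if "i \<in> I" for i
        using y_le[OF that] by linarith+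
      then show ?thesis using y by (auto simp: B_def space_PiM PiE_iff)
    qed
    then have "eventually (\<lambda>m. T m y = min (g y) (of_nat m)) sequentially"
      unfolding eventually_sequentially T_def by (auto intro!: exI[of _ N])
    moreover have "(\<lambda>m. min (g y) (of_nat m :: ennreal)) \<longlonglongrightarrow> min (g y) top"
      by (intro tendsto_min tendsto_const of_nat_tendsto_top_ennreal)
    ultimately have "(\<lambda>m. T m y) \<longlonglongrightarrow> g y"
      by (simp add: tendsto_cong)
    moreover have "(\<lambda>m. T m y) \<longlonglongrightarrow> (SUP m. T m y)"
      using T_inc by (intro LIMSEQ_SUP) (auto simp: incseq_def le_fun_def)
    ultimately show ?thesis using LIMSEQ_unique by auto
  qed
  have trunc: "(\<integral>\<^sup>+x. f x \<partial>?N) * (\<integral>\<^sup>+y. T m y \<partial>?N) \<le> ?K" for m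
  proof -
    define g' where "g' y = enn2real (T m y)" for y
    have Tle: "T m y \<le> of_nat m" for y by (auto simp: T_def indicator_def)
    then have "T m y < top" for y by (rule le_less_trans) (simp add: of_nat_less_top)
    then have g': "ennreal (g' y) = T m y" for y by (simp add: g'_def ennreal_enn2real)
    have 1: "g' \<in> borel_measurable ?N" unfolding g'_def[abs_def] by measurable
    have 2: "\<forall>y. 0 \<le> g' y \<and> g' y \<le> real m"
      using Tle by (auto simp: g'_def enn2real_leI ennreal_of_nat_eq_real_of_nat)
    have 3: "\<forall>y. g' y \<noteq> 0 \<longrightarrow> (\<forall>i\<in>I. \<bar>y i\<bar> \<le> real m)"
      by (auto simp: g'_def T_def B_def indicator_def PiE_iff abs_le_iff minus_le_iff split: if_splits)
    from A[unfolded santalo_some_point_def, THEN spec[of _ g'], THEN spec[of _ "real m"], THEN spec[of _ "real m"],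
      THEN mp, OF 1, THEN mp, OF 2, THEN mp, OF 3]
    obtain z where z: "\<forall>(h :: ('i \<Rightarrow> real) \<Rightarrow> ennreal) (d::real). h \<in> borel_measurable ?N \<longrightarrow> 0 \<le> d \<longrightarrow>
       (\<forall>y\<in>space ?N. \<forall>x\<in>space ?N.
          ennreal (g' (\<lambda>i\<in>I. z i + y i)) * h x \<le> ennreal (d * exp (- (\<Sum>i\<in>I. y i * x i)))) \<longrightarrow>
       (\<integral>\<^sup>+y. ennreal (g' y) \<partial>?N) * (\<integral>\<^sup>+x. h x \<partial>?N) \<le> ennreal (d * (2 * pi) ^ card I)" ..
    define L where "L x = (\<Sum>i\<in>I. z i * x i)" for x
    have [measurable]: "L \<in> borel_measurable ?N" unfolding L_def[abs_def] by measurable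
    have "(\<integral>\<^sup>+y. g' y \<partial>?N) * (\<integral>\<^sup>+x. ennreal (f x * exp (L x)) \<partial>?N) \<le> ?K"
    proof (rule z[rule_format])
      fix y x assume y: "y \<in> space ?N" and x: "x \<in> space ?N"
      let ?y = "\<lambda>i\<in>I. z i + y i"
      have y': "?y \<in> space ?N" by (auto simp: space_PiM)
      have "ennreal (g' ?y) * ennreal (f x * exp (L x)) = ennreal (exp (L x)) * (ennreal (f x) * T m ?y)"
        using fnn by (simp add: g' ennreal_mult ac_simps)
      also have "\<dots> \<le> ennreal (exp (L x)) * (ennreal (f x) * g ?y)"
        by (intro mult_left_mono) (auto simp: T_def indicator_def)
      also have "\<dots> \<le> ennreal (exp (L x)) * ennreal (c * exp (- (\<Sum>i\<in>I. x i * ?y i)))"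
        by (intro mult_left_mono le[rule_format, OF x y']) simp
      also have "(\<Sum>i\<in>I. x i * ?y i) = L x + (\<Sum>i\<in>I. y i * x i)"
        by (simp add: L_def algebra_simps sum.distrib)
      also have "ennreal (exp (L x)) * ennreal (c * exp (- (L x + (\<Sum>i\<in>I. y i * x i))))
          = ennreal (c * exp (- (\<Sum>i\<in>I. y i * x i)))"
        using c by (simp add: exp_diff exp_minus field_simps flip: ennreal_mult exp_add)
      finally show "ennreal (g' ?y) * ennreal (f x * exp (L x)) \<le> ennreal (c * exp (- (\<Sum>i\<in>I. y i * x i)))" .
    qed (use c in auto)
    moreover have "(\<integral>\<^sup>+x. f x \<partial>?N) \<le> (\<integral>\<^sup>+x. ennreal (f x * exp (L x)) \<partial>?N)"
    proof (cases "(\<integral>\<^sup>+x. ennreal (f x * exp (L x)) \<partial>?N) = \<infinity>")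
      case False
      then have tint: "integrable ?N (\<lambda>x. f x * exp (L x))"
        using fnn by (intro integrableI_nonneg) (auto simp: less_top)
      have Lint: "integrable ?N (\<lambda>x. \<Sum>i\<in>I. z i * (x i * f x))"
        using bary by (intro Bochner_Integration.integrable_sum integrable_mult_right) auto
      have "(LINT x|?N. (\<Sum>i\<in>I. z i * (x i * f x))) = (\<Sum>i\<in>I. z i * (LINT x|?N. x i * f x))"
        using bary by (subst Bochner_Integration.integral_sum) auto
      also have "\<dots> = 0" using bary by simp
      finally have "(LINT x|?N. f x) = (LINT x|?N. f x + (\<Sum>i\<in>I. z i * (x i * f x)))"
        using fint Lint by simp
      also have "\<dots> \<le> (LINT x|?N. f x * exp (L x))"
      proof (rule integral_mono)
        fix x
        \<comment> \<open>The term \<open>f x * L x\<close> integrates to 0 because \<open>f\<close>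
          is centred, so this pointwise bound compares the integral of \<open>f\<close> with that of
          its tilt.\<close>
        have "f x * (1 + L x) \<le> f x * exp (L x)"
          using fnn exp_ge_add_one_self[of "L x"] by (intro mult_left_mono) auto
        then show "f x + (\<Sum>i\<in>I. z i * (x i * f x)) \<le> f x * exp (L x)"
          by (simp add: L_def algebra_simps sum_distrib_left)
      qed (use fint Lint tint in auto)
      finally have "ennreal (LINT x|?N. f x) \<le> ennreal (LINT x|?N. f x * exp (L x))"
        by (rule ennreal_leI)
      then show ?thesis
        using fint tint fnn by (simp add: nn_integral_eq_integral)
    qed simp
    ultimately show ?thesis
      using g' by (simp add: mult.commute) (meson mult_left_mono order_trans zero_le)
  qed
  have "(\<integral>\<^sup>+y. g y \<partial>?N) = (\<integral>\<^sup>+y. (SUP m. T m y) \<partial>?N)"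
    by (intro nn_integral_cong) (simp add: T_sup)
  also have "\<dots> = (SUP m. \<integral>\<^sup>+y. T m y \<partial>?N)"
    using T_inc by (intro nn_integral_monotone_convergence_SUP) auto
  finally show "(\<integral>\<^sup>+x. f x \<partial>?N) * (\<integral>\<^sup>+y. g y \<partial>?N) \<le> ?K"
    using trunc by (simp add: SUP_mult_left_ennreal SUP_le_iff)
qed

text \<open>Each new coordinate is gained by \<open>santalo_step\<close>, at the price of a
  displaced origin; \<open>santalo_centered_if_some_point\<close> restores the centred form. In
  dimension 0 the space is a single point and the exponent an empty sum.\<close>

lemma santalo_centered_finite: "finite I \<Longrightarrow> santalo_centered I"
proof (induction I rule: finite_induct)
  case empty
  show ?case
    unfolding santalo_centered_def
    by (auto simp: lborel_prod.nn_integral_empty space_PiM_empty)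
next
  case (insert k I)
  then show ?case
    by (intro santalo_centered_if_some_point[OF _ santalo_step]) auto
qed

section \<open>Support function and gauge\<close>

definition origin_body :: "'a::euclidean_space set \<Rightarrow> bool" where
  "origin_body K \<longleftrightarrow> convex K \<and> compact K \<and> 0 \<in> interior K"

lemma origin_bodyD:
  assumes "origin_body K"
  shows "convex K" "compact K" "closed K" "0 \<in> interior K" "0 \<in> K" "K \<noteq> {}"
  using assms interior_subset[of K] by (auto simp: origin_body_def compact_imp_closed)

lemma bdd_above_support:
  fixes K :: "'a::euclidean_space set"
  assumes "compact K"
  shows "bdd_above ((\<lambda>x. x \<bullet> u) ` K)"
  by (intro bounded_imp_bdd_above compact_imp_bounded compact_continuous_image continuous_intros assms)

lemma support_fun_upper:
  fixes K :: "'a::euclidean_space set"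
  assumes "compact K" "x \<in> K"
  shows "x \<bullet> u \<le> support_fun K u"
  unfolding support_fun_def using assms by (intro cSUP_upper bdd_above_support)

lemma support_fun_least:
  fixes K :: "'a::euclidean_space set"
  assumes "K \<noteq> {}" "\<And>x. x \<in> K \<Longrightarrow> x \<bullet> u \<le> c"
  shows "support_fun K u \<le> c"
  unfolding support_fun_def using assms by (intro cSUP_least)

lemma support_fun_attained:
  fixes K :: "'a::euclidean_space set"
  assumes "compact K" "K \<noteq> {}"
  obtains x where "x \<in> K" "x \<bullet> u = support_fun K u"
proof -
  obtain x where x: "x \<in> K" "\<And>y. y \<in> K \<Longrightarrow> y \<bullet> u \<le> x \<bullet> u"
    using continuous_attains_sup[OF assms, of "\<lambda>x. x \<bullet> u"] continuous_on_inner[OF continuous_on_id continuous_on_const]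
    by blast
  then have "support_fun K u = x \<bullet> u"
    using assms by (intro antisym support_fun_least support_fun_upper) auto
  then show ?thesis using x that by simp
qed

lemma support_fun_eqI:
  fixes K :: "'a::euclidean_space set"
  assumes "x \<in> K" "\<And>y. y \<in> K \<Longrightarrow> y \<bullet> u \<le> x \<bullet> u"
  shows "support_fun K u = x \<bullet> u"
  unfolding support_fun_def using assms by (intro cSup_eq_maximum) auto

lemma support_fun_scaleR:
  fixes K :: "'a::euclidean_space set"
  assumes K: "compact K" "K \<noteq> {}" and c: "0 \<le> c"
  shows "support_fun K (c *\<^sub>R u) = c * support_fun K u"
proof -
  obtain x where x: "x \<in> K" "x \<bullet> u = support_fun K u"
    using support_fun_attained[OF K] .
  have "support_fun K (c *\<^sub>R u) = x \<bullet> (c *\<^sub>R u)"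
    using x support_fun_upper[OF K(1)] c by (intro support_fun_eqI) (auto intro!: mult_left_mono)
  then show ?thesis using x by simp
qed

lemma support_fun_zero [simp]: "compact K \<Longrightarrow> K \<noteq> {} \<Longrightarrow> support_fun K (0::'a::euclidean_space) = 0"
  using support_fun_scaleR[of K 0 0] by simp

lemma support_fun_diff_le:
  fixes K :: "'a::euclidean_space set"
  assumes K: "compact K" "K \<noteq> {}" and R: "\<And>x. x \<in> K \<Longrightarrow> norm x \<le> R"
  shows "support_fun K u - support_fun K v \<le> R * norm (u - v)"
proof -
  obtain x where x: "x \<in> K" "x \<bullet> u = support_fun K u"
    using support_fun_attained[OF K] .
  have "support_fun K u - support_fun K v \<le> x \<bullet> u - x \<bullet> v"
    using x support_fun_upper[OF K(1) x(1), of v] by simp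
  also have "\<dots> = x \<bullet> (u - v)" by (simp add: inner_diff_right)
  also have "\<dots> \<le> norm x * norm (u - v)" by (rule norm_cauchy_schwarz)
  also have "\<dots> \<le> R * norm (u - v)" using R[OF x(1)] by (intro mult_right_mono) auto
  finally show ?thesis .
qed

lemma continuous_support_fun:
  fixes K :: "'a::euclidean_space set"
  assumes K: "compact K" "K \<noteq> {}"
  shows "continuous_on S (support_fun K)"
proof -
  obtain R where R: "R > 0" "\<And>x. x \<in> K \<Longrightarrow> norm x \<le> R"
    using compact_imp_bounded[OF K(1)] bounded_pos by blast
  have "R-lipschitz_on UNIV (support_fun K)"
  proof (rule lipschitz_onI)
    fix u v :: 'a
    show "dist (support_fun K u) (support_fun K v) \<le> R * dist u v"
      using support_fun_diff_le[OF K R(2), of u v] support_fun_diff_le[OF K R(2), of v u]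
      by (auto simp: dist_norm abs_le_iff norm_minus_commute)
  qed (use R in simp)
  then show ?thesis
    using lipschitz_on_continuous_on continuous_on_subset by blast
qed

lemma support_fun_pos:
  fixes K :: "'a::euclidean_space set"
  assumes K: "origin_body K" and u: "u \<noteq> 0"
  shows "support_fun K u > 0"
proof -
  obtain e where e: "e > 0" "cball 0 e \<subseteq> K"
    using origin_bodyD(4)[OF K] by (auto simp: mem_interior_cball)
  have "e *\<^sub>R sgn u \<in> K" using e u by (intro subsetD[OF e(2)]) (auto simp: norm_sgn)
  from support_fun_upper[OF origin_bodyD(2)[OF K] this, of u]
  have "e * norm u \<le> support_fun K u"
    using u by (simp add: sgn_div_norm dot_square_norm power2_eq_square field_simps)
  moreover have "0 < e * norm u" using e u by simp
  ultimately show ?thesis by linarith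
qed

lemma support_fun_nonneg:
  fixes K :: "'a::euclidean_space set"
  assumes K: "origin_body K"
  shows "support_fun K u \<ge> 0"
  using support_fun_pos[OF K, of u] origin_bodyD[OF K] by (cases "u = 0") auto

lemma support_fun_eq_0_iff:
  fixes K :: "'a::euclidean_space set"
  assumes K: "origin_body K"
  shows "support_fun K u = 0 \<longleftrightarrow> u = 0"
  using support_fun_pos[OF K, of u] origin_bodyD[OF K] by (cases "u = 0") auto

lemma mem_polar_body_iff:
  fixes K :: "'a::euclidean_space set"
  assumes K: "compact K" "K \<noteq> {}"
  shows "y \<in> polar_body K \<longleftrightarrow> support_fun K y \<le> 1"
proof
  show "support_fun K y \<le> 1" if "y \<in> polar_body K"
    using that by (intro support_fun_least K) (auto simp: polar_body_def)
  show "y \<in> polar_body K" if "support_fun K y \<le> 1"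
    using that support_fun_upper[OF K(1), of _ y] by (auto simp: polar_body_def intro: order_trans)
qed

text \<open>A ball of radius \<open>e\<close> inside \<open>K\<close> confines the polar body to
  radius \<open>1 / e\<close>; a ball of radius \<open>R\<close> containing \<open>K\<close> leaves
  room for radius \<open>1 / R\<close> in it.\<close>

lemma origin_body_polar:
  fixes K :: "'a::euclidean_space set"
  assumes K: "origin_body K"
  shows "origin_body (polar_body K)"
proof -
  note [simp] = origin_bodyD[OF K]
  obtain e where e: "e > 0" "cball 0 e \<subseteq> K"
    using origin_bodyD(4)[OF K] by (auto simp: mem_interior_cball)
  obtain R where R: "R > 0" "\<And>x. x \<in> K \<Longrightarrow> norm x \<le> R"
    using compact_imp_bounded[OF origin_bodyD(2)[OF K]] bounded_pos by blast
  have eq: "polar_body K = (\<Inter>x\<in>K. {y. x \<bullet> y \<le> 1})" by (auto simp: polar_body_def)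
  have "convex (polar_body K)" unfolding eq by (intro convex_INT convex_halfspace_le)
  moreover have "closed (polar_body K)" unfolding eq by (intro closed_INT ballI closed_halfspace_le)
  moreover have "bounded (polar_body K)"
  proof (rule boundedI)
    fix y assume y: "y \<in> polar_body K"
    show "norm y \<le> 1 / e"
    proof (cases "y = 0")
      case False
      have "e *\<^sub>R sgn y \<in> K" using e False by (intro subsetD[OF e(2)]) (auto simp: norm_sgn)
      then have "(e *\<^sub>R sgn y) \<bullet> y \<le> 1" using y by (auto simp: polar_body_def)
      then have "e * norm y \<le> 1" using False by (simp add: sgn_div_norm dot_square_norm power2_eq_square field_simps)
      then show ?thesis using e by (simp add: field_simps)
    qed (use e in auto)
  qed
  moreover have "ball 0 (1 / R) \<subseteq> polar_body K"
  proof
    fix y :: 'a assume "y \<in> ball 0 (1 / R)"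
    then have y: "norm y \<le> 1 / R" by simp
    have "x \<bullet> y \<le> 1" if "x \<in> K" for x
    proof -
      have "x \<bullet> y \<le> norm x * norm y" by (rule norm_cauchy_schwarz)
      also have "\<dots> \<le> R * (1 / R)" using R that y by (intro mult_mono) auto
      finally show ?thesis using R by simp
    qed
    then show "y \<in> polar_body K" by (auto simp: polar_body_def)
  qed
  then have "0 \<in> interior (polar_body K)"
    using R by (auto simp: mem_interior intro!: exI[of _ "1 / R"])
  ultimately show ?thesis by (simp add: origin_body_def compact_eq_bounded_closed)
qed

lemma polar_polar_body:
  fixes K :: "'a::euclidean_space set"
  assumes K: "origin_body K"
  shows "polar_body (polar_body K) = K"
proof
  show "K \<subseteq> polar_body (polar_body K)" by (auto simp: polar_body_def inner_commute)
  show "polar_body (polar_body K) \<subseteq> K"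
  proof (rule ccontr)
    assume "\<not> polar_body (polar_body K) \<subseteq> K"
    then obtain z where z: "z \<in> polar_body (polar_body K)" "z \<notin> K" by auto
    obtain a b where ab: "a \<bullet> z < b" "\<And>x. x \<in> K \<Longrightarrow> b < a \<bullet> x"
      using separating_hyperplane_closed_point[OF origin_bodyD(1,3)[OF K] z(2)] by blast
    \<comment> \<open>The level is negative because the origin lies in \<open>K\<close>; division by
      \<open>b\<close> therefore reverses the inequality and lands in the polar body.\<close>
    have b: "b < 0" using ab(2)[OF origin_bodyD(5)[OF K]] by simp
    have "(1 / b) *\<^sub>R a \<in> polar_body K"
      using ab(2) b by (auto simp: polar_body_def inner_commute divide_le_eq less_imp_le)
    then have "((1 / b) *\<^sub>R a) \<bullet> z \<le> 1" using z unfolding polar_body_def by blast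
    then show False using ab(1) b by (simp add: divide_le_eq)
  qed
qed

text \<open>The Minkowski functional of \<open>K\<close>. By bipolarity it is the support function
  of the polar body, so every fact about support functions also serves the gauge.\<close>

abbreviation gauge_fun :: "'a::euclidean_space set \<Rightarrow> 'a \<Rightarrow> real" where
  "gauge_fun K \<equiv> support_fun (polar_body K)"

lemma gauge_fun_props:
  fixes K :: "'a::euclidean_space set"
  assumes K: "origin_body K"
  shows mem_iff_gauge_le: "x \<in> K \<longleftrightarrow> gauge_fun K x \<le> 1"
    and gauge_scaleR: "0 \<le> c \<Longrightarrow> gauge_fun K (c *\<^sub>R x) = c * gauge_fun K x"
    and gauge_nonneg: "0 \<le> gauge_fun K x"
    and gauge_pos: "x \<noteq> 0 \<Longrightarrow> 0 < gauge_fun K x"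
    and gauge_eq_0_iff: "gauge_fun K x = 0 \<longleftrightarrow> x = 0"
    and continuous_gauge: "continuous_on S (gauge_fun K)"
proof -
  note P = origin_body_polar[OF K]
  show "x \<in> K \<longleftrightarrow> gauge_fun K x \<le> 1"
    using mem_polar_body_iff[OF origin_bodyD(2,6)[OF P]] polar_polar_body[OF K] by simp
  show "0 \<le> c \<Longrightarrow> gauge_fun K (c *\<^sub>R x) = c * gauge_fun K x"
    by (rule support_fun_scaleR[OF origin_bodyD(2,6)[OF P]])
  show "0 \<le> gauge_fun K x" "x \<noteq> 0 \<Longrightarrow> 0 < gauge_fun K x" "gauge_fun K x = 0 \<longleftrightarrow> x = 0"
    using support_fun_nonneg[OF P] support_fun_pos[OF P] support_fun_eq_0_iff[OF P] by auto
  show "continuous_on S (gauge_fun K)"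
    by (rule continuous_support_fun[OF origin_bodyD(2,6)[OF P]])
qed

lemma mem_interior_iff_gauge_less:
  fixes K :: "'a::euclidean_space set"
  assumes K: "origin_body K"
  shows "x \<in> interior K \<longleftrightarrow> gauge_fun K x < 1"
proof
  assume x: "x \<in> interior K"
  show "gauge_fun K x < 1"
  proof (cases "x = 0")
    case True
    then show ?thesis using gauge_eq_0_iff[OF K, of 0] by simp
  next
    case False
    obtain e where e: "e > 0" "cball x e \<subseteq> K" using x by (auto simp: mem_interior_cball)
    have "x + (e / norm x) *\<^sub>R x \<in> K" using e False by (intro subsetD[OF e(2)]) (auto simp: dist_norm)
    then have "gauge_fun K ((1 + e / norm x) *\<^sub>R x) \<le> 1"
      using mem_iff_gauge_le[OF K] by (simp add: algebra_simps)
    then have *: "(1 + e / norm x) * gauge_fun K x \<le> 1"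
      using e gauge_scaleR[OF K, of "1 + e / norm x" x] by simp
    have "0 < e / norm x * gauge_fun K x" using e False gauge_pos[OF K, of x] by simp
    then show ?thesis using * by (simp add: algebra_simps)
  qed
next
  assume x: "gauge_fun K x < 1"
  have "open {x. gauge_fun K x < 1}"
    using continuous_gauge[OF K, of UNIV] by (intro open_Collect_less) auto
  moreover have "{x. gauge_fun K x < 1} \<subseteq> K" by (auto simp: mem_iff_gauge_le[OF K])
  ultimately show "x \<in> interior K" using x interior_maximal by blast
qed

lemma mem_frontier_iff_gauge_eq:
  fixes K :: "'a::euclidean_space set"
  assumes K: "origin_body K"
  shows "x \<in> frontier K \<longleftrightarrow> gauge_fun K x = 1"
  using origin_bodyD(3)[OF K]
  by (auto simp: frontier_def mem_interior_iff_gauge_less[OF K] mem_iff_gauge_le[OF K])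

text \<open>Scaling \<open>x\<close> to the boundary reduces this to the definition of the support
  function; it is the Cauchy-Schwarz inequality for a gauge and its dual.\<close>

lemma inner_le_gauge_support:
  fixes K :: "'a::euclidean_space set"
  assumes K: "origin_body K"
  shows "x \<bullet> y \<le> gauge_fun K x * support_fun K y"
proof (cases "x = 0")
  case False
  then have k: "gauge_fun K x > 0" by (rule gauge_pos[OF K])
  have "gauge_fun K ((1 / gauge_fun K x) *\<^sub>R x) \<le> 1"
    using k gauge_scaleR[OF K, of "1 / gauge_fun K x" x] by simp
  then have "(1 / gauge_fun K x) *\<^sub>R x \<in> K" by (simp add: mem_iff_gauge_le[OF K])
  from support_fun_upper[OF origin_bodyD(2)[OF K] this, of y]
  show ?thesis using k by (simp add: field_simps)
qed (use gauge_eq_0_iff[OF K, of 0] in simp)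

section \<open>The Blaschke-Santalo inequality\<close>

text \<open>Coordinates with respect to \<open>Basis\<close> identify Lebesgue measure with a
  product measure indexed by \<open>Basis\<close>, where \<open>santalo_centered_finite\<close>
  applies with \<open>c = 1\<close>.\<close>

lemma functional_santalo:
  fixes f :: "'a::euclidean_space \<Rightarrow> real" and g :: "'a \<Rightarrow> ennreal"
  assumes f: "integrable lborel f" and nn: "\<And>x. 0 \<le> f x"
    and fb: "\<And>b. b \<in> Basis \<Longrightarrow> integrable lborel (\<lambda>x. (x \<bullet> b) * f x)"
    and bary: "\<And>b. b \<in> Basis \<Longrightarrow> (LINT x|lborel. (x \<bullet> b) * f x) = 0"
    and g[measurable]: "g \<in> borel_measurable borel"
    and le: "\<And>x y. ennreal (f x) * g y \<le> ennreal (exp (- (x \<bullet> y)))"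
  shows "(\<integral>\<^sup>+x. ennreal (f x) \<partial>lborel) * (\<integral>\<^sup>+y. g y \<partial>lborel) \<le> ennreal ((2 * pi) ^ DIM('a))"
proof -
  let ?N = "lborel_on (Basis :: 'a set)"
  define \<phi> where "\<phi> v = (\<Sum>b\<in>Basis. v b *\<^sub>R b)" for v :: "'a \<Rightarrow> real"
  have \<phi>[measurable]: "\<phi> \<in> measurable ?N borel" unfolding \<phi>_def by measurable
  have lb: "(lborel :: 'a measure) = distr ?N borel \<phi>" unfolding \<phi>_def by (rule lborel_eq)
  have \<phi>_inner: "\<phi> v \<bullet> b = v b" if "b \<in> Basis" for v b
    using that by (simp add: \<phi>_def inner_sum_left_Basis)
  have [measurable]: "f \<in> borel_measurable borel" using f by auto
  have "santalo_centered (Basis :: 'a set)" by (rule santalo_centered_finite) simp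
  then have "(\<integral>\<^sup>+x. ennreal (f (\<phi> x)) \<partial>?N) * (\<integral>\<^sup>+y. g (\<phi> y) \<partial>?N) \<le> ennreal (1 * (2 * pi) ^ card (Basis :: 'a set))"
    unfolding santalo_centered_def
  proof (elim allE impE)
    show "integrable ?N (\<lambda>x. f (\<phi> x))"
      using f unfolding lb by (subst (asm) integrable_distr_eq) auto
    show "\<forall>i\<in>Basis. integrable ?N (\<lambda>x. x i * f (\<phi> x)) \<and> (LINT x|?N. x i * f (\<phi> x)) = 0"
    proof
      fix b :: 'a assume b: "b \<in> Basis"
      show "integrable ?N (\<lambda>x. x b * f (\<phi> x)) \<and> (LINT x|?N. x b * f (\<phi> x)) = 0"
        using fb[OF b] bary[OF b] unfolding lb
        by (subst (asm) integrable_distr_eq, simp, simp, subst (asm) integral_distr) (auto simp: \<phi>_inner b)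
    qed
    show "\<forall>x\<in>space ?N. \<forall>y\<in>space ?N. ennreal (f (\<phi> x)) * g (\<phi> y) \<le> ennreal (1 * exp (- (\<Sum>i\<in>Basis. x i * y i)))"
    proof (intro ballI)
      fix x y :: "'a \<Rightarrow> real"
      have "\<phi> x \<bullet> \<phi> y = (\<Sum>i\<in>Basis. x i * y i)"
        by (subst euclidean_inner) (auto simp: \<phi>_inner intro!: sum.cong)
      then show "ennreal (f (\<phi> x)) * g (\<phi> y) \<le> ennreal (1 * exp (- (\<Sum>i\<in>Basis. x i * y i)))"
        using le[of "\<phi> x" "\<phi> y"] by simp
    qed
  qed (use nn in auto)
  then show ?thesis
    unfolding lb by (subst nn_integral_distr, simp, simp)+ simp
qed

section \<open>Gaussian integrals of positively homogeneous functions\<close>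

lemma nn_integral_lborel_scaleR:
  fixes f :: "'a::euclidean_space \<Rightarrow> ennreal"
  assumes [measurable]: "f \<in> borel_measurable borel" and c: "0 < c"
  shows "(\<integral>\<^sup>+x. f x \<partial>lborel) = ennreal (c ^ DIM('a)) * (\<integral>\<^sup>+x. f (c *\<^sub>R x) \<partial>lborel)"
  using c by (subst lborel_affine[of c 0])
    (auto simp: nn_integral_density nn_integral_distr nn_integral_cmult)

lemma integral_lborel_scaleR:
  fixes f :: "'a::euclidean_space \<Rightarrow> real"
  assumes [measurable]: "f \<in> borel_measurable borel" and c: "0 < c"
  shows "(LINT x|lborel. f x) = c ^ DIM('a) * (LINT x|lborel. f (c *\<^sub>R x))"
  using c by (subst lborel_affine[of c 0])
    (auto simp: integral_density integral_distr)

text \<open>Its value is 2^(n/2) Gamma(n/2 + 1), but this is never computed: only its relation to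
  the volume of the unit ball is used, and in the end it cancels.\<close>

definition gauss_const :: "nat \<Rightarrow> ennreal" where
  "gauss_const n = (\<integral>\<^sup>+r. indicator {0<..<1} r * ennreal (sqrt (- 2 * ln r) ^ n) \<partial>lborel)"

lemma gauss_level_iff:
  assumes "0 \<le> (k::real)" "0 < r"
  shows "r < exp (- (k\<^sup>2 / 2)) \<longleftrightarrow> r < 1 \<and> k < sqrt (- 2 * ln r)"
proof -
  have "r < exp (- (k\<^sup>2 / 2)) \<longleftrightarrow> ln r < - (k\<^sup>2 / 2)"
    using assms by (metis exp_less_cancel_iff exp_ln)
  also have "\<dots> \<longleftrightarrow> k\<^sup>2 < - 2 * ln r" by auto
  also have "\<dots> \<longleftrightarrow> r < 1 \<and> k < sqrt (- 2 * ln r)"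
  proof
    assume *: "k\<^sup>2 < - 2 * ln r"
    have "ln r < 0" using * zero_le_power2[of k] by linarith
    then show "r < 1 \<and> k < sqrt (- 2 * ln r)"
      using assms * by (auto simp: real_less_rsqrt)
  next
    assume *: "r < 1 \<and> k < sqrt (- 2 * ln r)"
    then have "k\<^sup>2 < (sqrt (- 2 * ln r))\<^sup>2" using assms by (intro power_strict_mono) auto
    also have "\<dots> = - 2 * ln r" using * assms by (subst real_sqrt_pow2) auto
    finally show "k\<^sup>2 < - 2 * ln r" .
  qed
  finally show ?thesis .
qed

lemma emeasure_gauge_scale:
  fixes k :: "'a::euclidean_space \<Rightarrow> real"
  assumes [measurable]: "k \<in> borel_measurable borel"
    and hom: "\<And>c x. 0 < c \<Longrightarrow> k (c *\<^sub>R x) = c * k x" and \<rho>: "0 < \<rho>"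
  shows "emeasure lborel {x. k x < \<rho>} = ennreal (\<rho> ^ DIM('a)) * emeasure lborel {x. k x < 1}"
proof -
  have "emeasure lborel {x. k x < \<rho>} = (\<integral>\<^sup>+x. indicator {x. k x < \<rho>} x \<partial>lborel)" by simp
  also have "\<dots> = ennreal (\<rho> ^ DIM('a)) * (\<integral>\<^sup>+x. indicator {x. k x < \<rho>} (\<rho> *\<^sub>R x) \<partial>lborel)"
    by (rule nn_integral_lborel_scaleR) (use \<rho> in auto)
  also have "(\<integral>\<^sup>+x. indicator {x. k x < \<rho>} (\<rho> *\<^sub>R x) \<partial>lborel) = (\<integral>\<^sup>+x. indicator {x. k x < 1} x \<partial>lborel)"
    using \<rho> by (intro nn_integral_cong) (auto simp: indicator_def hom)
  finally show ?thesis by simp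
qed

text \<open>The superlevel set of the Gaussian at height \<open>r\<close> is the dilate of
  \<open>{x. k x < 1}\<close> by \<open>sqrt (- 2 * ln r)\<close>, so the layer cake formula factors
  into a volume and a constant.\<close>

lemma nn_integral_gauss_gauge:
  fixes k :: "'a::euclidean_space \<Rightarrow> real"
  assumes k[measurable]: "k \<in> borel_measurable borel" and nn: "\<And>x. 0 \<le> k x"
    and hom: "\<And>c x. 0 < c \<Longrightarrow> k (c *\<^sub>R x) = c * k x"
  shows "(\<integral>\<^sup>+x. ennreal (exp (- ((k x)\<^sup>2 / 2))) \<partial>lborel) = emeasure lborel {x. k x < 1} * gauss_const DIM('a)"
proof -
  have "(\<integral>\<^sup>+x. ennreal (exp (- ((k x)\<^sup>2 / 2))) \<partial>lborel)
      = (\<integral>\<^sup>+r. indicator {0<..} r * emeasure lborel {x. r < exp (- ((k x)\<^sup>2 / 2))} \<partial>lborel)"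
    by (subst nn_integral_layer_cake[OF sigma_finite_lborel]) auto
  also have "\<dots> = (\<integral>\<^sup>+r. emeasure lborel {x. k x < 1} * (indicator {0<..<1} r * ennreal (sqrt (- 2 * ln r) ^ DIM('a))) \<partial>lborel)"
  proof (rule nn_integral_cong)
    fix r :: real
    show "indicator {0<..} r * emeasure lborel {x. r < exp (- ((k x)\<^sup>2 / 2))}
      = emeasure lborel {x. k x < 1} * (indicator {0<..<1} r * ennreal (sqrt (- 2 * ln r) ^ DIM('a)))"
    proof (cases "0 < r \<and> r < 1")
      case True
      then have "{x. r < exp (- ((k x)\<^sup>2 / 2))} = {x. k x < sqrt (- 2 * ln r)}"
        using nn by (auto simp: gauss_level_iff)
      then show ?thesis
        using True emeasure_gauge_scale[OF k hom, of "sqrt (- 2 * ln r)"] by (simp add: ac_simps)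
    next
      case False
      have "{x. r < exp (- ((k x)\<^sup>2 / 2))} = {}" if "r > 0"
        using False that nn by (auto simp: gauss_level_iff)
      then show ?thesis using False by (cases "r > 0") auto
    qed
  qed
  also have "\<dots> = emeasure lborel {x. k x < 1} * gauss_const DIM('a)"
    unfolding gauss_const_def by (rule nn_integral_cmult) measurable
  finally show ?thesis .
qed

lemma nn_integral_gaussian:
  "(\<integral>\<^sup>+(x::'a::euclidean_space). ennreal (exp (- ((norm x)\<^sup>2 / 2))) \<partial>lborel) = ennreal (sqrt (2 * pi) ^ DIM('a))"
proof -
  have 1: "(\<integral>\<^sup>+x. ennreal (exp (- (x\<^sup>2 / 2))) \<partial>lborel) = ennreal (sqrt (2 * pi))"
  proof -
    let ?g = "\<lambda>x::real. ennreal (exp (- (x\<^sup>2 / 2)))"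
    have "(\<integral>\<^sup>+x. ?g x \<partial>lborel) = (\<integral>\<^sup>+x. ?g x * indicator {0<..} x + ?g x * indicator {..<0} x \<partial>lborel)"
    proof (rule nn_integral_cong_AE)
      have "AE r in lborel. r \<noteq> (0::real)" by (rule AE_lborel_singleton)
      then show "AE x in lborel. ?g x = ?g x * indicator {0<..} x + ?g x * indicator {..<0} x"
        by eventually_elim (auto simp: indicator_def)
    qed
    also have "\<dots> = (\<integral>\<^sup>+x. ?g x * indicator {0<..} x \<partial>lborel) + (\<integral>\<^sup>+x. ?g x * indicator {..<0} x \<partial>lborel)"
      by (rule nn_integral_add) measurable
    also have "(\<integral>\<^sup>+x. ?g x * indicator {..<0} x \<partial>lborel) = (\<integral>\<^sup>+x. ?g x * indicator {0<..} x \<partial>lborel)"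
      by (subst nn_integral_real_affine[where c="-1" and t=0])
         (auto intro!: nn_integral_cong simp: indicator_def)
    also have "(\<integral>\<^sup>+x. ?g x * indicator {0<..} x \<partial>lborel) = ennreal (sqrt (pi / 2))"
      by (rule nn_integral_half_gaussian)
    also have "ennreal (sqrt (pi / 2)) + ennreal (sqrt (pi / 2)) = ennreal (2 * sqrt (pi / 2))"
      by (simp flip: ennreal_plus)
    also have "2 * sqrt (pi / 2) = sqrt (2 * pi)"
    proof -
      have "2 * sqrt (pi / 2) = sqrt 4 * sqrt (pi / 2)" by simp
      also have "\<dots> = sqrt (2 * pi)" by (subst real_sqrt_mult[symmetric]) (simp add: field_simps)
      finally show ?thesis .
    qed
    finally show ?thesis .
  qed
  have "(\<integral>\<^sup>+(x::'a). ennreal (exp (- ((norm x)\<^sup>2 / 2))) \<partial>lborel)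
      = (\<integral>\<^sup>+(x::'a). (\<Prod>b\<in>Basis. ennreal (exp (- ((x \<bullet> b)\<^sup>2 / 2)))) \<partial>lborel)"
  proof (rule nn_integral_cong)
    fix x :: 'a
    have "(norm x)\<^sup>2 = (\<Sum>b\<in>Basis. (x \<bullet> b)\<^sup>2)"
      by (subst power2_norm_eq_inner, subst euclidean_inner) (simp add: power2_eq_square)
    then have "exp (- ((norm x)\<^sup>2 / 2)) = (\<Prod>b\<in>Basis. exp (- ((x \<bullet> b)\<^sup>2 / 2)))"
      by (simp add: exp_sum sum_divide_distrib flip: sum_negf)
    then show "ennreal (exp (- ((norm x)\<^sup>2 / 2))) = (\<Prod>b\<in>Basis. ennreal (exp (- ((x \<bullet> b)\<^sup>2 / 2))))"
      by (simp add: prod_ennreal)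
  qed
  also have "\<dots> = (\<Prod>b\<in>(Basis::'a set). \<integral>\<^sup>+x. ennreal (exp (- (x\<^sup>2 / 2))) \<partial>lborel)"
    by (rule nn_integral_lborel_prod) auto
  also have "\<dots> = ennreal (sqrt (2 * pi) ^ DIM('a))"
    by (simp add: 1 ennreal_power)
  finally show ?thesis .
qed

text \<open>The case \<open>k = norm\<close> expresses the constant through the ball; in this way
  the ball enters the Blaschke-Santalo bound.\<close>

lemma gauss_const_ball:
  "ennreal (measure lborel (cball (0::'a::euclidean_space) 1)) * gauss_const DIM('a) = ennreal (sqrt (2 * pi) ^ DIM('a))"
proof -
  have "(\<integral>\<^sup>+(x::'a). ennreal (exp (- ((norm x)\<^sup>2 / 2))) \<partial>lborel) = emeasure lborel {x::'a. norm x < 1} * gauss_const DIM('a)"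
    by (rule nn_integral_gauss_gauge) auto
  moreover have "{x::'a. norm x < 1} = ball 0 1" by auto
  moreover have "emeasure lborel (ball (0::'a) 1) = ennreal (measure lborel (cball (0::'a) 1))"
    by (simp add: emeasure_ball content_cball)
  ultimately show ?thesis by (simp add: nn_integral_gaussian)
qed


lemma gauss_const_pos_finite:
  "gauss_const DIM('a::euclidean_space) \<noteq> 0" "gauss_const DIM('a) < top"
proof -
  have B: "0 < measure lborel (cball (0::'a) 1)" by (simp add: content_cball)
  have p: "0 < sqrt (2 * pi) ^ DIM('a)" by simp
  note eq = gauss_const_ball[where 'a='a]
  show "gauss_const DIM('a) \<noteq> 0"
    using eq p by (auto simp: ennreal_eq_0_iff simp del: zero_less_power)
  show "gauss_const DIM('a) < top"
  proof (rule ccontr)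
    assume "\<not> gauss_const DIM('a) < top"
    then have "gauss_const DIM('a) = top" using less_top by blast
    then show False using eq B by (simp add: ennreal_mult_top)
  qed
qed

text \<open>Follows from \<open>(t/2 - 1)\<^sup>2 \<ge> 0\<close>; it lets half of a Gaussian
  exponent absorb a linear factor.\<close>

lemma le_two_exp_quarter_square: "(t::real) \<le> exp (t\<^sup>2 / 4)"
proof -
  have "0 \<le> (t / 2 - 1)\<^sup>2" by simp
  then have "t \<le> 1 + t\<^sup>2 / 4" by (simp add: power2_eq_square field_simps)
  also have "\<dots> \<le> exp (t\<^sup>2 / 4)" by (rule exp_ge_add_one_self)
  finally show ?thesis .
qed

text \<open>Every superlevel set of the Gaussian is a dilate of \<open>{x. k x < 1}\<close>, so its
  first moment vanishes as well, and Fubini over the height transfers this to the Gaussian. The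
  linear factor is controlled by \<open>norm x \<le> R * k x\<close> and a wider Gaussian.\<close>

lemma gauss_gauge_barycenter:
  fixes k :: "'a::euclidean_space \<Rightarrow> real"
  assumes k[measurable]: "k \<in> borel_measurable borel" and nn: "\<And>x. 0 \<le> k x"
    and hom: "\<And>c x. 0 < c \<Longrightarrow> k (c *\<^sub>R x) = c * k x"
    and R: "\<And>x. norm x \<le> R * k x" and R0: "0 \<le> R" and fin: "emeasure lborel {x. k x < 1} < top"
    and bary: "(LINT x|lborel. indicator {x. k x < 1} x * (x \<bullet> b)) = 0"
  shows "integrable lborel (\<lambda>x. exp (- ((k x)\<^sup>2 / 2)))"
    and "integrable lborel (\<lambda>x. (x \<bullet> b) * exp (- ((k x)\<^sup>2 / 2)))"
    and "(LINT x|lborel. (x \<bullet> b) * exp (- ((k x)\<^sup>2 / 2))) = 0"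
proof -
  have gint: "integrable lborel (\<lambda>x. exp (- ((k' x)\<^sup>2 / 2)))"
    if "k' = (\<lambda>x. a * k x)" "0 < a" for k' a
  proof (rule integrableI_nonneg)
    have m: "k' \<in> borel_measurable borel" unfolding that by measurable
    have "{x. k' x < 1} = {x. k x < 1 / a}" using that by (auto simp: field_simps)
    then have "emeasure lborel {x. k' x < 1} < top"
      using emeasure_gauge_scale[OF k hom, of "1 / a"] that fin by (simp add: ennreal_mult_less_top)
    moreover have "(\<integral>\<^sup>+x. ennreal (exp (- ((k' x)\<^sup>2 / 2))) \<partial>lborel) = emeasure lborel {x. k' x < 1} * gauss_const DIM('a)"
      using m nn that hom by (intro nn_integral_gauss_gauge) auto
    ultimately show "(\<integral>\<^sup>+x. ennreal (exp (- ((k' x)\<^sup>2 / 2))) \<partial>lborel) < \<infinity>"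
      using gauss_const_pos_finite(2)[where 'a='a] by (simp add: ennreal_mult_less_top)
    show "(\<lambda>x. exp (- ((k' x)\<^sup>2 / 2))) \<in> borel_measurable lborel" using m by measurable
  qed simp
  show "integrable lborel (\<lambda>x. exp (- ((k x)\<^sup>2 / 2)))"
    using gint[of "\<lambda>x. 1 * k x" 1] by simp
  have dom: "\<bar>x \<bullet> b\<bar> * exp (- ((k x)\<^sup>2 / 2)) \<le> (R * norm b) * exp (- ((sqrt (1/2) * k x)\<^sup>2 / 2))" for x
  proof -
    have "\<bar>x \<bullet> b\<bar> \<le> norm x * norm b" by (rule Cauchy_Schwarz_ineq2)
    also have "\<dots> \<le> (R * exp ((k x)\<^sup>2 / 4)) * norm b"
      using R[of x] le_two_exp_quarter_square[of "k x"] R0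
      by (intro mult_right_mono) (auto intro: order_trans mult_left_mono)
    finally have "\<bar>x \<bullet> b\<bar> * exp (- ((k x)\<^sup>2 / 2)) \<le> (R * exp ((k x)\<^sup>2 / 4)) * norm b * exp (- ((k x)\<^sup>2 / 2))"
      by (intro mult_right_mono) auto
    also have "\<dots> = R * norm b * (exp ((k x)\<^sup>2 / 4) * exp (- ((k x)\<^sup>2 / 2)))" by simp
    also have "exp ((k x)\<^sup>2 / 4) * exp (- ((k x)\<^sup>2 / 2)) = exp (- ((sqrt (1/2) * k x)\<^sup>2 / 2))"
      by (simp add: power_mult_distrib real_sqrt_divide power_divide flip: exp_add)
    finally show ?thesis .
  qed
  have dint: "integrable lborel (\<lambda>x. (R * norm b) * exp (- ((sqrt (1/2) * k x)\<^sup>2 / 2)))"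
    using gint[of _ "sqrt (1/2)"] by (intro integrable_mult_right) auto
  have aint: "integrable lborel (\<lambda>x. \<bar>x \<bullet> b\<bar> * exp (- ((k x)\<^sup>2 / 2)))"
    using dint by (rule Bochner_Integration.integrable_bound) (use dom in \<open>auto simp: abs_mult abs_of_nonneg[OF R0]\<close>)
  show int: "integrable lborel (\<lambda>x. (x \<bullet> b) * exp (- ((k x)\<^sup>2 / 2)))"
    using aint by (rule Bochner_Integration.integrable_bound) (auto simp: abs_mult)
  define E where "E x = exp (- ((k x)\<^sup>2 / 2))" for x
  have [measurable]: "E \<in> borel_measurable borel" unfolding E_def[abs_def] by measurable
  \<comment> \<open>Layers of the first moment: integrating over \<open>r\<close> returns
    \<open>(x \<bullet> b) * E x\<close>, integrating over \<open>x\<close> gives the first moment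
    of one superlevel set.\<close>
  define u where "u x r = (x \<bullet> b) * indicator {0<..<E x} r" for x and r :: real
  have u_alt: "u x r = (x \<bullet> b) * indicator {p. 0 < snd p \<and> snd p < E (fst p)} (x, r)" for x r
    by (auto simp: u_def indicator_def)
  have um: "case_prod u \<in> borel_measurable (lborel \<Otimes>\<^sub>M lborel)"
    unfolding u_alt[abs_def] by measurable
  have Enn: "0 < E x" for x by (simp add: E_def)
  have u1: "(LINT r|lborel. u x r) = (x \<bullet> b) * E x" for x
    using Enn[of x] by (simp add: u_def)
  have uint: "integrable (lborel \<Otimes>\<^sub>M lborel) (case_prod u)"
  proof (rule lborel_pair.Fubini_integrable[OF um])
    have "(LINT r|lborel. norm (case (x, r) of (x, r) \<Rightarrow> u x r)) = \<bar>x \<bullet> b\<bar> * E x" for x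
      using Enn[of x] by (simp add: u_def abs_mult)
    then show "integrable lborel (\<lambda>x. LINT r|lborel. norm (case (x, r) of (x, r) \<Rightarrow> u x r))"
      using aint by (simp add: E_def)
    show "AE x in lborel. integrable lborel (\<lambda>r. case (x, r) of (x, r) \<Rightarrow> u x r)"
    proof (rule AE_I2)
      fix x
      have "integrable lborel (indicat_real {0<..<E x})" using Enn[of x] by (intro integrable_real_indicator) auto
      then show "integrable lborel (\<lambda>r. case (x, r) of (x, r) \<Rightarrow> u x r)" by (simp add: u_def)
    qed
  qed
  have u2: "(LINT x|lborel. u x r) = 0" for r
  proof (cases "0 < r \<and> r < 1")
    case True
    define \<rho> where "\<rho> = sqrt (- 2 * ln r)"
    have \<rho>: "0 < \<rho>" using True by (simp add: \<rho>_def)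
    have "u x r = indicator {x. k x < \<rho>} x * (x \<bullet> b)" for x
      using True nn gauss_level_iff[of "k x" r] by (auto simp: u_def E_def \<rho>_def indicator_def)
    then have "(LINT x|lborel. u x r) = (LINT x|lborel. indicator {x. k x < \<rho>} x * (x \<bullet> b))" by simp
    also have "\<dots> = \<rho> ^ DIM('a) * (LINT x|lborel. indicator {x. k x < \<rho>} (\<rho> *\<^sub>R x) * ((\<rho> *\<^sub>R x) \<bullet> b))"
      by (rule integral_lborel_scaleR) (use \<rho> in auto)
    also have "(\<lambda>x. indicator {x. k x < \<rho>} (\<rho> *\<^sub>R x) * ((\<rho> *\<^sub>R x) \<bullet> b)) = (\<lambda>x. \<rho> * (indicator {x. k x < 1} x * (x \<bullet> b)))"
      using \<rho> by (auto simp: indicator_def hom fun_eq_iff)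
    also have "(LINT x|lborel. \<rho> * (indicator {x. k x < 1} x * (x \<bullet> b))) = 0"
      using bary by simp
    finally show ?thesis by simp
  next
    case False
    have "E x \<le> 1" for x by (simp add: E_def)
    then have "u x r = 0" for x using False by (auto simp: u_def indicator_def not_less intro: order_trans)
    then show ?thesis by simp
  qed
  have "(LINT x|lborel. (x \<bullet> b) * E x) = (LINT x|lborel. LINT r|lborel. u x r)" by (simp add: u1)
  also have "\<dots> = (LINT r|lborel. LINT x|lborel. u x r)" by (rule lborel_pair.Fubini_integral[OF uint, symmetric])
  also have "\<dots> = 0" by (simp add: u2)
  finally show "(LINT x|lborel. (x \<bullet> b) * exp (- ((k x)\<^sup>2 / 2))) = 0" by (simp add: E_def)
qed

lemma emeasure_interior_body:
  fixes K :: "'a::euclidean_space set"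
  assumes "convex K" "compact K"
  shows "emeasure lborel (interior K) = ennreal (measure lborel K)"
    and "AE x in lborel. indicator (interior K) x = (indicator K x :: real)"
proof -
  have "negligible (frontier K)" by (rule negligible_convex_frontier[OF assms(1)])
  then have n: "frontier K \<in> null_sets lborel"
    by (simp add: negligible_iff_null_sets null_sets_completion_iff)
  then show ae: "AE x in lborel. indicator (interior K) x = (indicator K x :: real)"
    by (rule AE_I') (use interior_subset[of K] closure_subset[of K] in \<open>auto simp: frontier_def indicator_def\<close>)
  have "emeasure lborel (interior K) = emeasure lborel K"
    using ae assms by (intro emeasure_eq_AE) (auto elim!: eventually_mono simp: indicator_def split: if_splits intro: borel_compact)
  also have "\<dots> = ennreal (measure lborel K)"
    using emeasure_compact_finite[OF assms(2)] by (simp add: emeasure_eq_ennreal_measure less_top)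
  finally show "emeasure lborel (interior K) = ennreal (measure lborel K)" .
qed

text \<open>The functional form is applied to the Gaussians of the gauge \<open>k\<close> and of the
  support function \<open>h\<close>, since \<open>x \<bullet> y \<le> k x * h y\<close> and twice
  this product is at most the sum of the squares. Their integrals are the volumes of
  \<open>K\<close> and of its polar times a common constant; the volume of the ball times that
  constant squares to exactly \<open>(2 * pi) ^ DIM('a)\<close>, so the constant cancels.\<close>

lemma blaschke_santalo:
  fixes K :: "'a::euclidean_space set"
  assumes K: "origin_body K" and bary: "(LINT x:K|lborel. x) = 0"
  shows "measure lborel K * measure lborel (polar_body K) \<le> (measure lborel (cball (0::'a) 1))\<^sup>2"
proof -
  define k where "k = gauge_fun K"
  define h where "h = support_fun K"
  note P = origin_body_polar[OF K]
  have [measurable]: "k \<in> borel_measurable borel" "h \<in> borel_measurable borel"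
    unfolding k_def h_def using continuous_gauge[OF K, of UNIV] continuous_support_fun[OF origin_bodyD(2,6)[OF K], of UNIV]
    by (auto intro: borel_measurable_continuous_onI)
  have k1: "{x. k x < 1} = interior K" using mem_interior_iff_gauge_less[OF K] by (auto simp: k_def)
  have h1: "{x. h x < 1} = interior (polar_body K)"
    using mem_interior_iff_gauge_less[OF P] polar_polar_body[OF K] by (auto simp: h_def)
  have hom: "k (c *\<^sub>R x) = c * k x" "h (c *\<^sub>R x) = c * h x" if "0 < c" for c x
    using that gauge_scaleR[OF K, of c x] support_fun_scaleR[OF origin_bodyD(2,6)[OF K], of c x] by (auto simp: k_def h_def)
  have nn: "0 \<le> k x" "0 \<le> h x" for x using gauge_nonneg[OF K] support_fun_nonneg[OF K] by (auto simp: k_def h_def)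
  let ?C = "gauss_const DIM('a)"
  have Ik: "(\<integral>\<^sup>+x. ennreal (exp (- ((k x)\<^sup>2 / 2))) \<partial>lborel) = ennreal (measure lborel K) * ?C"
    using nn_integral_gauss_gauge[of k] nn hom k1 emeasure_interior_body(1)[OF origin_bodyD(1,2)[OF K]] by simp
  have Ih: "(\<integral>\<^sup>+x. ennreal (exp (- ((h x)\<^sup>2 / 2))) \<partial>lborel) = ennreal (measure lborel (polar_body K)) * ?C"
    using nn_integral_gauss_gauge[of h] nn hom h1 emeasure_interior_body(1)[OF origin_bodyD(1,2)[OF P]] by simp
  obtain R where R: "R > 0" "\<And>x. x \<in> K \<Longrightarrow> norm x \<le> R"
    using compact_imp_bounded[OF origin_bodyD(2)[OF K]] bounded_pos by blast
  have Rk: "norm x \<le> R * k x" for x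
  proof (cases "x = 0")
    case False
    then have kx: "k x > 0" using gauge_pos[OF K] by (simp add: k_def)
    have "k ((1 / k x) *\<^sub>R x) \<le> 1" using kx hom(1)[of "1 / k x" x] by simp
    then have "(1 / k x) *\<^sub>R x \<in> K" by (simp add: mem_iff_gauge_le[OF K] k_def)
    from R(2)[OF this] show ?thesis using kx by (simp add: field_simps)
  qed (use R nn in auto)
  have Kint: "integrable lborel (\<lambda>x. indicator K x *\<^sub>R x)"
    using borel_integrable_compact[OF origin_bodyD(2)[OF K], of "\<lambda>x. x"] by auto
  have fin: "emeasure lborel {x. k x < 1} < top"
    using k1 emeasure_interior_body(1)[OF origin_bodyD(1,2)[OF K]] by simp
  have b0: "(LINT x|lborel. indicator {x. k x < 1} x * (x \<bullet> b)) = 0" for b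
  proof -
    have "(LINT x|lborel. indicator {x. k x < 1} x * (x \<bullet> b)) = (LINT x|lborel. (indicator K x *\<^sub>R x) \<bullet> b)"
      unfolding k1 using emeasure_interior_body(2)[OF origin_bodyD(1,2)[OF K]] origin_bodyD(3)[OF K]
      by (intro integral_cong_AE) (auto elim!: eventually_mono simp: borel_closed)
    also have "\<dots> = (LINT x|lborel. indicator K x *\<^sub>R x) \<bullet> b"
      by (rule integral_inner_left) (use Kint in auto)
    also have "\<dots> = 0" using bary by (simp add: set_lebesgue_integral_def)
    finally show ?thesis .
  qed
  have "(\<integral>\<^sup>+x. ennreal (exp (- ((k x)\<^sup>2 / 2))) \<partial>lborel) * (\<integral>\<^sup>+x. ennreal (exp (- ((h x)\<^sup>2 / 2))) \<partial>lborel)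
      \<le> ennreal ((2 * pi) ^ DIM('a))"
  proof (rule functional_santalo)
    fix x y
    have "0 \<le> (k x - h y)\<^sup>2" by simp
    then have "k x * h y \<le> (k x)\<^sup>2 / 2 + (h y)\<^sup>2 / 2" by (simp add: power2_eq_square algebra_simps)
    moreover have "x \<bullet> y \<le> k x * h y" using inner_le_gauge_support[OF K] by (simp add: k_def h_def)
    ultimately have "exp (- ((k x)\<^sup>2 / 2)) * exp (- ((h y)\<^sup>2 / 2)) \<le> exp (- (x \<bullet> y))"
      by (simp flip: exp_add)
    then show "ennreal (exp (- ((k x)\<^sup>2 / 2))) * ennreal (exp (- ((h y)\<^sup>2 / 2))) \<le> ennreal (exp (- (x \<bullet> y)))"
      by (simp flip: ennreal_mult)
  qed (use gauss_gauge_barycenter[of k R] nn hom Rk R fin b0 in auto)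
  then have 1: "(ennreal (measure lborel K) * ?C) * (ennreal (measure lborel (polar_body K)) * ?C) \<le> ennreal ((2 * pi) ^ DIM('a))"
    by (simp add: Ik Ih)
  let ?B = "measure lborel (cball (0::'a) 1)"
  obtain c where c: "?C = ennreal c" "0 \<le> c" using gauss_const_pos_finite(2)[where 'a='a] by (cases ?C) auto
  have c0: "c > 0" using gauss_const_pos_finite(1)[where 'a='a] c by (cases "c = 0") auto
  have "?B * c = sqrt (2 * pi) ^ DIM('a)"
    using gauss_const_ball[where 'a='a] c by (simp flip: ennreal_mult)
  then have "(?B * c)\<^sup>2 = (2 * pi) ^ DIM('a)"
    using real_sqrt_pow2[of "2 * pi"] by (simp only: power_mult[symmetric] mult.commute[of _ 2]) (simp add: power_mult)
  moreover have "(measure lborel K * c) * (measure lborel (polar_body K) * c) \<le> (2 * pi) ^ DIM('a)"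
    using 1 c by (simp flip: ennreal_mult)
  ultimately have "(measure lborel K * measure lborel (polar_body K)) * c\<^sup>2 \<le> ?B\<^sup>2 * c\<^sup>2"
    by (simp add: power2_eq_square algebra_simps)
  then show ?thesis using c0 by simp
qed

section \<open>Change of variables\<close>

text \<open>A copy of a finite index type, to be well-ordered through some injection into
  \<open>nat\<close>. As a new type it can carry this order whatever order the original has;
  Lebesgue measure and determinants are then transported along the relabelling.\<close>

typedef 'a wo_copy = "UNIV :: 'a set" by auto

definition wo_index :: "'a::finite wo_copy \<Rightarrow> nat" where
  "wo_index x = (SOME f. inj f) (Rep_wo_copy x)"

lemma inj_wo_index: "inj (wo_index :: 'a::finite wo_copy \<Rightarrow> nat)"
proof -
  obtain f :: "'a \<Rightarrow> nat" where "inj f" using finite_imp_inj_to_nat_seg[of "UNIV :: 'a set"] by auto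
  then have "inj (SOME f :: 'a \<Rightarrow> nat. inj f)" by (rule someI[where P=inj])
  moreover have "inj (Rep_wo_copy :: 'a wo_copy \<Rightarrow> 'a)" by (simp add: inj_on_def Rep_wo_copy_inject)
  ultimately have "inj ((SOME f :: 'a \<Rightarrow> nat. inj f) \<circ> Rep_wo_copy)" by (rule inj_compose)
  then show ?thesis by (simp add: wo_index_def[abs_def] comp_def)
qed

instantiation wo_copy :: (finite) "{finite, wellorder}"
begin

definition less_eq_wo_copy :: "'a wo_copy \<Rightarrow> 'a wo_copy \<Rightarrow> bool" where
  "less_eq_wo_copy x y \<longleftrightarrow> wo_index x \<le> wo_index y"

definition less_wo_copy :: "'a wo_copy \<Rightarrow> 'a wo_copy \<Rightarrow> bool" where
  "less_wo_copy x y \<longleftrightarrow> wo_index x < wo_index y"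

instance
proof
  have "UNIV = range (Abs_wo_copy :: 'a \<Rightarrow> _)"
    by (metis Rep_wo_copy_inverse UNIV_eq_I rangeI)
  then show "finite (UNIV :: 'a wo_copy set)" by (metis finite finite_imageI)
  fix x y z :: "'a wo_copy"
  show "x < y \<longleftrightarrow> x \<le> y \<and> \<not> y \<le> x" "x \<le> x" "x \<le> y \<Longrightarrow> y \<le> z \<Longrightarrow> x \<le> z" "x \<le> y \<or> y \<le> x"
    by (auto simp: less_eq_wo_copy_def less_wo_copy_def)
  show "x \<le> y \<Longrightarrow> y \<le> x \<Longrightarrow> x = y"
    using inj_wo_index by (auto simp: less_eq_wo_copy_def inj_def)
  fix P :: "'a wo_copy \<Rightarrow> bool" and a :: "'a wo_copy"
  assume step: "\<And>x. (\<And>y. y < x \<Longrightarrow> P y) \<Longrightarrow> P x"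
  show "P a"
    by (induction "wo_index a" arbitrary: a rule: less_induct) (auto intro: step simp: less_wo_copy_def)
qed

end

lemma bij_Rep_wo_copy: "bij Rep_wo_copy" and bij_Abs_wo_copy: "bij Abs_wo_copy"
proof -
  have "Rep_wo_copy \<circ> Abs_wo_copy = id" "Abs_wo_copy \<circ> Rep_wo_copy = id"
    by (simp_all add: fun_eq_iff Rep_wo_copy_inverse Abs_wo_copy_inverse)
  then show "bij Rep_wo_copy" "bij Abs_wo_copy" by (auto intro: o_bij)
qed

text \<open>Conjugation by the relabelling sends transpositions to transpositions, so the parity of
  a permutation survives.\<close>

lemma swapidseq_conj:
  assumes "swapidseq n p"
  shows "swapidseq n (Abs_wo_copy \<circ> p \<circ> Rep_wo_copy)"
  using assms
proof (induction rule: swapidseq.induct)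
  case id
  have "Abs_wo_copy \<circ> id \<circ> Rep_wo_copy = id" by (auto simp: fun_eq_iff Rep_wo_copy_inverse)
  then show ?case using swapidseq.id by metis
next
  case (comp_Suc n p a b)
  have "Abs_wo_copy \<circ> (Transposition.transpose a b \<circ> p) \<circ> Rep_wo_copy
    = Transposition.transpose (Abs_wo_copy a) (Abs_wo_copy b) \<circ> (Abs_wo_copy \<circ> p \<circ> Rep_wo_copy)"
    by (auto simp: fun_eq_iff Transposition.transpose_def Abs_wo_copy_inject)
  moreover have "Abs_wo_copy a \<noteq> Abs_wo_copy b" using comp_Suc by (simp add: Abs_wo_copy_inject)
  ultimately show ?case using swapidseq.comp_Suc[OF comp_Suc.IH] by metis
qed

text \<open>Relabelling rows and columns together conjugates the permutations in the Leibniz sum and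
  keeps their signs.\<close>

lemma det_reindex:
  fixes A :: "real^'n^'n"
  shows "det (\<chi> i j. A $ Rep_wo_copy i $ Rep_wo_copy j) = det A"
proof -
  let ?c = "\<lambda>p. Abs_wo_copy \<circ> p \<circ> Rep_wo_copy :: 'n wo_copy \<Rightarrow> 'n wo_copy"
  note [simp] = Abs_wo_copy_inverse[OF UNIV_I] Rep_wo_copy_inverse
  have perm: "p permutes UNIV \<longleftrightarrow> bij p" for p :: "'x \<Rightarrow> 'x"
    by (simp add: permutes_univ bij_iff)
  have bij: "bij_betw ?c {p. p permutes UNIV} {p. p permutes UNIV}"
  proof (rule bij_betw_byWitness[where f'="\<lambda>p. Rep_wo_copy \<circ> p \<circ> Abs_wo_copy"])
    show "?c ` {p. p permutes UNIV} \<subseteq> {p. p permutes UNIV}"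
      using bij_Rep_wo_copy bij_Abs_wo_copy by (auto simp: perm intro!: bij_comp)
    show "(\<lambda>p. Rep_wo_copy \<circ> p \<circ> Abs_wo_copy) ` {p. p permutes UNIV} \<subseteq> {p. p permutes UNIV}"
      using bij_Rep_wo_copy bij_Abs_wo_copy by (auto simp: perm intro!: bij_comp)
  qed (auto simp: fun_eq_iff)
  have sign: "sign (?c p) = sign p" if "p permutes UNIV" for p :: "'n \<Rightarrow> 'n"
  proof -
    have "permutation p" using that permutation_permutes[of p] finite[of UNIV] by metis
    then obtain n where n: "swapidseq n p" by (auto simp: permutation_def)
    show ?thesis using evenperm_unique[OF n refl] evenperm_unique[OF swapidseq_conj[OF n] refl]
      by (simp add: sign_def)
  qed
  have "det (\<chi> i j. A $ Rep_wo_copy i $ Rep_wo_copy j)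
     = (\<Sum>p | p permutes (UNIV :: 'n set). of_int (sign (?c p)) * (\<Prod>i\<in>UNIV. A $ Rep_wo_copy i $ Rep_wo_copy (?c p i)))"
    unfolding det_def by (subst sum.reindex_bij_betw[OF bij, symmetric]) simp
  also have "\<dots> = det A"
    unfolding det_def
  proof (intro sum.cong refl)
    fix p :: "'n \<Rightarrow> 'n" assume p: "p \<in> {p. p permutes UNIV}"
    have "(\<Prod>i\<in>UNIV. A $ Rep_wo_copy i $ Rep_wo_copy (?c p i)) = (\<Prod>i\<in>UNIV. A $ i $ p i)"
      using prod.reindex_bij_betw[OF bij_Rep_wo_copy, of "\<lambda>i. A $ i $ p i"] by simp
    then show "of_int (sign (?c p)) * (\<Prod>i\<in>UNIV. A $ Rep_wo_copy i $ Rep_wo_copy (?c p i)) = of_int (sign p) * (\<Prod>i\<in>UNIV. A $ i $ p i)"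
      using sign p by simp
  qed
  finally show ?thesis .
qed

definition to_wo :: "real^'n \<Rightarrow> real^('n::finite wo_copy)" where
  "to_wo x = (\<chi> i. x $ Rep_wo_copy i)"

definition of_wo :: "real^('n::finite wo_copy) \<Rightarrow> real^'n" where
  "of_wo y = (\<chi> i. y $ Abs_wo_copy i)"

lemma to_of_wo [simp]: "to_wo (of_wo y) = y" and of_to_wo [simp]: "of_wo (to_wo x) = x"
  by (simp_all add: to_wo_def of_wo_def vec_eq_iff Abs_wo_copy_inverse Rep_wo_copy_inverse)

lemma linear_to_wo: "linear to_wo" and linear_of_wo: "linear of_wo"
  by (auto intro!: linearI simp: to_wo_def of_wo_def vec_eq_iff)

lemma distr_to_wo: "distr lborel borel (to_wo :: real^'n \<Rightarrow> _) = lborel"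
proof (rule lborel_eqI[symmetric])
  have [measurable]: "(to_wo :: real^'n \<Rightarrow> _) \<in> borel_measurable borel"
    by (intro borel_measurable_continuous_onI linear_continuous_on linear_conv_bounded_linear[THEN iffD1] linear_to_wo)
  fix l u :: "real^('n wo_copy)" assume le: "\<And>b. b \<in> Basis \<Longrightarrow> l \<bullet> b \<le> u \<bullet> b"
  have le': "l $ i \<le> u $ i" for i using le[of "axis i 1"] by (simp add: axis_in_Basis_iff inner_axis)
  have "to_wo -` box l u = box (of_wo l) (of_wo u)"
    by (auto simp: mem_box_cart to_wo_def of_wo_def)
      (metis Abs_wo_copy_inverse Rep_wo_copy_inverse UNIV_I)+
  then have "emeasure (distr lborel borel to_wo) (box l u) = emeasure lborel (box (of_wo l) (of_wo u))"
    by (subst emeasure_distr) auto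
  also have "\<dots> = (\<Prod>b\<in>Basis. (of_wo u - of_wo l) \<bullet> b)"
    using le' by (intro emeasure_lborel_box) (auto simp: Basis_vec_def inner_axis of_wo_def)
  also have "(\<Prod>b\<in>Basis. (of_wo u - of_wo l) \<bullet> b) = (\<Prod>i\<in>UNIV. (of_wo u - of_wo l) $ i)"
    by (rule prod.reindex_cong[of "\<lambda>i. axis i 1"]) (auto simp: Basis_vec_def inner_axis inj_on_def axis_eq_axis)
  also have "\<dots> = (\<Prod>i\<in>UNIV. (u - l) $ i)"
    using prod.reindex_bij_betw[OF bij_Abs_wo_copy, of "\<lambda>i. (u - l) $ i"] by (simp add: of_wo_def)
  also have "\<dots> = (\<Prod>b\<in>Basis. (u - l) \<bullet> b)"
    by (rule prod.reindex_cong[of "\<lambda>i. axis i 1", symmetric]) (auto simp: Basis_vec_def inner_axis inj_on_def axis_eq_axis)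
  finally show "emeasure (distr lborel borel to_wo) (box l u) = (\<Prod>b\<in>Basis. (u - l) \<bullet> b)" .
qed simp

lemma measurable_linear_vec: "linear (f :: real^'n \<Rightarrow> real^'m) \<Longrightarrow> f \<in> measurable lborel lborel"
  by (simp add: borel_measurable_continuous_onI linear_continuous_on linear_conv_bounded_linear)

lemma distr_of_wo: "distr lborel borel (of_wo :: _ \<Rightarrow> real^'n) = lborel"
proof -
  have "distr (distr lborel borel (to_wo :: real^'n \<Rightarrow> _)) borel (of_wo :: _ \<Rightarrow> real^'n) = distr lborel borel (of_wo \<circ> to_wo)"
    using measurable_linear_vec[OF linear_to_wo] measurable_linear_vec[OF linear_of_wo]
    by (intro distr_distr) auto
  also have "of_wo \<circ> to_wo = (\<lambda>x :: real^'n. x)" by auto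
  also have "distr lborel borel (\<lambda>x :: real^'n. x) = lborel" by (rule distr_id2) simp
  finally show ?thesis by (simp add: distr_to_wo)
qed

text \<open>Preservation of the Borel measure passes to the completions on both sides.\<close>

lemma lebesgue_distr_linear:
  fixes f :: "real^'n \<Rightarrow> real^'m"
  assumes f: "linear f" and d: "distr lborel borel f = lborel"
  shows "f \<in> measurable lebesgue lebesgue" and "distr lebesgue lebesgue f = lebesgue"
proof -
  have m: "f \<in> measurable lborel lborel" by (rule measurable_linear_vec[OF f])
  have d': "distr lborel lborel f = lborel" using d by (simp cong: distr_cong)
  have d'': "distr lebesgue lborel f = lborel" using distr_completion[OF m] d' by simp
  have m': "f \<in> measurable lebesgue lborel" by (rule measurable_completion[OF m])
  show "f \<in> measurable lebesgue lebesgue"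
    by (rule completion.measurable_completion2[OF m']) (simp add: d'')
  show "distr lebesgue lebesgue f = lebesgue"
    using completion.completion_distr_eq[OF m'] by (simp add: d'')
qed

text \<open>The change of variables theorem of the library is restricted to well-ordered index types;
  here it is transferred to arbitrary finite ones.\<close>

lemma integral_abs_det_eq_measure_image:
  fixes f :: "real^'n \<Rightarrow> real^'n"
  assumes S: "S \<in> sets lebesgue"
    and der: "\<And>x. x \<in> S \<Longrightarrow> (f has_derivative f' x) (at x within S)"
    and inj: "inj_on f S" and fS: "f ` S \<in> lmeasurable"
  shows "set_integrable lebesgue S (\<lambda>x. \<bar>det (matrix (f' x))\<bar>)"
    and "(LINT x:S|lebesgue. \<bar>det (matrix (f' x))\<bar>) = measure lebesgue (f ` S)"
proof -
  have mt: "(to_wo :: real^'n \<Rightarrow> _) \<in> measurable lebesgue lebesgue" "distr lebesgue lebesgue (to_wo :: real^'n \<Rightarrow> _) = lebesgue"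
    by (rule lebesgue_distr_linear[OF linear_to_wo distr_to_wo])+
  have mo: "(of_wo :: _ \<Rightarrow> real^'n) \<in> measurable lebesgue lebesgue"
    by (rule lebesgue_distr_linear[OF linear_of_wo distr_of_wo])
  have img: "to_wo ` A = of_wo -` A" for A :: "(real^'n) set"
    by (auto intro: rev_image_eqI)
  have sets: "to_wo ` A \<in> sets lebesgue" if "A \<in> sets lebesgue" for A :: "(real^'n) set"
    using measurable_sets[OF mo that] by (simp add: img)
  have em: "emeasure lebesgue (to_wo ` A) = emeasure lebesgue A" if "A \<in> sets lebesgue" for A :: "(real^'n) set"
  proof -
    have "emeasure (distr lebesgue lebesgue to_wo) (to_wo ` A) = emeasure lebesgue (to_wo -` (to_wo ` A) \<inter> space lebesgue)"
      by (rule emeasure_distr[OF mt(1) sets[OF that]])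
    also have "to_wo -` (to_wo ` A) \<inter> space lebesgue = A" by (auto simp: img)
    finally show ?thesis by (simp add: mt(2))
  qed
  define S' where "S' = to_wo ` S"
  \<comment> \<open>\<open>f\<close> seen in the relabelled coordinates, to which
    \<open>has_measure_differentiable_image\<close> applies.\<close>
  define g where "g = to_wo \<circ> f \<circ> of_wo"
  define g' where "g' y = to_wo \<circ> f' (of_wo y) \<circ> of_wo" for y
  have S'_iff: "y \<in> S' \<longleftrightarrow> of_wo y \<in> S" for y by (simp add: S'_def img)
  have gS: "g ` S' = to_wo ` (f ` S)" by (force simp: g_def S'_def)
  have "of_wo ` S' = S" by (force simp: S'_def)
  have der': "(g has_derivative g' y) (at y within S')" if "y \<in> S'" for y
    unfolding g_def g'_def comp_assoc
  proof (rule diff_chain_within)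
    show "(f \<circ> of_wo has_derivative f' (of_wo y) \<circ> of_wo) (at y within S')"
      using der that by (intro diff_chain_within) (auto simp: \<open>of_wo ` S' = S\<close> S'_iff intro: linear_imp_has_derivative linear_of_wo)
  qed (intro linear_imp_has_derivative linear_to_wo)
  have inj': "inj_on g S'"
    using inj by (auto simp: inj_on_def g_def S'_iff) (metis of_to_wo to_of_wo)
  have gS': "g ` S' \<in> lmeasurable"
    using fS sets em unfolding gS by (auto simp: fmeasurable_def)
  have "measure lebesgue (g ` S') = measure lebesgue (f ` S)"
    using em[of "f ` S"] fS unfolding gS by (simp add: measure_def fmeasurableD)
  then have hi: "((\<lambda>y. \<bar>det (matrix (g' y))\<bar>) has_integral measure lebesgue (f ` S)) S'"
    using has_measure_differentiable_image[OF sets[OF S, folded S'_def] der' inj', of "measure lebesgue (f ` S)"] gS' by simp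
  have det: "det (matrix (g' y)) = det (matrix (f' (of_wo y)))" for y
  proof -
    have ax: "of_wo (axis j 1) = axis (Rep_wo_copy j) 1" for j :: "'n wo_copy"
      by (auto simp: of_wo_def axis_def vec_eq_iff Abs_wo_copy_inverse Rep_wo_copy_inverse)
    have "matrix (g' y) = (\<chi> i j. matrix (f' (of_wo y)) $ Rep_wo_copy i $ Rep_wo_copy j)"
      by (simp add: matrix_def g'_def to_wo_def ax)
    then show ?thesis by (simp add: det_reindex)
  qed
  define h where "h y = indicat_real S' y *\<^sub>R \<bar>det (matrix (f' (of_wo y)))\<bar>" for y
  have "(\<lambda>y. \<bar>det (matrix (g' y))\<bar>) absolutely_integrable_on S'"
    using hi by (intro nonnegative_absolutely_integrable_1) auto
  then have hint: "integrable lebesgue h"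
    by (simp add: set_integrable_def h_def[abs_def] det)
  have "(LINT y:S'|lebesgue. \<bar>det (matrix (g' y))\<bar>) = measure lebesgue (f ` S)"
    using \<open>(\<lambda>y. \<bar>det (matrix (g' y))\<bar>) absolutely_integrable_on S'\<close> hi
    by (subst set_lebesgue_integral_eq_integral(2)) (auto simp: integral_unique)
  then have heq: "(LINT y|lebesgue. h y) = measure lebesgue (f ` S)"
    by (simp add: set_lebesgue_integral_def h_def det)
  have hT: "h (to_wo x) = indicator S x *\<^sub>R \<bar>det (matrix (f' x))\<bar>" for x
    by (simp add: h_def S'_iff indicator_def)
  have "integrable lebesgue (\<lambda>x. h (to_wo x :: real^'n wo_copy))"
    by (rule integrable_distr[OF mt(1)]) (simp add: mt(2) hint)
  then show "set_integrable lebesgue S (\<lambda>x. \<bar>det (matrix (f' x))\<bar>)"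
    by (simp add: set_integrable_def hT)
  have "(LINT x|lebesgue. h (to_wo x :: real^'n wo_copy)) = measure lebesgue (f ` S)"
    using integral_distr[OF mt(1), of h] hint heq by (simp add: mt(2))
  then show "(LINT x:S|lebesgue. \<bar>det (matrix (f' x))\<bar>) = measure lebesgue (f ` S)"
    by (simp add: set_lebesgue_integral_def hT)
qed

section \<open>Regular bodies\<close>

text \<open>Adding multiples of row \<open>k\<close> to the other rows does not change the
  determinant, so it is that of the identity with row \<open>k\<close> replaced by
  \<open>b\<close>.\<close>

lemma det_replace_row_identity:
  fixes b :: "real^'n"
  assumes "finite T" "k \<notin> T"
  shows "det (\<chi> i. if i = k then b else if i \<in> T then axis i 1 + a i *s b else axis i (1::real)) = b $ k"
  using assms
proof (induction T rule: finite_induct)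
  case empty
  have r: "row i (mat 1 :: real^'n^'n) = axis i 1" for i
    by (simp add: row_def mat_def axis_def vec_eq_iff)
  have "det (\<chi> i. if i = k then b else axis i (1::real)) = b $ k * det (mat 1 :: real^'n^'n)"
    using cramer_lemma_transpose[of k b "mat 1"] unfolding r basis_expansion by simp
  then show ?case by (simp cong: if_cong)
next
  case (insert j T)
  let ?A = "\<chi> i. if i = k then b else if i \<in> T then axis i 1 + a i *s b else axis i (1::real)"
  have "det (\<chi> i. if i = j then row j ?A + a j *s row k ?A else row i ?A) = det ?A"
    using insert by (intro det_row_operation) auto
  moreover have "(\<chi> i. if i = j then row j ?A + a j *s row k ?A else row i ?A)
    = (\<chi> i. if i = k then b else if i \<in> insert j T then axis i 1 + a i *s b else axis i 1)"
    using insert by (auto simp: vec_eq_iff row_def)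
  moreover have "det ?A = b $ k" using insert by blast
  ultimately show ?case by (simp only:)
qed

text \<open>Row \<open>k\<close> is a unit vector plus a multiple of \<open>b\<close>. Linearity in
  this row leaves the case of the smaller set and a determinant of the preceding kind.\<close>

lemma det_rank_one_rows:
  fixes a b :: "real^'n"
  assumes "finite T"
  shows "det (\<chi> i. if i \<in> T then axis i 1 + a $ i *s b else axis i (1::real)) = 1 + (\<Sum>i\<in>T. a $ i * b $ i)"
  using assms
proof (induction T rule: finite_induct)
  case empty
  have "(\<chi> i. axis i 1) = (mat 1 :: real^'n^'n)" by (simp add: mat_def axis_def vec_eq_iff)
  then show ?case by simp
next
  case (insert k T)
  let ?c = "\<lambda>i. if i \<in> T then axis i 1 + a $ i *s b else axis i (1::real)"
  have "(\<chi> i. if i \<in> insert k T then axis i 1 + a $ i *s b else axis i (1::real))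
      = (\<chi> i. if i = k then axis i 1 + a $ i *s b else ?c i)"
    by (auto simp: vec_eq_iff)
  also have "det \<dots> = det (\<chi> i. if i = k then axis i 1 else ?c i) + det (\<chi> i. if i = k then a $ i *s b else ?c i)"
    by (rule det_row_add)
  also have "(\<chi> i. if i = k then axis i 1 else ?c i) = (\<chi> i. ?c i)"
    using insert by (auto simp: vec_eq_iff)
  also have "det (\<chi> i. if i = k then a $ i *s b else ?c i) = det (\<chi> i. if i = k then a $ k *s b else ?c i)"
    by (rule arg_cong[of _ _ det]) (auto simp: vec_eq_iff)
  also have "\<dots> = a $ k * det (\<chi> i. if i = k then b else ?c i)"
    by (rule det_row_mul)
  also have "det (\<chi> i. if i = k then b else ?c i) = b $ k"
    by (rule det_replace_row_identity) (use insert in auto)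
  also have "det (\<chi> i. ?c i) = 1 + (\<Sum>i\<in>T. a $ i * b $ i)" by (rule insert.IH)
  finally show ?case using insert.hyps by simp
qed

text \<open>The matrix determinant lemma. The Jacobians of the radial maps below are simpler
  determinants up to a rank-one factor of this form.\<close>

lemma det_rank_one:
  fixes a b :: "real^'n"
  shows "det (matrix (\<lambda>v. v + (b \<bullet> v) *\<^sub>R a)) = 1 + b \<bullet> a"
proof -
  have "matrix (\<lambda>v. v + (b \<bullet> v) *\<^sub>R a) = (\<chi> i. if i \<in> UNIV then axis i 1 + a $ i *s b else axis i 1)"
    by (simp add: matrix_def vec_eq_iff inner_axis) (simp add: axis_def)
  then show ?thesis
    using det_rank_one_rows[of UNIV a b] by (simp add: inner_vec_def mult.commute)
qed

lemma det_matrix_compose: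
  fixes f g :: "real^'n \<Rightarrow> real^'n"
  assumes "linear f" "linear g"
  shows "det (matrix (\<lambda>v. f (g v))) = det (matrix f) * det (matrix g)"
  using matrix_compose[OF assms(2,1)] by (simp add: det_mul comp_def)

lemma det_matrix_scaleR:
  fixes c :: real
  shows "det (matrix (\<lambda>v :: real^'n. c *\<^sub>R v)) = c ^ CARD('n)"
proof -
  have "matrix (\<lambda>v :: real^'n. c *\<^sub>R v) = (\<chi> i j. if i = j then c else 0)"
    by (auto simp: matrix_def vec_eq_iff axis_def)
  then show ?thesis
    by (simp add: det_diagonal)
qed

text \<open>Along the segment from the identity to \<open>f\<close> the determinant never vanishes,
  so it keeps the sign that it has at the identity.\<close>

lemma det_pos_if_monotone:
  fixes f :: "real^'n \<Rightarrow> real^'n"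
  assumes f: "linear f" and mono: "\<And>v. 0 \<le> v \<bullet> f v" and nz: "det (matrix f) \<noteq> 0"
  shows "det (matrix f) > 0"
proof (rule ccontr)
  assume neg: "\<not> det (matrix f) > 0"
  define F where "F t = (\<lambda>v. (1 - t) *\<^sub>R v + t *\<^sub>R f v)" for t :: real
  define \<phi> where "\<phi> t = det (matrix (F t))" for t
  have lin: "linear (F t)" for t unfolding F_def
    using f by (intro linear_compose_add linear_compose_scale_right linear_id[unfolded id_def] f)
  have cont: "continuous_on {0..1} \<phi>"
    unfolding \<phi>_def F_def det_def matrix_def by (simp) (intro continuous_intros)
  \<comment> \<open>For \<open>t < 1\<close> the identity contributes a strictly positive quadratic
    form; at \<open>t = 1\<close> the form may degenerate and \<open>nz\<close> takes over.\<close>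
  have nonzero: "\<phi> t \<noteq> 0" if t: "0 \<le> t" "t \<le> 1" for t
  proof (cases "t = 1")
    case True
    then show ?thesis using nz by (simp add: \<phi>_def F_def)
  next
    case False
    have "v = 0" if "F t v = 0" for v
    proof -
      have "0 = v \<bullet> F t v" using that by simp
      also have "\<dots> = (1 - t) * (v \<bullet> v) + t * (v \<bullet> f v)" by (simp add: F_def inner_add_right)
      finally have "(1 - t) * (v \<bullet> v) \<le> 0" using mult_nonneg_nonneg[OF t(1) mono[of v]] by linarith
      then have "v \<bullet> v \<le> 0" using t False by (simp add: mult_le_0_iff)
      then show ?thesis by (metis inner_eq_zero_iff inner_ge_zero order_antisym)
    qed
    then have "inj (F t)" using linear_injective_0[OF lin] by blast
    then show ?thesis using det_nz_iff_inj[OF lin] by (simp add: \<phi>_def)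
  qed
  have "\<phi> 0 = 1" using matrix_id by (simp add: \<phi>_def F_def id_def)
  moreover have "\<phi> 1 \<le> 0" using neg by (simp add: \<phi>_def F_def)
  ultimately obtain t where "0 \<le> t" "t \<le> 1" "\<phi> t = 0"
    using IVT2'[of \<phi> 1 0 0] cont by auto
  then show False using nonzero by blast
qed

lemma has_derivative_sgn:
  fixes z :: "'a::real_inner"
  assumes z: "z \<noteq> 0"
  shows "(sgn has_derivative (\<lambda>v. (1 / norm z) *\<^sub>R (v - (sgn z \<bullet> v) *\<^sub>R sgn z))) (at z)"
proof -
  have "((\<lambda>z. inverse (norm z) *\<^sub>R z) has_derivative (\<lambda>v. (1 / norm z) *\<^sub>R (v - (sgn z \<bullet> v) *\<^sub>R sgn z))) (at z)"
    using z by (auto intro!: derivative_eq_intros has_derivative_norm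
      simp: sgn_div_norm fun_eq_iff scaleR_diff_right inner_commute field_simps)
  then show ?thesis by (simp add: sgn_div_norm[abs_def] inverse_eq_divide)
qed

lemma homogeneous_derivative_radial:
  fixes f :: "'a::real_normed_vector \<Rightarrow> 'b::real_normed_vector"
  assumes f: "(f has_derivative f') (at z)" and hom: "\<And>c. 0 < c \<Longrightarrow> f (c *\<^sub>R z) = f z"
  shows "f' z = 0"
proof -
  have "((\<lambda>t::real. f (z + t *\<^sub>R z)) has_derivative (\<lambda>t. f' (t *\<^sub>R z))) (at 0)"
  proof -
    have "((\<lambda>t::real. z + t *\<^sub>R z) has_derivative (\<lambda>t. t *\<^sub>R z)) (at 0)"
      by (auto intro!: derivative_eq_intros)
    from has_derivative_compose[OF this, of f f'] f show ?thesis by simp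
  qed
  moreover have "((\<lambda>t::real. f (z + t *\<^sub>R z)) has_derivative (\<lambda>t. 0)) (at 0)"
  proof (rule has_derivative_transform_within_open)
    show "open {-(1::real)<..}" by simp
    show "((\<lambda>t::real. f z) has_derivative (\<lambda>t. 0)) (at 0)" by simp
    show "f z = f (z + t *\<^sub>R z)" if "t \<in> {-1<..}" for t :: real
      using hom[of "1 + t"] that by (simp add: scaleR_add_left)
  qed auto
  ultimately have "(\<lambda>t. f' (t *\<^sub>R z)) = (\<lambda>t::real. 0)" by (rule has_derivative_unique)
  then show ?thesis by (metis scaleR_one)
qed


text \<open>Equality in \<open>inner_le_gauge_support\<close>, normalised so that both factors
  agree. Read backwards it is the same relation for the polar body, and it survives a common
  positive scaling of \<open>z\<close> and \<open>w\<close>.\<close>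

definition dual_pair :: "'a::euclidean_space set \<Rightarrow> 'a \<Rightarrow> 'a \<Rightarrow> bool" where
  "dual_pair K z w \<longleftrightarrow> z \<bullet> w = gauge_fun K z * support_fun K w \<and> gauge_fun K z = support_fun K w"

text \<open>\<open>J\<close> and \<open>Js\<close> are the gradients of half the squared gauge and of half the squared support function.\<close>

locale regular_body =
  fixes K :: "(real^'n) set" and J Js :: "real^'n \<Rightarrow> real^'n"
  assumes ob: "origin_body K"
    and J_iff: "dual_pair K z w \<longleftrightarrow> w = J z"
    and Js_iff: "dual_pair K z w \<longleftrightarrow> z = Js w"
    and diffJ: "z \<noteq> 0 \<Longrightarrow> J differentiable (at z)"
    and diffJs: "w \<noteq> 0 \<Longrightarrow> Js differentiable (at w)"

text \<open>The relation is symmetric, so exchanging \<open>J\<close> and \<open>Js\<close> gives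
  regularity of the polar body; its boundary never has to be examined as a hypersurface.\<close>

lemma regular_body_polar:
  assumes "regular_body K J Js"
  shows "regular_body (polar_body K) Js J"
proof -
  interpret regular_body K J Js by fact
  have "dual_pair (polar_body K) z w \<longleftrightarrow> dual_pair K w z" for z w
    by (auto simp: dual_pair_def polar_polar_body[OF ob] inner_commute)
  then show ?thesis
    using origin_body_polar[OF ob] J_iff Js_iff diffJ diffJs by unfold_locales auto
qed

context regular_body
begin

abbreviation "h \<equiv> support_fun K"
abbreviation "k \<equiv> gauge_fun K"

text \<open>The gradient of the support function: the boundary point with outer normal direction
  \<open>w\<close>, homogeneous of degree 0.\<close>

definition X :: "real^'n \<Rightarrow> real^'n" where "X w = (1 / h w) *\<^sub>R Js w"

lemmas hpos = support_fun_pos[OF ob]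
lemmas kpos = gauge_pos[OF ob]

lemma Js_props: "Js w \<bullet> w = (h w)\<^sup>2" "k (Js w) = h w"
  using Js_iff[of "Js w" w] by (auto simp: dual_pair_def power2_eq_square)

lemma X_props:
  assumes "w \<noteq> 0"
  shows "X w \<bullet> w = h w" "k (X w) = 1" "X w \<in> K" "X w \<in> frontier K" "X w \<noteq> 0"
proof -
  show 1: "X w \<bullet> w = h w" "k (X w) = 1"
    using hpos[OF assms] Js_props[of w] gauge_scaleR[OF ob, of "1 / h w" "Js w"]
    by (auto simp: X_def power2_eq_square)
  then show "X w \<in> K" "X w \<in> frontier K" "X w \<noteq> 0"
    by (auto simp: mem_iff_gauge_le[OF ob] mem_frontier_iff_gauge_eq[OF ob] gauge_eq_0_iff[OF ob])
       (metis gauge_eq_0_iff[OF ob] zero_neq_one)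
qed

text \<open>A point of \<open>K\<close> attaining \<open>h w\<close> has gauge 1, so scaled by
  \<open>h w\<close> it is dual to \<open>w\<close>, and the dual point is unique. This is strict
  convexity of \<open>K\<close>.\<close>

lemma X_unique:
  assumes w: "w \<noteq> 0" and x: "x \<in> K" "x \<bullet> w = h w"
  shows "x = X w"
proof -
  note hw = hpos[OF w]
  have "h w \<le> k x * h w" using inner_le_gauge_support[OF ob, of x w] x by simp
  then have "k x = 1" using hw x(1) by (auto simp: mem_iff_gauge_le[OF ob])
  then have "dual_pair K (h w *\<^sub>R x) w"
    using hw x gauge_scaleR[OF ob, of "h w" x] by (simp add: dual_pair_def)
  then have "h w *\<^sub>R x = Js w" by (simp add: Js_iff)
  then have "X w = (1 / h w) *\<^sub>R (h w *\<^sub>R x)" by (simp add: X_def)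
  then show ?thesis using hw by simp
qed

lemma h_scaleR: "0 \<le> c \<Longrightarrow> h (c *\<^sub>R w) = c * h w"
  by (rule support_fun_scaleR[OF origin_bodyD(2,6)[OF ob]])

lemma X_scaleR:
  assumes "w \<noteq> 0" "0 < c"
  shows "X (c *\<^sub>R w) = X w"
  by (rule X_unique[symmetric]) (use assms X_props[of w] in \<open>auto simp: h_scaleR\<close>)

lemma X_sgn: "w \<noteq> 0 \<Longrightarrow> X (sgn w) = X w"
  using X_scaleR[of w "1 / norm w"] by (simp add: sgn_div_norm inverse_eq_divide)

lemma h_sgn: "h (sgn w) = h w / norm w"
  using h_scaleR[of "1 / norm w" w] by (simp add: sgn_div_norm inverse_eq_divide)

lemma J_X:
  assumes "w \<noteq> 0"
  shows "J (X w) = (1 / h w) *\<^sub>R w"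
  using J_iff[of "X w" "(1 / h w) *\<^sub>R w"] X_props[OF assms] hpos[OF assms]
  by (simp add: dual_pair_def h_scaleR)

lemma sgn_J_X: "w \<noteq> 0 \<Longrightarrow> sgn (J (X w)) = sgn w"
  using J_X[of w] hpos[of w] by (simp add: sgn_scaleR)

lemma J_props: "z \<bullet> J z = (k z)\<^sup>2" "h (J z) = k z"
  using J_iff[of z "J z"] by (auto simp: dual_pair_def power2_eq_square)

lemma J_nonzero: "z \<noteq> 0 \<Longrightarrow> J z \<noteq> 0"
  using J_props(2)[of z] kpos[of z] support_fun_eq_0_iff[OF ob, of "J z"] by auto

lemma X_J:
  assumes "z \<noteq> 0"
  shows "X (J z) = (1 / k z) *\<^sub>R z"
proof (rule X_unique[symmetric])
  show "(1 / k z) *\<^sub>R z \<in> K"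
    using kpos[OF assms] gauge_scaleR[OF ob, of "1 / k z" z] by (simp add: mem_iff_gauge_le[OF ob])
  show "((1 / k z) *\<^sub>R z) \<bullet> J z = h (J z)"
    using kpos[OF assms] J_props[of z] by (simp add: power2_eq_square)
qed (rule J_nonzero[OF assms])

lemma outer_unit_normal_iff: "outer_unit_normal K x u \<longleftrightarrow> norm u = 1 \<and> x = X u"
proof
  assume *: "outer_unit_normal K x u"
  then have u: "norm u = 1" "u \<noteq> 0" and x: "x \<in> K"
    using frontier_subset_closed[OF origin_bodyD(3)[OF ob]] by (auto simp: outer_unit_normal_def)
  have "h u = x \<bullet> u"
    using * x by (intro support_fun_eqI) (auto simp: outer_unit_normal_def inner_diff_left)
  then show "norm u = 1 \<and> x = X u" using X_unique[OF u(2) x] u by simp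
next
  assume *: "norm u = 1 \<and> x = X u"
  then have "u \<noteq> 0" by auto
  then show "outer_unit_normal K x u"
    using * X_props[of u] support_fun_upper[OF origin_bodyD(2)[OF ob], of _ u]
    by (auto simp: outer_unit_normal_def inner_diff_left)
qed

lemma gauss_map_eq:
  assumes "x \<in> frontier K"
  shows "gauss_map K x = sgn (J x)"
proof -
  have kx: "k x = 1" using assms by (simp add: mem_frontier_iff_gauge_eq[OF ob])
  then have x: "x \<noteq> 0" using gauge_eq_0_iff[OF ob, of 0] by auto
  have "X (sgn (J x)) = x" using X_sgn[OF J_nonzero[OF x]] X_J[OF x] kx by simp
  then have "outer_unit_normal K x (sgn (J x))"
    using J_nonzero[OF x] by (simp add: outer_unit_normal_iff norm_sgn)
  moreover have "u = sgn (J x)" if "outer_unit_normal K x u" for u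
  proof -
    have "norm u = 1" "x = X u" using that by (auto simp: outer_unit_normal_iff)
    moreover then have "u \<noteq> 0" by auto
    ultimately show ?thesis using sgn_J_X[of u] by (simp add: sgn_div_norm)
  qed
  ultimately show ?thesis unfolding gauss_map_def by (rule the_equality)
qed

lemma support_point_eq: "norm u = 1 \<Longrightarrow> (THE x. outer_unit_normal K x u) = X u"
  by (simp add: outer_unit_normal_iff)

lemma h_eq_sqrt: "h w = sqrt (Js w \<bullet> w)"
  using Js_props(1)[of w] support_fun_nonneg[OF ob, of w] by simp

lemma diff_h:
  assumes w: "w \<noteq> 0"
  shows "h differentiable (at w)"
proof -
  obtain D where D: "(Js has_derivative D) (at w)" using diffJs[OF w] by (auto simp: differentiable_def)
  have "Js w \<bullet> w > 0" using Js_props(1)[of w] hpos[OF w] by simp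
  then have "((\<lambda>w. sqrt (Js w \<bullet> w)) has_derivative (\<lambda>v. (Js w \<bullet> v + D v \<bullet> w) * (inverse (sqrt (Js w \<bullet> w)) / 2))) (at w)"
    using D by (auto intro!: derivative_eq_intros simp: fun_eq_iff)
  then show ?thesis by (auto simp: differentiable_def h_eq_sqrt[abs_def])
qed

lemma diff_X:
  assumes w: "w \<noteq> 0"
  obtains A where "(X has_derivative A) (at w)"
proof -
  obtain D where D: "(Js has_derivative D) (at w)" using diffJs[OF w] by (auto simp: differentiable_def)
  obtain E where E: "(h has_derivative E) (at w)" using diff_h[OF w] by (auto simp: differentiable_def)
  have "h w \<noteq> 0" using hpos[OF w] by simp
  from has_derivative_scaleR[OF Deriv.has_derivative_inverse[OF this E] D]
  have "\<exists>A. ((\<lambda>w. inverse (h w) *\<^sub>R Js w) has_derivative A) (at w)" by blast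
  moreover have "(\<lambda>w. inverse (h w) *\<^sub>R Js w) = X" by (simp add: X_def fun_eq_iff inverse_eq_divide)
  ultimately show ?thesis using that by auto
qed

text \<open>Monotonicity of the gradient of a convex function, obtained by adding two support
  inequalities.\<close>

lemma X_monotone:
  assumes "z \<noteq> 0" "z' \<noteq> 0"
  shows "0 \<le> (X z - X z') \<bullet> (z - z')"
proof -
  have "X z' \<bullet> z \<le> h z" "X z \<bullet> z' \<le> h z'"
    using X_props(3) assms support_fun_upper[OF origin_bodyD(2)[OF ob]] by blast+
  then show ?thesis
    using X_props(1)[OF assms(1)] X_props(1)[OF assms(2)] by (simp add: inner_diff_left inner_diff_right)
qed

end

context regular_body
begin

text \<open>Among the boundary points \<open>X z\<close>, the product \<open>X z \<bullet> w\<close>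
  is largest at \<open>z = w\<close>, so its derivative vanishes there.\<close>

lemma X_derivative_orthogonal:
  assumes w: "w \<noteq> 0" and A: "(X has_derivative A) (at w)"
  shows "A v \<bullet> w = 0"
proof -
  have "((\<lambda>z. X z \<bullet> w) has_derivative (\<lambda>v. A v \<bullet> w)) (at w)"
    by (rule has_derivative_inner_left[OF A])
  moreover have "\<forall>z\<in>-{0}. X z \<bullet> w \<le> X w \<bullet> w"
    using X_props(1)[OF w] X_props(3) support_fun_upper[OF origin_bodyD(2)[OF ob]] by auto
  ultimately have "(\<lambda>v. A v \<bullet> w) = (\<lambda>v. 0)"
    using w by (intro differential_zero_maxmin[of w "-{0}" "\<lambda>z. X z \<bullet> w"]) auto
  then show ?thesis by metis
qed

text \<open>By \<open>X_monotone\<close> the difference quotients in direction \<open>v\<close> are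
  non-negative for either sign of \<open>t\<close>; the sign passes to the limit.\<close>

lemma X_derivative_monotone:
  assumes w: "w \<noteq> 0" and A: "(X has_derivative A) (at w)"
  shows "0 \<le> v \<bullet> A v"
proof -
  have "((\<lambda>t. w + t *\<^sub>R v) has_vector_derivative v) (at 0)"
    by (auto intro!: derivative_eq_intros simp: has_vector_derivative_def)
  then have "((\<lambda>t. X (w + t *\<^sub>R v)) has_derivative (\<lambda>t. A (t *\<^sub>R v))) (at 0)"
    using has_derivative_compose[of "\<lambda>t. w + t *\<^sub>R v" "\<lambda>t. t *\<^sub>R v" 0 UNIV X A] A
    by (simp add: has_vector_derivative_def)
  then have "((\<lambda>t. X (w + t *\<^sub>R v) \<bullet> v) has_derivative (\<lambda>t. A (t *\<^sub>R v) \<bullet> v)) (at 0)"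
    by (rule has_derivative_inner_left)
  moreover have "A (t *\<^sub>R v) \<bullet> v = (v \<bullet> A v) * t" for t
    using has_derivative_linear[OF A] by (simp add: linear_scale inner_commute)
  ultimately have "((\<lambda>t. X (w + t *\<^sub>R v) \<bullet> v) has_field_derivative (v \<bullet> A v)) (at 0)"
    by (simp add: has_field_derivative_def)
  then have "((\<lambda>t. (X (w + t *\<^sub>R v) \<bullet> v - X w \<bullet> v) / t) \<longlongrightarrow> v \<bullet> A v) (at 0)"
    by (simp add: has_field_derivative_iff)
  moreover have "eventually (\<lambda>t. w + t *\<^sub>R v \<noteq> 0) (at (0::real))"
  proof -
    have "((\<lambda>t. w + t *\<^sub>R v) \<longlongrightarrow> w + 0 *\<^sub>R v) (at 0)" by (intro tendsto_intros)
    then show ?thesis using w by (intro tendsto_imp_eventually_ne) auto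
  qed
  then have "eventually (\<lambda>t. 0 \<le> (X (w + t *\<^sub>R v) \<bullet> v - X w \<bullet> v) / t) (at (0::real))"
    using eventually_neq_at_within[of "0::real" 0 UNIV]
  proof eventually_elim
    case (elim t)
    have "0 \<le> (X (w + t *\<^sub>R v) - X w) \<bullet> ((w + t *\<^sub>R v) - w)" by (rule X_monotone) (use elim w in auto)
    also have "\<dots> = t * (X (w + t *\<^sub>R v) \<bullet> v - X w \<bullet> v)" by (simp add: inner_diff_left)
    finally show ?case by (simp add: zero_le_mult_iff divide_nonneg_nonneg divide_nonpos_nonpos zero_le_divide_iff) argo
  qed
  ultimately show ?thesis by (rule tendsto_lowerbound) auto
qed

text \<open>The Gauss map inverts \<open>X\<close> on directions, so its differential
  \<open>W\<close> composed with \<open>A\<close> is the projection onto the tangent space. Extended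
  by the identity on the normal line, the two become inverse to each other, hence
  \<open>det (matrix M)\<close> is the reciprocal of the Gauss curvature. It is positive because
  \<open>M\<close> is monotone and invertible.\<close>

lemma curvature_fun_eq_det:
  assumes u: "norm u = 1" and A: "(X has_derivative A) (at u)"
  defines "M \<equiv> \<lambda>v. A v + (u \<bullet> v) *\<^sub>R u"
  shows "curvature_fun K u = det (matrix M)" and "det (matrix M) > 0"
proof -
  have u0: "u \<noteq> 0" using u by auto
  have uu: "u \<bullet> u = 1" using u by (simp add: dot_square_norm)
  have su: "sgn u = u" using u by (simp add: sgn_div_norm)
  define x where "x = X u"
  have xf: "x \<in> frontier K" and x0: "x \<noteq> 0" using X_props[OF u0] by (auto simp: x_def)
  have gx: "gauss_map K x = u" using gauss_map_eq[OF xf] sgn_J_X[OF u0] su by (simp add: x_def)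
  define W where "W = frechet_derivative (gauss_map K) (at x within frontier K)"
  have W: "(gauss_map K has_derivative W) (at x within frontier K)"
  proof -
    obtain B where B: "(J has_derivative B) (at x)" using diffJ[OF x0] by (auto simp: differentiable_def)
    have "((\<lambda>z. sgn (J z)) has_derivative (\<lambda>v. (1 / norm (J x)) *\<^sub>R (B v - (sgn (J x) \<bullet> B v) *\<^sub>R sgn (J x)))) (at x)"
      using has_derivative_compose[OF B has_derivative_sgn[OF J_nonzero[OF x0]]] by simp
    then have "((\<lambda>z. sgn (J z)) has_derivative (\<lambda>v. (1 / norm (J x)) *\<^sub>R (B v - (sgn (J x) \<bullet> B v) *\<^sub>R sgn (J x)))) (at x within frontier K)"
      by (rule has_derivative_at_withinI)
    then have "(gauss_map K has_derivative (\<lambda>v. (1 / norm (J x)) *\<^sub>R (B v - (sgn (J x) \<bullet> B v) *\<^sub>R sgn (J x)))) (at x within frontier K)"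
      by (rule has_derivative_transform[OF xf, rotated]) (simp add: gauss_map_eq)
    then have "gauss_map K differentiable (at x within frontier K)" by (auto simp: differentiable_def)
    then show ?thesis unfolding W_def by (simp add: frechet_derivative_works)
  qed
  have Alin: "linear A" using has_derivative_linear[OF A] .
  have Wlin: "linear W" using has_derivative_linear[OF W] .
  have WA: "W (A v) = v - (u \<bullet> v) *\<^sub>R u" for v
  proof -
    \<comment> \<open>Since \<open>X\<close> takes values in the frontier, the chain rule uses the
      derivative of the Gauss map along it; whichever derivative \<open>frechet_derivative\<close>
      selects, its values on the tangent vectors \<open>A v\<close> are thereby determined.\<close>
    have "(gauss_map K \<circ> X has_derivative W \<circ> A) (at u within -{0})"
    proof (rule diff_chain_within)
      show "(X has_derivative A) (at u within -{0})" using A by (rule has_derivative_at_withinI)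
      show "(gauss_map K has_derivative W) (at (X u) within X ` (- {0}))"
        using W X_props(4) by (auto simp: x_def intro: has_derivative_subset)
    qed
    then have "(gauss_map K \<circ> X has_derivative W \<circ> A) (at u)"
      using u0 at_within_open[of u "-{0}"] by (auto simp: open_Compl)
    moreover have "(gauss_map K \<circ> X has_derivative (\<lambda>v. v - (u \<bullet> v) *\<^sub>R u)) (at u)"
    proof (rule has_derivative_transform_within_open)
      show "(sgn has_derivative (\<lambda>v. v - (u \<bullet> v) *\<^sub>R u)) (at u)"
        using has_derivative_sgn[OF u0] u su by simp
      show "open (-{0::real^'n})" by auto
      show "u \<in> -{0}" using u0 by simp
      show "sgn z = (gauss_map K \<circ> X) z" if "z \<in> -{0}" for z
        using gauss_map_eq[OF X_props(4)[of z]] sgn_J_X[of z] that by simp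
    qed
    ultimately have "W \<circ> A = (\<lambda>v. v - (u \<bullet> v) *\<^sub>R u)" by (rule has_derivative_unique)
    then show ?thesis by (metis comp_apply)
  qed
  have Au: "u \<bullet> A v = 0" for v
    using X_derivative_orthogonal[OF u0 A, of v] by (simp add: inner_commute)
  define E where "E = (\<lambda>v. W (v - (v \<bullet> u) *\<^sub>R u) + (v \<bullet> u) *\<^sub>R u)"
  have Elin: "linear E"
    using Wlin unfolding E_def
    by (intro linearI) (simp_all add: linear_add linear_scale linear_diff algebra_simps inner_add_left scaleR_add_left)
  have Mlin: "linear M"
    using Alin unfolding M_def
    by (intro linearI) (simp_all add: linear_add linear_scale algebra_simps inner_add_right scaleR_add_left)
  have EM: "E (M v) = v" for v
  proof -
    have "M v \<bullet> u = u \<bullet> v" using X_derivative_orthogonal[OF u0 A, of v] uu by (simp add: M_def inner_add_left)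
    then have "E (M v) = W (A v) + (u \<bullet> v) *\<^sub>R u" by (simp add: E_def M_def)
    then show ?thesis by (simp add: WA)
  qed
  have "det (matrix E) * det (matrix M) = det (matrix (\<lambda>v::real^'n. v))"
    using det_matrix_compose[OF Elin Mlin] EM by simp
  also have "\<dots> = 1" using matrix_id by (simp add: id_def)
  finally have dd: "det (matrix E) * det (matrix M) = 1" .
  have "gauss_curvature K x = det (matrix E)"
    by (simp add: gauss_curvature_def Let_def gx E_def W_def)
  then show "curvature_fun K u = det (matrix M)"
    using dd support_point_eq[OF u]
    by (metis curvature_fun_def nonzero_eq_divide_eq mult.commute mult_eq_0_iff x_def zero_neq_one)
  show "det (matrix M) > 0"
  proof (rule det_pos_if_monotone[OF Mlin])
    show "0 \<le> v \<bullet> M v" for v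
      using X_derivative_monotone[OF u0 A, of v] by (simp add: M_def inner_add_right inner_commute)
    show "det (matrix M) \<noteq> 0" using dd by auto
  qed
qed

lemma curvature_fun_pos:
  assumes "norm u = 1"
  shows "curvature_fun K u > 0"
proof -
  have "u \<noteq> 0" using assms by auto
  then obtain A where "(X has_derivative A) (at u)" using diff_X by blast
  then show ?thesis using curvature_fun_eq_det[OF assms] by simp
qed

definition radial_X :: "real^'n \<Rightarrow> real^'n" where "radial_X z = norm z *\<^sub>R X z"

text \<open>The derivative factors into \<open>Q\<close> after \<open>M\<close>: \<open>M\<close>
  has determinant \<open>curvature_fun\<close>, and \<open>Q\<close> is the rank-one change that
  tilts the normal \<open>u\<close> to \<open>X u\<close>, with determinant
  \<open>u \<bullet> X u = h u\<close>.\<close>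

lemma radial_X_jacobian:
  assumes z: "z \<noteq> 0"
  obtains D where "(radial_X has_derivative D) (at z)" "det (matrix D) = h (sgn z) * curvature_fun K (sgn z)"
proof -
  obtain A where A: "(X has_derivative A) (at z)" using diff_X[OF z] by blast
  define u where "u = sgn z"
  define r where "r = norm z"
  have u: "norm u = 1" "u \<noteq> 0" and r: "r > 0" and zu: "z = r *\<^sub>R u"
    using z by (auto simp: u_def r_def norm_sgn sgn_div_norm)
  have D: "(radial_X has_derivative (\<lambda>v. r *\<^sub>R A v + (u \<bullet> v) *\<^sub>R X z)) (at z)"
    using has_derivative_scaleR[OF has_derivative_norm[OF z] A]
    by (simp add: radial_X_def[abs_def] u_def r_def inner_commute)
  \<comment> \<open>Homogeneity of degree 0 moves the derivative from \<open>z\<close> to the unit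
    vector \<open>u\<close>, where the curvature formula is stated.\<close>
  have A': "(X has_derivative (\<lambda>v. A (r *\<^sub>R v))) (at u)"
  proof (rule has_derivative_transform_within_open)
    have "((\<lambda>w. r *\<^sub>R w) has_derivative (\<lambda>v. r *\<^sub>R v)) (at u)" by (auto intro!: derivative_eq_intros)
    then show "((\<lambda>w. X (r *\<^sub>R w)) has_derivative (\<lambda>v. A (r *\<^sub>R v))) (at u)"
      using has_derivative_compose[of "\<lambda>w. r *\<^sub>R w" "\<lambda>v. r *\<^sub>R v" u UNIV X A] A zu by simp
    show "open (-{0::real^'n})" by auto
    show "u \<in> -{0}" using u by simp
    show "X (r *\<^sub>R w) = X w" if "w \<in> -{0}" for w using X_scaleR[of w r] r that by simp
  qed
  define M where "M = (\<lambda>v. A (r *\<^sub>R v) + (u \<bullet> v) *\<^sub>R u)"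
  have Alin: "linear A" using has_derivative_linear[OF A] .
  have Mlin: "linear M" unfolding M_def
    by (intro linearI) (simp_all add: linear_add[OF Alin] linear_scale[OF Alin] algebra_simps inner_add_right scaleR_add_left)
  define Q where "Q = (\<lambda>v. v + (u \<bullet> v) *\<^sub>R (X u - u))"
  have Qlin: "linear Q" unfolding Q_def
    by (intro linearI) (simp_all add: algebra_simps inner_add_right scaleR_add_left)
  have uu: "u \<bullet> u = 1" using u by (simp add: dot_square_norm)
  have QM: "Q (M v) = r *\<^sub>R A v + (u \<bullet> v) *\<^sub>R X z" for v
  proof -
    have "u \<bullet> A (r *\<^sub>R v) = 0" using X_derivative_orthogonal[OF u(2) A', of v] by (simp add: inner_commute)
    then have "u \<bullet> M v = u \<bullet> v" using uu by (simp add: M_def inner_add_right)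
    moreover have "X z = X u" using X_sgn[OF z] by (simp add: u_def)
    ultimately show ?thesis
      by (simp add: Q_def) (simp add: M_def linear_scale[OF Alin] algebra_simps)
  qed
  have "det (matrix (\<lambda>v. r *\<^sub>R A v + (u \<bullet> v) *\<^sub>R X z)) = det (matrix Q) * det (matrix M)"
    using det_matrix_compose[OF Qlin Mlin] QM by simp
  also have "det (matrix Q) = 1 + u \<bullet> (X u - u)" unfolding Q_def by (rule det_rank_one)
  also have "\<dots> = h u" using X_props(1)[OF u(2)] uu by (simp add: inner_diff_right inner_commute)
  also have "det (matrix M) = curvature_fun K u"
    using curvature_fun_eq_det(1)[OF u(1) A'] by (simp add: M_def)
  finally show ?thesis using that[OF D] by (simp add: u_def)
qed

text \<open>The image determines \<open>z\<close>: its gauge is the length of \<open>z\<close>, and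
  \<open>J\<close> of it has the direction of \<open>z\<close>. Conversely
  \<open>k x *\<^sub>R sgn (J x)\<close> is the preimage of \<open>x\<close>.\<close>

lemma radial_X_image: "radial_X ` (cball 0 1 - {0}) = K - {0}"
  and inj_radial_X: "inj_on radial_X (cball 0 1 - {0})"
proof -
  have k: "k (radial_X z) = norm z" "sgn (J (radial_X z)) = sgn z" "radial_X z \<noteq> 0" if "z \<noteq> 0" for z
  proof -
    show "k (radial_X z) = norm z"
      using X_props(2)[OF that] gauge_scaleR[OF ob, of "norm z" "X z"] by (simp add: radial_X_def)
    show "radial_X z \<noteq> 0" using X_props(5)[OF that] that by (simp add: radial_X_def)
    have "dual_pair K (radial_X z) (norm z *\<^sub>R J (X z))"
      using J_props[of "X z"] X_props[OF that] gauge_scaleR[OF ob, of "norm z" "X z"] h_scaleR[of "norm z" "J (X z)"]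
      by (simp add: dual_pair_def radial_X_def)
    then have "J (radial_X z) = norm z *\<^sub>R J (X z)" by (simp add: J_iff)
    then show "sgn (J (radial_X z)) = sgn z" using sgn_J_X[OF that] that by (simp add: sgn_scaleR)
  qed
  show "inj_on radial_X (cball 0 1 - {0})"
  proof (rule inj_onI)
    fix z z' assume "z \<in> cball 0 1 - {0}" "z' \<in> cball 0 1 - {0}" "radial_X z = radial_X z'"
    then have "norm z = norm z'" "sgn z = sgn z'" using k(1,2)[of z] k(1,2)[of z'] by auto
    then show "z = z'" by (metis norm_sgn sgn_div_norm real_vector.scale_left_imp_eq scaleR_eq_0_iff sgn_zero_iff
        inverse_zero_imp_zero norm_eq_zero)
  qed
  show "radial_X ` (cball 0 1 - {0}) = K - {0}"
  proof
    show "radial_X ` (cball 0 1 - {0}) \<subseteq> K - {0}" using k by (auto simp: mem_iff_gauge_le[OF ob])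
    show "K - {0} \<subseteq> radial_X ` (cball 0 1 - {0})"
    proof
      fix x assume "x \<in> K - {0}"
      then have x: "x \<noteq> 0" "k x \<le> 1" by (auto simp: mem_iff_gauge_le[OF ob])
      define z where "z = k x *\<^sub>R sgn (J x)"
      have n: "norm z = k x" using kpos[OF x(1)] J_nonzero[OF x(1)] by (simp add: z_def norm_sgn)
      have z0: "z \<noteq> 0" using n kpos[OF x(1)] by auto
      have "X z = X (J x)"
        using X_scaleR[of "sgn (J x)" "k x"] X_sgn[of "J x"] J_nonzero[OF x(1)] kpos[OF x(1)] by (simp add: z_def sgn_zero_iff)
      then have "radial_X z = x" using n X_J[OF x(1)] kpos[OF x(1)] by (simp add: radial_X_def)
      then show "x \<in> radial_X ` (cball 0 1 - {0})" using n x z0 by (intro image_eqI[of _ _ z]) auto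
    qed
  qed
qed

end

section \<open>The Gauss map of a body of class C2+\<close>

context
  fixes K :: "(real^'n) set"
  assumes body: "convex_body K"
begin

lemma body_facts: "convex K" "compact K" "closed K" "interior K \<noteq> {}" "closure (interior K) = K"
proof -
  show 1: "convex K" "compact K" "closed K" "interior K \<noteq> {}"
    using body by (auto simp: convex_body_def compact_imp_closed)
  then show "closure (interior K) = K" using convex_closure_interior[of K] by (simp add: closure_closed)
qed

lemma frontier_subset_body: "frontier K \<subseteq> K"
  by (rule frontier_subset_closed[OF body_facts(3)])

lemma segment_to_interior:
  assumes "y \<in> K" "c \<in> interior K" "0 < t" "t \<le> (1::real)"
  shows "y + t *\<^sub>R (c - y) \<in> interior K"
proof -
  have "y - t *\<^sub>R (y - c) \<in> interior K"
    by (rule mem_interior_convex_shrink[OF body_facts(1)]) (use assms in auto)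
  then show ?thesis by (simp add: algebra_simps)
qed

text \<open>The gradient of a defining function, oriented outwards, spans the normal cone: a direction in which
  the defining function decreases but which leaves the body would give a zero of it too close to \<open>y\<close>.\<close>

lemma outer_normal_gradient:
  fixes g :: "real^'n \<Rightarrow> real" and G :: "real^'n"
  assumes y: "y \<in> frontier K" and r: "r > 0"
    and zero: "\<And>z. z \<in> ball y r \<Longrightarrow> z \<in> frontier K \<Longrightarrow> g z = 0"
    and neg: "\<And>z. z \<in> interior K \<inter> ball y r \<Longrightarrow> g z < 0"
    and der: "(g has_derivative (\<lambda>v. v \<bullet> G)) (at y)" and G: "G \<noteq> 0"
  shows "outer_unit_normal K y u \<longleftrightarrow> u = sgn G"
proof -
  have yK: "y \<in> K" using y frontier_subset_body by auto
  have gy: "g y = 0" by (rule zero) (use y r in auto)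
  have small: "\<exists>d>0. \<forall>v. norm v < d \<longrightarrow> \<bar>g (y + v) - v \<bullet> G\<bar> \<le> e * norm v" if "e > 0" for e
  proof -
    obtain d where d: "d > 0" "\<And>z. norm (z - y) < d \<Longrightarrow> norm (g z - g y - (z - y) \<bullet> G) \<le> e * norm (z - y)"
      using der[unfolded has_derivative_at_alt, THEN conjunct2, rule_format, OF \<open>e > 0\<close>] by metis
    show ?thesis
    proof (intro exI[of _ d] conjI allI impI)
      fix v :: "real^'n" assume "norm v < d"
      then show "\<bar>g (y + v) - v \<bullet> G\<bar> \<le> e * norm v" using d(2)[of "y + v"] by (simp add: gy)
    qed (rule d)
  qed
  have le_int: "(c - y) \<bullet> G \<le> 0" if c: "c \<in> interior K" for c
  proof (rule ccontr)
    assume "\<not> (c - y) \<bullet> G \<le> 0"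
    then have pos: "(c - y) \<bullet> G > 0" by simp
    then have n: "norm (c - y) > 0" by auto
    define e where "e = (c - y) \<bullet> G / (2 * norm (c - y))"
    have e: "e > 0" using pos n by (simp add: e_def)
    obtain d where d: "d > 0" "\<And>v. norm v < d \<Longrightarrow> \<bar>g (y + v) - v \<bullet> G\<bar> \<le> e * norm v" using small[OF e] by blast
    define t where "t = min 1 (min d r / (2 * norm (c - y)))"
    have t: "0 < t" "t \<le> 1" using d r n by (auto simp: t_def)
    have tn: "t * norm (c - y) < d" "t * norm (c - y) < r"
    proof -
      have "t * norm (c - y) \<le> min d r / (2 * norm (c - y)) * norm (c - y)"
        by (intro mult_right_mono) (auto simp: t_def)
      also have "\<dots> = min d r / 2" using n by simp
      finally show "t * norm (c - y) < d" "t * norm (c - y) < r" using d(1) r by auto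
    qed
    have "y + t *\<^sub>R (c - y) \<in> interior K" by (rule segment_to_interior[OF yK c t])
    moreover have "y + t *\<^sub>R (c - y) \<in> ball y r" using tn t by (simp add: dist_norm)
    ultimately have "g (y + t *\<^sub>R (c - y)) < 0" using neg by auto
    moreover have "\<bar>g (y + t *\<^sub>R (c - y)) - (t *\<^sub>R (c - y)) \<bullet> G\<bar> \<le> e * norm (t *\<^sub>R (c - y))"
      using d(2)[of "t *\<^sub>R (c - y)"] tn t by simp
    moreover have "e * norm (t *\<^sub>R (c - y)) = t * ((c - y) \<bullet> G) / 2"
      using n t by (simp add: e_def)
    moreover have "t * ((c - y) \<bullet> G) > 0" using t pos by simp
    ultimately show False by (simp add: abs_le_iff)
  qed
  have leG: "(c - y) \<bullet> G \<le> 0" if "c \<in> K" for c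
  proof -
    have "closed {c. (c - y) \<bullet> G \<le> 0}" by (intro closed_Collect_le continuous_intros)
    then have "closure (interior K) \<subseteq> {c. (c - y) \<bullet> G \<le> 0}" using le_int by (intro closure_minimal) auto
    then show ?thesis using that body_facts(5) by auto
  qed
  define N where "N = sgn G"
  have N: "norm N = 1" "G = norm G *\<^sub>R N" using G by (auto simp: N_def norm_sgn sgn_div_norm)
  have nG: "norm G > 0" using G by simp
  have leN: "(c - y) \<bullet> N \<le> 0" if "c \<in> K" for c
    using leG[OF that] nG by (simp add: N_def sgn_div_norm mult_le_0_iff)
  have onN: "outer_unit_normal K y N"
    using y N(1) leN by (auto simp: outer_unit_normal_def)
  have uniq: "u = N" if u: "outer_unit_normal K y u" for u
  proof (rule ccontr)
    assume ne: "u \<noteq> N"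
    have un: "norm u = 1" and ule: "\<And>c. c \<in> K \<Longrightarrow> (c - y) \<bullet> u \<le> 0" using u by (auto simp: outer_unit_normal_def)
    have "0 < (norm (u - N))\<^sup>2" using ne by simp
    also have "(norm (u - N))\<^sup>2 = 2 - 2 * (u \<bullet> N)"
    proof -
      have "u \<bullet> u = 1" "N \<bullet> N = 1" using un N(1) by (simp_all add: dot_square_norm)
      then show ?thesis
        unfolding power2_norm_eq_inner by (simp add: inner_diff_left inner_diff_right inner_commute[of N u])
    qed
    finally have uN: "u \<bullet> N < 1" by simp
    \<comment> \<open>A direction that leaves \<open>K\<close> according to the supposed second
      normal \<open>u\<close>, while \<open>g\<close> decreases along it.\<close>
    define w where "w = u - N"
    have wu: "w \<bullet> u > 0" and wN: "w \<bullet> N < 0"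
      using uN un N(1) by (simp_all add: w_def inner_diff_left dot_square_norm inner_commute[of N u])
    obtain c where c: "c \<in> interior K" using body_facts(4) by blast
    obtain \<epsilon> where \<epsilon>: "\<epsilon> > 0" "cball c \<epsilon> \<subseteq> K" using c by (auto simp: mem_interior_cball)
    define w0 where "w0 = c - y"
    have w0N: "w0 \<bullet> N < 0"
    proof -
      have "c + \<epsilon> *\<^sub>R N \<in> K" using \<epsilon> N(1) by (intro subsetD[OF \<epsilon>(2)]) (auto simp: dist_norm)
      from leN[OF this] have "w0 \<bullet> N + \<epsilon> * (N \<bullet> N) \<le> 0" by (simp add: w0_def inner_add_left inner_diff_left)
      then show ?thesis using \<epsilon> N(1) by (simp add: dot_square_norm)
    qed
    \<comment> \<open>\<open>\<delta>\<close> and \<open>R\<close> bound the slope and the length on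
      the whole segment from \<open>w\<close> to the inward direction \<open>w0\<close>, so that one
      step size \<open>t\<close> serves all of its points.\<close>
    define \<delta> where "\<delta> = min (- (w \<bullet> N)) (- (w0 \<bullet> N)) * norm G"
    define R where "R = norm w + norm w0"
    have \<delta>: "\<delta> > 0" using wN w0N nG by (auto simp: \<delta>_def)
    have "w \<noteq> 0" using wN by auto
    then have R: "R > 0" unfolding R_def by (intro add_pos_nonneg) auto
    have seg: "(((1 - s) *\<^sub>R w + s *\<^sub>R w0) \<bullet> G \<le> - \<delta>) \<and> norm ((1 - s) *\<^sub>R w + s *\<^sub>R w0) \<le> R"
      if s: "0 \<le> s" "s \<le> 1" for s
    proof
      define m where "m = min (- (w \<bullet> N)) (- (w0 \<bullet> N))"
      have m: "w \<bullet> N \<le> - m" "w0 \<bullet> N \<le> - m" unfolding m_def by linarith+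
      have "(1 - s) * (w \<bullet> N) + s * (w0 \<bullet> N) \<le> (1 - s) * (- m) + s * (- m)"
        using s by (intro add_mono mult_left_mono m) auto
      also have "\<dots> = - m" by (simp add: algebra_simps)
      finally have le: "((1 - s) *\<^sub>R w + s *\<^sub>R w0) \<bullet> N \<le> - m" by (simp add: inner_add_left)
      have "((1 - s) *\<^sub>R w + s *\<^sub>R w0) \<bullet> G = norm G * (((1 - s) *\<^sub>R w + s *\<^sub>R w0) \<bullet> N)"
        by (subst N(2)) (simp only: inner_scaleR_right)
      also have "\<dots> \<le> norm G * (- m)" by (rule mult_left_mono[OF le]) simp
      finally show "((1 - s) *\<^sub>R w + s *\<^sub>R w0) \<bullet> G \<le> - \<delta>" by (simp add: \<delta>_def m_def mult.commute)
      have "norm ((1 - s) *\<^sub>R w + s *\<^sub>R w0) \<le> norm ((1 - s) *\<^sub>R w) + norm (s *\<^sub>R w0)" by (rule norm_triangle_ineq)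
      also have "\<dots> \<le> 1 * norm w + 1 * norm w0" unfolding norm_scaleR using s by (intro add_mono mult_right_mono) auto
      finally show "norm ((1 - s) *\<^sub>R w + s *\<^sub>R w0) \<le> R" by (simp add: R_def)
    qed
    define e where "e = \<delta> / (2 * R)"
    have e: "e > 0" using \<delta> R by (simp add: e_def)
    obtain d where d: "d > 0" "\<And>v. norm v < d \<Longrightarrow> \<bar>g (y + v) - v \<bullet> G\<bar> \<le> e * norm v" using small[OF e] by blast
    define t where "t = min 1 (min d r / (2 * R))"
    have t: "0 < t" "t \<le> 1" using d r R by (auto simp: t_def)
    have tR: "t * R < d" "t * R < r"
    proof -
      have "t * R \<le> min d r / (2 * R) * R" using R by (intro mult_right_mono) (auto simp: t_def)
      also have "\<dots> = min d r / 2" using R by simp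
      finally show "t * R < d" "t * R < r" using d(1) r by auto
    qed
    have out: "y + t *\<^sub>R w \<notin> K" using ule[of "y + t *\<^sub>R w"] t wu by (auto simp: mult_le_0_iff)
    have inn: "y + t *\<^sub>R w0 \<in> K"
      using segment_to_interior[OF yK c t] interior_subset by (auto simp: w0_def)
    \<comment> \<open>The segment joins a point outside \<open>K\<close> to one inside and so meets
      the frontier, where \<open>g\<close> is 0. But the expansion with error \<open>e\<close> gives
      \<open>g \<le> - (t * \<delta> / 2)\<close> all along it.\<close>
    have "closed_segment (y + t *\<^sub>R w) (y + t *\<^sub>R w0) \<inter> frontier K \<noteq> {}"
    proof (rule connected_Int_frontier)
      show "closed_segment (y + t *\<^sub>R w) (y + t *\<^sub>R w0) \<inter> K \<noteq> {}" using inn by auto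
      show "closed_segment (y + t *\<^sub>R w) (y + t *\<^sub>R w0) - K \<noteq> {}" using out by auto
    qed simp
    then obtain q where q: "q \<in> frontier K" "q \<in> closed_segment (y + t *\<^sub>R w) (y + t *\<^sub>R w0)" by auto
    then obtain s where s: "0 \<le> s" "s \<le> 1" "q = (1 - s) *\<^sub>R (y + t *\<^sub>R w) + s *\<^sub>R (y + t *\<^sub>R w0)"
      by (auto simp: in_segment)
    define ws where "ws = (1 - s) *\<^sub>R w + s *\<^sub>R w0"
    have qeq: "q = y + t *\<^sub>R ws" unfolding s(3) ws_def by (simp add: algebra_simps)
    have ws: "ws \<bullet> G \<le> - \<delta>" "norm ws \<le> R" using seg[OF s(1,2)] by (auto simp: ws_def)
    have nt: "norm (t *\<^sub>R ws) \<le> t * R" using ws t by (simp add: mult_left_mono)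
    then have "q \<in> ball y r" using tR qeq by (simp add: dist_norm)
    then have "g q = 0" using zero q(1) by blast
    moreover have "\<bar>g q - (t *\<^sub>R ws) \<bullet> G\<bar> \<le> e * norm (t *\<^sub>R ws)"
      using d(2)[of "t *\<^sub>R ws"] nt tR by (simp add: qeq)
    moreover have "e * norm (t *\<^sub>R ws) \<le> e * (t * R)" using nt e by (intro mult_left_mono) auto
    moreover have "e * (t * R) = t * \<delta> / 2" using R by (simp add: e_def)
    moreover have "(t *\<^sub>R ws) \<bullet> G \<le> - (t * \<delta>)" using mult_left_mono[OF ws(1), of t] t by simp
    moreover have "t * \<delta> > 0" using t \<delta> by simp
    ultimately show False by (simp add: abs_le_iff)
  qed
  show ?thesis using onN uniq unfolding N_def by blast
qed

text \<open>A defining function has no zero in the connected set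
  \<open>interior K \<inter> ball x r\<close>, so it has one sign there. Oriented by
  \<open>\<sigma>\<close>, its normalised gradient is the outer normal near \<open>x\<close>, and
  that is differentiable.\<close>

lemma gauss_map_smooth:
  assumes C2: "C2_hypersurface (frontier K)" and x: "x \<in> frontier K"
  shows "outer_unit_normal K x u \<longleftrightarrow> u = gauss_map K x"
    and "gauss_map K differentiable (at x within frontier K)"
proof -
  from C2[unfolded C2_hypersurface_def, rule_format, OF x]
  obtain U g G and H :: "real^'n \<Rightarrow> (real^'n) \<Rightarrow>\<^sub>L (real^'n)" where *: "open U \<and> x \<in> U \<and> frontier K \<inter> U = {y \<in> U. g y = 0} \<and>
        (\<forall>y\<in>U. GDERIV g y :> G y \<and> G y \<noteq> 0 \<and> (G has_derivative blinfun_apply (H y)) (at y)) \<and>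
        continuous_on U H" by (elim exE)
  then have U: "open U" "x \<in> U" and zero: "frontier K \<inter> U = {y \<in> U. g y = 0}"
    and der: "\<And>y. y \<in> U \<Longrightarrow> GDERIV g y :> G y" "\<And>y. y \<in> U \<Longrightarrow> G y \<noteq> 0"
      "\<And>y. y \<in> U \<Longrightarrow> (G has_derivative blinfun_apply (H y)) (at y)"
    by simp_all
  have zero': "z \<in> frontier K \<longleftrightarrow> g z = 0" if "z \<in> U" for z
    using zero that by blast
  obtain r where r: "r > 0" "ball x r \<subseteq> U" using U by (auto simp: open_contains_ball)
  let ?I = "interior K \<inter> ball x r"
  have gcont: "continuous_on U g"
    using der(1) by (intro continuous_at_imp_continuous_on ballI) (auto simp: gderiv_def intro: has_derivative_continuous)
  have nz: "g z \<noteq> 0" if "z \<in> ?I" for z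
    using that zero'[of z] r by (auto simp: frontier_def)
  have "connected (g ` ?I)"
    by (intro connected_continuous_image convex_connected convex_Int convex_interior body_facts convex_ball)
       (use continuous_on_subset[OF gcont] r in blast)
  then have "is_interval (g ` ?I)" by (simp add: is_interval_connected_1)
  then have sgn: "(\<forall>z\<in>?I. g z < 0) \<or> (\<forall>z\<in>?I. g z > 0)"
    using nz unfolding is_interval_1 by (smt (verit, ccfv_threshold) imageE image_eqI)
  define \<sigma> :: real where "\<sigma> = (if \<forall>z\<in>?I. g z < 0 then 1 else -1)"
  have \<sigma>: "\<sigma> \<noteq> 0" "\<And>z. z \<in> ?I \<Longrightarrow> \<sigma> * g z < 0" using sgn by (auto simp: \<sigma>_def)
  have normal: "outer_unit_normal K y u \<longleftrightarrow> u = sgn (\<sigma> *\<^sub>R G y)" if y: "y \<in> frontier K" "y \<in> ball x r" for y u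
  proof -
    obtain r' where r': "r' > 0" "ball y r' \<subseteq> ball x r" using openE[OF open_ball y(2)] by blast
    show ?thesis
    proof (rule outer_normal_gradient[OF y(1) r'(1)])
      show "\<sigma> * g z = 0" if "z \<in> ball y r'" "z \<in> frontier K" for z
      proof -
        have "z \<in> U" using that r r' by blast
        then show ?thesis using that zero' by simp
      qed
      show "\<sigma> * g z < 0" if "z \<in> interior K \<inter> ball y r'" for z using that r' \<sigma> by auto
      have "y \<in> U" using y r by auto
      then have "(g has_derivative (\<lambda>v. v \<bullet> G y)) (at y)" using der(1) by (simp add: gderiv_def)
      from has_derivative_mult_right[OF this, of \<sigma>]
      show "((\<lambda>z. \<sigma> * g z) has_derivative (\<lambda>v. v \<bullet> (\<sigma> *\<^sub>R G y))) (at y)" by simp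
      show "\<sigma> *\<^sub>R G y \<noteq> 0" using der(2) \<open>y \<in> U\<close> \<sigma> by simp
    qed
  qed
  have gm: "gauss_map K y = sgn (\<sigma> *\<^sub>R G y)" if "y \<in> frontier K" "y \<in> ball x r" for y
    unfolding gauss_map_def by (rule the_equality) (use normal[OF that] in blast)+
  show "outer_unit_normal K x u \<longleftrightarrow> u = gauss_map K x" using normal[OF x] gm[OF x] r by simp
  have "((\<lambda>y. \<sigma> *\<^sub>R G y) has_derivative (\<lambda>v. \<sigma> *\<^sub>R blinfun_apply (H x) v)) (at x)"
    by (rule has_derivative_scaleR_right[OF der(3)[OF U(2)]])
  from has_derivative_compose[OF this has_derivative_sgn] der(2)[OF U(2)] \<sigma>
  obtain D where "((\<lambda>y. sgn (\<sigma> *\<^sub>R G y)) has_derivative D) (at x)" by auto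
  then have "((\<lambda>y. sgn (\<sigma> *\<^sub>R G y)) has_derivative D) (at x within frontier K)" by (rule has_derivative_at_withinI)
  then have "(gauss_map K has_derivative D) (at x within frontier K)"
    by (rule has_derivative_transform_within[OF _ r(1) x]) (use gm in \<open>auto simp: dist_commute\<close>)
  then show "gauss_map K differentiable (at x within frontier K)" by (auto simp: differentiable_def)
qed

end

section \<open>Volumes of a body and of its polar as integrals over directions\<close>

lemma lmeasurable_minus_point:
  fixes K :: "'a::euclidean_space set"
  assumes "compact K"
  shows "K - {a} \<in> lmeasurable" "measure lebesgue (K - {a}) = measure lborel K"
proof -
  have K: "K \<in> lmeasurable" by (rule lmeasurable_compact[OF assms])
  show "K - {a} \<in> lmeasurable" using K lmeasurable_compact[of "{a}"] by (intro fmeasurable.Diff) auto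
  have "measure lebesgue (K - {a}) = measure lebesgue K"
    using K by (intro measure_negligible_symdiff) (auto intro: negligible_subset[OF negligible_sing[of a]])
  also have "\<dots> = measure lborel K" using assms by (simp add: borel_compact)
  finally show "measure lebesgue (K - {a}) = measure lborel K" .
qed

text \<open>The origin is removed because the radial maps need not be differentiable there.\<close>

abbreviation punctured_ball :: "(real^'n) set" where "punctured_ball \<equiv> cball 0 1 - {0}"

lemma punctured_ball_sets: "punctured_ball \<in> sets lebesgue" "punctured_ball \<in> sets borel"
  by (auto simp: borel_closed)

context regular_body
begin

text \<open>Change of variables along \<open>radial_X\<close>. The integrand depends on the
  direction only, so the integral over the ball is the spherical one divided by the
  dimension.\<close>

lemma integral_support_curvature:
  shows "set_integrable lebesgue punctured_ball (\<lambda>z. h (sgn z) * curvature_fun K (sgn z))"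
    and "(LINT z:punctured_ball|lebesgue. h (sgn z) * curvature_fun K (sgn z)) = measure lborel K"
proof -
  have "\<forall>z. \<exists>D. z \<noteq> 0 \<longrightarrow> (radial_X has_derivative D) (at z) \<and> det (matrix D) = h (sgn z) * curvature_fun K (sgn z)"
    using radial_X_jacobian by metis
  then obtain D where D: "\<And>z. z \<noteq> 0 \<Longrightarrow> (radial_X has_derivative D z) (at z)"
    "\<And>z. z \<noteq> 0 \<Longrightarrow> det (matrix (D z)) = h (sgn z) * curvature_fun K (sgn z)"
    by metis
  have abs: "\<bar>det (matrix (D z))\<bar> = h (sgn z) * curvature_fun K (sgn z)" if "z \<in> punctured_ball" for z
    using D(2)[of z] that hpos[of "sgn z"] curvature_fun_pos[of "sgn z"] by (simp add: norm_sgn sgn_zero_iff)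
  note lm = lmeasurable_minus_point[OF origin_bodyD(2)[OF ob], of 0]
  have cov: "set_integrable lebesgue punctured_ball (\<lambda>x. \<bar>det (matrix (D x))\<bar>)"
    "(LINT x:punctured_ball|lebesgue. \<bar>det (matrix (D x))\<bar>) = measure lebesgue (radial_X ` punctured_ball)"
    using integral_abs_det_eq_measure_image[of punctured_ball radial_X D, OF punctured_ball_sets(1) _ inj_radial_X] D(1) lm(1)
    by (auto simp: radial_X_image intro: has_derivative_at_withinI)
  show "set_integrable lebesgue punctured_ball (\<lambda>z. h (sgn z) * curvature_fun K (sgn z))"
    by (rule iffD1[OF set_integrable_cong[OF refl refl abs] cov(1)])
  have "(LINT z:punctured_ball|lebesgue. h (sgn z) * curvature_fun K (sgn z)) = (LINT x:punctured_ball|lebesgue. \<bar>det (matrix (D x))\<bar>)"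
    using abs by (intro set_lebesgue_integral_cong) (auto simp: punctured_ball_sets)
  then show "(LINT z:punctured_ball|lebesgue. h (sgn z) * curvature_fun K (sgn z)) = measure lborel K"
    using cov(2) lm(2) by (simp add: radial_X_image)
qed

text \<open>The factor \<open>norm z / h z\<close> is homogeneous of degree 0, so its derivative
  annihilates \<open>z\<close>; the rank-one term \<open>q' v *\<^sub>R z\<close> then leaves the
  determinant of the pure scaling unchanged.\<close>

lemma radial_scaling_jacobian:
  assumes z: "z \<noteq> 0"
  obtains D where "((\<lambda>z. (norm z / h z) *\<^sub>R z) has_derivative D) (at z)" "det (matrix D) = (1 / h (sgn z)) ^ CARD('n)"
proof -
  note False = z
  define q where "q z = norm z / h z" for z
  define \<Psi> where "\<Psi> z = q z *\<^sub>R z" for z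
  have qpos: "q z > 0" if "z \<noteq> 0" for z using hpos[OF that] that by (simp add: q_def)
  obtain E where E: "(h has_derivative E) (at z)" using diff_h[OF False] by (auto simp: differentiable_def)
  have hz: "h z \<noteq> 0" using hpos[OF False] by simp
  from has_derivative_divide[OF has_derivative_norm[OF False] E hz]
  obtain q' where q': "(q has_derivative q') (at z)" unfolding q_def[abs_def] by blast
  have lin: "linear q'" by (rule has_derivative_linear[OF q'])
  have q'z: "q' z = 0"
    by (rule homogeneous_derivative_radial[OF q']) (use hz in \<open>auto simp: q_def h_scaleR\<close>)
  define b where "b = (1 / q z) *\<^sub>R adjoint q' 1"
  have b: "b \<bullet> v = q' v / q z" for v
    using adjoint_works[OF lin, of v 1] by (simp add: b_def inner_commute)
  have q0: "q z \<noteq> 0" using qpos[OF False] by simp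
  have D: "(\<Psi> has_derivative (\<lambda>v. q z *\<^sub>R v + q' v *\<^sub>R z)) (at z)"
    unfolding \<Psi>_def[abs_def] by (rule has_derivative_scaleR[OF q' has_derivative_ident])
  have "(\<lambda>v. q z *\<^sub>R v + q' v *\<^sub>R z) = (\<lambda>v. q z *\<^sub>R (v + (b \<bullet> v) *\<^sub>R z))"
    using q0 by (auto simp: b scaleR_add_right)
  then have "det (matrix (\<lambda>v. q z *\<^sub>R v + q' v *\<^sub>R z)) = det (matrix (\<lambda>v :: real^'n. q z *\<^sub>R v)) * det (matrix (\<lambda>v. v + (b \<bullet> v) *\<^sub>R z))"
    using det_matrix_compose[of "\<lambda>v. q z *\<^sub>R v" "\<lambda>v. v + (b \<bullet> v) *\<^sub>R z"]
    by (simp add: linear_iff inner_add_right scaleR_add_left scaleR_add_right)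
  also have "\<dots> = q z ^ CARD('n) * (1 + b \<bullet> z)" by (simp add: det_matrix_scaleR det_rank_one)
  also have "\<dots> = q z ^ CARD('n)" by (simp add: b q'z)
  finally have det: "det (matrix (\<lambda>v. q z *\<^sub>R v + q' v *\<^sub>R z)) = q z ^ CARD('n)" .
  have qz: "q z = 1 / h (sgn z)" using z hpos[OF z] by (simp add: q_def h_sgn)
  have "(\<lambda>z. (norm z / h z) *\<^sub>R z) = \<Psi>" by (simp add: \<Psi>_def fun_eq_iff q_def)
  then show ?thesis using that[of "\<lambda>v. q z *\<^sub>R v + q' v *\<^sub>R z"] D det by (simp only: qz)
qed

lemma integral_support_power:
  shows "set_integrable lebesgue punctured_ball (\<lambda>z. (1 / h (sgn z)) ^ CARD('n))"
    and "(LINT z:punctured_ball|lebesgue. (1 / h (sgn z)) ^ CARD('n)) = measure lborel (polar_body K)"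
proof -
  define q where "q z = norm z / h z" for z
  define \<Psi> where "\<Psi> z = q z *\<^sub>R z" for z
  have qpos: "q z > 0" if "z \<noteq> 0" for z using hpos[OF that] that by (simp add: q_def)
  have q_sgn: "q z = 1 / h (sgn z)" if "z \<noteq> 0" for z using that hpos[OF that] by (simp add: q_def h_sgn)
  have "\<forall>z. \<exists>D. z \<noteq> 0 \<longrightarrow> (\<Psi> has_derivative D) (at z) \<and> det (matrix D) = q z ^ CARD('n)"
  proof
    fix z :: "real^'n"
    show "\<exists>D. z \<noteq> 0 \<longrightarrow> (\<Psi> has_derivative D) (at z) \<and> det (matrix D) = q z ^ CARD('n)"
    proof (cases "z = 0")
      case False
      obtain D where "((\<lambda>z. (norm z / h z) *\<^sub>R z) has_derivative D) (at z)" "det (matrix D) = (1 / h (sgn z)) ^ CARD('n)"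
        using radial_scaling_jacobian[OF False] .
      moreover have "(\<lambda>z. (norm z / h z) *\<^sub>R z) = \<Psi>" by (simp add: \<Psi>_def fun_eq_iff q_def)
      ultimately show ?thesis using q_sgn[OF False] by auto
    qed simp
  qed
  then obtain D where D: "\<And>z. z \<noteq> 0 \<Longrightarrow> (\<Psi> has_derivative D z) (at z)"
    "\<And>z. z \<noteq> 0 \<Longrightarrow> det (matrix (D z)) = q z ^ CARD('n)"
    by metis
  have abs: "\<bar>det (matrix (D z))\<bar> = (1 / h (sgn z)) ^ CARD('n)" if "z \<in> punctured_ball" for z
    using D(2)[of z] q_sgn[of z] qpos[of z] that by simp
  \<comment> \<open>The value of \<open>h\<close> identifies the image with the polar body; together
    with the preserved direction it gives injectivity.\<close>
  have h\<Psi>: "h (\<Psi> z) = norm z" "sgn (\<Psi> z) = sgn z" "\<Psi> z \<noteq> 0" if "z \<noteq> 0" for z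
    using qpos[OF that] hpos[OF that] that by (auto simp: \<Psi>_def h_scaleR sgn_scaleR) (simp add: q_def)
  have inj: "inj_on \<Psi> punctured_ball"
  proof (rule inj_onI)
    fix z z' assume zz: "z \<in> punctured_ball" "z' \<in> punctured_ball" "\<Psi> z = \<Psi> z'"
    then have "norm z = norm z'" "sgn z = sgn z'" using h\<Psi>(1,2)[of z] h\<Psi>(1,2)[of z'] by auto
    then have "norm z *\<^sub>R sgn z = norm z' *\<^sub>R sgn z'" by simp
    then show "z = z'" using zz by (simp add: sgn_div_norm)
  qed
  have img: "\<Psi> ` punctured_ball = polar_body K - {0}"
  proof
    show "\<Psi> ` punctured_ball \<subseteq> polar_body K - {0}"
      using h\<Psi> by (auto simp: mem_polar_body_iff[OF origin_bodyD(2,6)[OF ob]])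
    show "polar_body K - {0} \<subseteq> \<Psi> ` punctured_ball"
    proof
      fix y assume "y \<in> polar_body K - {0}"
      then have y: "y \<noteq> 0" "h y \<le> 1" by (auto simp: mem_polar_body_iff[OF origin_bodyD(2,6)[OF ob]])
      define z where "z = (h y / norm y) *\<^sub>R y"
      have n: "norm z = h y" using y hpos[OF y(1)] by (simp add: z_def)
      have z0: "z \<noteq> 0" using n hpos[OF y(1)] by auto
      have "h z = h y / norm y * h y" using hpos[OF y(1)] by (simp add: z_def h_scaleR)
      then have "q z = norm y / h y" using n hpos[OF y(1)] y by (simp add: q_def)
      then have "\<Psi> z = y" using hpos[OF y(1)] y by (simp add: \<Psi>_def z_def)
      then show "y \<in> \<Psi> ` punctured_ball" using n y z0 by (intro image_eqI[of _ _ z]) auto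
    qed
  qed
  note lm = lmeasurable_minus_point[OF origin_bodyD(2)[OF origin_body_polar[OF ob]], of 0]
  have cov: "set_integrable lebesgue punctured_ball (\<lambda>x. \<bar>det (matrix (D x))\<bar>)"
    "(LINT x:punctured_ball|lebesgue. \<bar>det (matrix (D x))\<bar>) = measure lebesgue (\<Psi> ` punctured_ball)"
    using integral_abs_det_eq_measure_image[of punctured_ball \<Psi> D, OF punctured_ball_sets(1) _ inj] D(1) lm(1)
    by (auto simp: img intro: has_derivative_at_withinI)
  show "set_integrable lebesgue punctured_ball (\<lambda>z. (1 / h (sgn z)) ^ CARD('n))"
    by (rule iffD1[OF set_integrable_cong[OF refl refl abs] cov(1)])
  have "(LINT z:punctured_ball|lebesgue. (1 / h (sgn z)) ^ CARD('n)) = (LINT x:punctured_ball|lebesgue. \<bar>det (matrix (D x))\<bar>)"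
    using abs by (intro set_lebesgue_integral_cong) (auto simp: punctured_ball_sets)
  then show "(LINT z:punctured_ball|lebesgue. (1 / h (sgn z)) ^ CARD('n)) = measure lborel (polar_body K)"
    using cov(2) lm(2) by (simp add: img)
qed

end

section \<open>Smooth duality for bodies of class C2+\<close>

text \<open>\<open>k\<close> is a maximum of linear functions. Comparing the maximisers at
  \<open>z\<close> and \<open>z'\<close> encloses the error of the linear approximation between 0
  and \<open>(z' - z) \<bullet> (Y z' - Y z)\<close>, so mere continuity of \<open>Y\<close> makes
  \<open>k\<close> differentiable.\<close>

lemma has_derivative_support_sandwich:
  fixes k :: "'a::euclidean_space \<Rightarrow> real" and Y :: "'a \<Rightarrow> 'a"
  assumes attained: "\<And>z'. z' \<in> S \<Longrightarrow> k z' = z' \<bullet> Y z'" and upper: "\<And>z1 z2. z1 \<in> S \<Longrightarrow> z2 \<in> S \<Longrightarrow> z1 \<bullet> Y z2 \<le> k z1"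
    and S: "open S" "z \<in> S" and cont: "continuous (at z) Y"
  shows "(k has_derivative (\<lambda>v. v \<bullet> Y z)) (at z)"
  unfolding has_derivative_at_alt
proof (intro conjI allI impI)
  show "bounded_linear (\<lambda>v. v \<bullet> Y z)" by (rule bounded_linear_inner_left)
  fix e :: real assume e: "e > 0"
  obtain d1 where d1: "d1 > 0" "\<And>z'. dist z' z < d1 \<Longrightarrow> dist (Y z') (Y z) < e"
    using cont e unfolding continuous_at_eps_delta by blast
  obtain d2 where d2: "d2 > 0" "ball z d2 \<subseteq> S" using S by (auto simp: open_contains_ball)
  show "\<exists>d>0. \<forall>z'. norm (z' - z) < d \<longrightarrow> norm (k z' - k z - (z' - z) \<bullet> Y z) \<le> e * norm (z' - z)"
  proof (intro exI[of _ "min d1 d2"] conjI allI impI)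
    fix z' assume z': "norm (z' - z) < min d1 d2"
    then have S': "z' \<in> S" using d2 by (auto simp: dist_norm norm_minus_commute)
    have lower: "0 \<le> k z' - k z - (z' - z) \<bullet> Y z"
      using upper[OF S' S(2)] attained[OF S(2)] by (simp add: inner_diff_left)
    have "k z' - k z - (z' - z) \<bullet> Y z = z' \<bullet> Y z' - z' \<bullet> Y z"
      using attained[OF S'] attained[OF S(2)] by (simp add: inner_diff_left)
    also have "\<dots> \<le> z' \<bullet> Y z' - z' \<bullet> Y z - (z \<bullet> Y z' - z \<bullet> Y z)"
      using upper[OF S(2) S'] attained[OF S(2)] by simp
    also have "\<dots> = (z' - z) \<bullet> (Y z' - Y z)" by (simp add: inner_diff_left inner_diff_right)
    also have "\<dots> \<le> norm (z' - z) * norm (Y z' - Y z)" by (rule norm_cauchy_schwarz)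
    also have "\<dots> \<le> norm (z' - z) * e"
      using d1(2)[of z'] z' by (intro mult_left_mono) (auto simp: dist_norm)
    finally show "norm (k z' - k z - (z' - z) \<bullet> Y z) \<le> e * norm (z' - z)" using lower by (simp add: mult.commute)
  qed (use d1 d2 in auto)
qed

text \<open>\<open>J\<close> is built from the Gauss map, and its differentiability is reached in
  stages: continuity of the normals makes the gauge differentiable, hence the radial projection to
  the frontier, hence the normal as a function of \<open>z\<close>, hence \<open>J\<close>. Positive
  curvature makes the derivative of \<open>J\<close> injective, which yields both the uniqueness of
  \<open>z\<close> for given \<open>w\<close> and the differentiability of the inverse
  \<open>Js\<close>.\<close>

lemma C2_plus_regular_body:
  fixes K :: "(real^'n) set"
  assumes C2: "C2_plus K" and int0: "0 \<in> interior K"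
  shows "\<exists>J Js. regular_body K J Js"
proof -
  have body: "convex_body K" and hyp: "C2_hypersurface (frontier K)"
    and curv: "\<And>x. x \<in> frontier K \<Longrightarrow> gauss_curvature K x > 0"
    using C2 by (auto simp: C2_plus_def)
  have ob: "origin_body K" using body int0 by (auto simp: origin_body_def convex_body_def)
  note compactK = origin_bodyD(2)[OF ob]
  define h where "h = support_fun K"
  define k where "k = gauge_fun K"
  define \<nu> where "\<nu> = gauss_map K"
  note normal = gauss_map_smooth(1)[OF body hyp, folded \<nu>_def]
  note smooth = gauss_map_smooth(2)[OF body hyp, folded \<nu>_def]
  have hpos: "h w > 0" if "w \<noteq> 0" for w using support_fun_pos[OF ob that] by (simp add: h_def)
  have kpos: "k z > 0" if "z \<noteq> 0" for z using gauge_pos[OF ob that] by (simp add: k_def)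
  have h0: "h w = 0 \<longleftrightarrow> w = 0" for w using support_fun_eq_0_iff[OF ob] by (simp add: h_def)
  have k0: "k z = 0 \<longleftrightarrow> z = 0" for z using gauge_eq_0_iff[OF ob] by (simp add: k_def)
  have hs: "h (c *\<^sub>R w) = c * h w" if "0 \<le> c" for c w
    using support_fun_scaleR[OF compactK origin_bodyD(6)[OF ob] that] by (simp add: h_def)
  have ks: "k (c *\<^sub>R z) = c * k z" if "0 \<le> c" for c z
    using gauge_scaleR[OF ob that] by (simp add: k_def)
  have fr: "x \<in> frontier K \<longleftrightarrow> k x = 1" for x by (simp add: mem_frontier_iff_gauge_eq[OF ob] k_def)
  have memK: "x \<in> K \<longleftrightarrow> k x \<le> 1" for x by (simp add: mem_iff_gauge_le[OF ob] k_def)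
  have inner_le: "z \<bullet> w \<le> k z * h w" for z w using inner_le_gauge_support[OF ob] by (simp add: k_def h_def)
  have normal_iff: "outer_unit_normal K x u \<longleftrightarrow> k x = 1 \<and> norm u = 1 \<and> x \<bullet> u = h u" for x u
  proof
    assume *: "outer_unit_normal K x u"
    then have kx: "k x = 1" by (simp add: outer_unit_normal_def fr)
    have "h u = x \<bullet> u" unfolding h_def
      using * kx by (intro support_fun_eqI) (auto simp: outer_unit_normal_def inner_diff_left memK)
    then show "k x = 1 \<and> norm u = 1 \<and> x \<bullet> u = h u" using * kx by (auto simp: outer_unit_normal_def)
  next
    assume "k x = 1 \<and> norm u = 1 \<and> x \<bullet> u = h u"
    then show "outer_unit_normal K x u"
      using support_fun_upper[OF compactK, of _ u] by (auto simp: outer_unit_normal_def fr h_def inner_diff_left)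
  qed
  have \<nu>: "norm (\<nu> x) = 1" "x \<bullet> \<nu> x = h (\<nu> x)" "h (\<nu> x) > 0" if "k x = 1" for x
  proof -
    have "outer_unit_normal K x (\<nu> x)" using normal[of x "\<nu> x"] that by (simp add: fr)
    then show "norm (\<nu> x) = 1" "x \<bullet> \<nu> x = h (\<nu> x)" by (auto simp: normal_iff)
    then show "h (\<nu> x) > 0" by (intro hpos) auto
  qed
  define p where "p z = (1 / k z) *\<^sub>R z" for z
  \<comment> \<open>The normal at the radial projection \<open>p z\<close>, scaled to
    \<open>h (Y z) = 1\<close>: a boundary point of the polar body, and the gradient of the gauge at
    \<open>z\<close>.\<close>
  define Y where "Y z = (1 / (p z \<bullet> \<nu> (p z))) *\<^sub>R \<nu> (p z)" for z
  define J where "J z = k z *\<^sub>R Y z" for z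
  have kp: "k (p z) = 1" if "z \<noteq> 0" for z using kpos[OF that] by (simp add: p_def ks)
  have psub: "p ` (-{0}) \<subseteq> frontier K"
  proof
    fix x assume "x \<in> p ` (-{0})"
    then obtain z where "z \<noteq> 0" "x = p z" by blast
    then show "x \<in> frontier K" using kp by (simp add: fr)
  qed
  have zp: "z = k z *\<^sub>R p z" for z using k0[of z] by (simp add: p_def)
  have hY: "h (Y z) = 1" "p z \<bullet> Y z = 1" "Y z \<noteq> 0" if "z \<noteq> 0" for z
  proof -
    show "h (Y z) = 1" "p z \<bullet> Y z = 1" using \<nu>[OF kp[OF that]] by (simp_all add: Y_def hs)
    then show "Y z \<noteq> 0" by auto
  qed
  have zY: "z \<bullet> Y z = k z" if "z \<noteq> 0" for z
    using hY(2)[OF that] by (subst zp) simp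
  have J0: "J 0 = 0" using k0[of 0] by (simp add: J_def)
  have Jnz: "J z \<noteq> 0" if "z \<noteq> 0" for z using hY(3)[OF that] kpos[OF that] by (simp add: J_def)
  have J_iff: "dual_pair K z w \<longleftrightarrow> w = J z" for z w
  proof (cases "z = 0")
    case True
    then show ?thesis using h0[of w] k0[of 0] J0 by (auto simp: dual_pair_def k_def[symmetric] h_def[symmetric])
  next
    case False
    show ?thesis
    proof
      assume d: "dual_pair K z w"
      then have zw: "z \<bullet> w = k z * h w" "k z = h w" by (auto simp: dual_pair_def k_def h_def)
      have w: "w \<noteq> 0" using zw kpos[OF False] h0[of w] by auto
      have sg: "w = norm w *\<^sub>R sgn w" using w by (simp add: sgn_div_norm)
      have "p z \<bullet> sgn w = h (sgn w)"
        using zw kpos[OF False] hs[of "1 / norm w" w] by (simp add: p_def sgn_div_norm inverse_eq_divide)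
      then have "outer_unit_normal K (p z) (sgn w)" using kp[OF False] w by (simp add: normal_iff norm_sgn)
      then have s: "sgn w = \<nu> (p z)" using normal[of "p z"] kp[OF False] by (simp add: fr)
      have "h w = norm w * h (\<nu> (p z))" using sg hs[of "norm w" "sgn w"] s by simp
      then have "norm w = k z / h (\<nu> (p z))" using zw \<nu>(3)[OF kp[OF False]] by simp
      then show "w = J z" using sg s \<nu>(2)[OF kp[OF False]] by (simp add: J_def Y_def)
    next
      assume "w = J z"
      then show "dual_pair K z w"
        using zY[OF False] hY(1)[OF False] kpos[OF False] hs[of "k z" "Y z"]
        by (simp add: dual_pair_def k_def[symmetric] h_def[symmetric] J_def)
    qed
  qed
  have J_scale: "J (c *\<^sub>R z) = c *\<^sub>R J z" if "0 < c" for c z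
  proof -
    have "dual_pair K z (J z)" by (simp add: J_iff)
    then have "dual_pair K (c *\<^sub>R z) (c *\<^sub>R J z)"
      using that ks[of c z] hs[of c "J z"] by (simp add: dual_pair_def k_def[symmetric] h_def[symmetric])
    then show ?thesis by (simp add: J_iff)
  qed
  have contk: "continuous_on T k" for T unfolding k_def by (rule continuous_gauge[OF ob])
  have open0: "open (-{0::real^'n})" by auto
  have at0: "at z within -{0} = at z" if "z \<noteq> 0" for z :: "real^'n"
    by (rule at_within_open) (use that open0 in auto)
  have pcont: "continuous (at z) p" if "z \<noteq> 0" for z
  proof -
    have "continuous (at z) k" using contk[of UNIV] by (simp add: continuous_on_eq_continuous_at)
    then show ?thesis unfolding p_def[abs_def] using k0[of z] that by (intro continuous_intros) auto
  qed
  have \<nu>pcont: "continuous (at z) (\<lambda>z. \<nu> (p z))" if z: "z \<noteq> 0" for z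
  proof -
    have "continuous (at (p z) within frontier K) \<nu>"
      using smooth[of "p z"] kp[OF z] by (intro differentiable_imp_continuous_within) (simp add: fr)
    then have "continuous (at (p z) within p ` (-{0})) \<nu>"
      by (rule continuous_within_subset) (rule psub)
    moreover have "continuous (at z within -{0}) p" using pcont[OF z] at0[OF z] by simp
    ultimately have "continuous (at z within -{0}) (\<nu> \<circ> p)" by (intro continuous_within_compose)
    then show ?thesis using at0[OF z] by (simp add: comp_def)
  qed
  have Ycont: "continuous (at z) Y" if z: "z \<noteq> 0" for z
    unfolding Y_def[abs_def] using \<nu>[OF kp[OF z]] pcont[OF z] \<nu>pcont[OF z]
    by (intro continuous_intros) auto
  have kder: "(k has_derivative (\<lambda>v. v \<bullet> Y z)) (at z)" if z: "z \<noteq> 0" for z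
  proof (rule has_derivative_support_sandwich[where S="-{0}"])
    show "k z' = z' \<bullet> Y z'" if "z' \<in> -{0}" for z' using zY[of z'] that by simp
    show "z1 \<bullet> Y z2 \<le> k z1" if "z1 \<in> -{0}" "z2 \<in> -{0}" for z1 z2
      using inner_le[of z1 "Y z2"] hY(1)[of z2] that by simp
  qed (use z open0 Ycont in auto)
  have pder: "(p has_derivative (\<lambda>v. (1 / k z) *\<^sub>R (v - (v \<bullet> Y z) *\<^sub>R p z))) (at z)" if z: "z \<noteq> 0" for z
  proof -
    have "k z \<noteq> 0" using k0 z by simp
    from has_derivative_scaleR[OF Deriv.has_derivative_inverse[OF this kder[OF z]] has_derivative_ident]
    have "((\<lambda>z. inverse (k z) *\<^sub>R z) has_derivative (\<lambda>v. inverse (k z) *\<^sub>R v + - (inverse (k z) * (v \<bullet> Y z) * inverse (k z)) *\<^sub>R z)) (at z)"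
      by simp
    moreover have "(\<lambda>v. inverse (k z) *\<^sub>R v + - (inverse (k z) * (v \<bullet> Y z) * inverse (k z)) *\<^sub>R z)
      = (\<lambda>v. (1 / k z) *\<^sub>R (v - (v \<bullet> Y z) *\<^sub>R p z))"
      by (simp add: fun_eq_iff p_def inverse_eq_divide scaleR_diff_right)
    ultimately show ?thesis by (simp add: p_def[abs_def] inverse_eq_divide)
  qed
  have \<nu>pder: "((\<lambda>z. \<nu> (p z)) has_derivative (\<lambda>v. frechet_derivative \<nu> (at (p z) within frontier K) ((1 / k z) *\<^sub>R (v - (v \<bullet> Y z) *\<^sub>R p z)))) (at z)"
    if z: "z \<noteq> 0" for z
  proof -
    let ?W = "frechet_derivative \<nu> (at (p z) within frontier K)"
    have "(\<nu> has_derivative ?W) (at (p z) within frontier K)"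
      using smooth[of "p z"] kp[OF z] by (simp add: frechet_derivative_works fr)
    then have "(\<nu> has_derivative ?W) (at (p z) within p ` (-{0}))"
      by (rule has_derivative_subset) (rule psub)
    from diff_chain_within[OF has_derivative_at_withinI[OF pder[OF z]] this]
    show ?thesis using at0[OF z] by (simp add: comp_def)
  qed
  have Jdiff: "J differentiable (at z)" if z: "z \<noteq> 0" for z
  proof -
    have "p z \<bullet> \<nu> (p z) \<noteq> 0" using \<nu>(2,3)[OF kp[OF z]] by simp
    note nz = this
    note inn = has_derivative_inner[OF pder[OF z] \<nu>pder[OF z]]
    note inv = Deriv.has_derivative_inverse[where f="\<lambda>z. p z \<bullet> \<nu> (p z)" and x=z, OF nz inn]
    obtain D where D: "((\<lambda>z. inverse (p z \<bullet> \<nu> (p z)) *\<^sub>R \<nu> (p z)) has_derivative D) (at z)"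
      by (rule that[OF has_derivative_scaleR[OF inv \<nu>pder[OF z]]])
    moreover have "(\<lambda>z. inverse (p z \<bullet> \<nu> (p z)) *\<^sub>R \<nu> (p z)) = Y"
      by (simp add: Y_def fun_eq_iff inverse_eq_divide)
    ultimately have "(Y has_derivative D) (at z)" by simp
    from has_derivative_scaleR[OF kder[OF z] this]
    show ?thesis unfolding J_def[abs_def] differentiable_def by blast
  qed
  have sgnJ: "sgn (J z) = \<nu> (p z)" if z: "z \<noteq> 0" for z
    using kpos[OF z] \<nu>[OF kp[OF z]] by (simp add: J_def Y_def sgn_scaleR sgn_div_norm)
  \<comment> \<open>If \<open>D v = 0\<close>, the differential of the Gauss map kills the
    tangential part \<open>t\<close> of \<open>v\<close>, so \<open>t = 0\<close> by non-zero
    curvature and \<open>v\<close> is radial. On radial vectors \<open>D\<close> is injective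
    because homogeneity gives \<open>D z = J z\<close>.\<close>
  have Jinj: "v = 0" if z: "z \<noteq> 0" and D: "(J has_derivative D) (at z)" and Dv: "D v = 0" for z D v
  proof -
    let ?W = "frechet_derivative \<nu> (at (p z) within frontier K)"
    let ?u = "\<nu> (p z)"
    have Dlin: "linear D" by (rule has_derivative_linear[OF D])
    have "(\<nu> has_derivative ?W) (at (p z) within frontier K)"
      using smooth[of "p z"] kp[OF z] by (simp add: frechet_derivative_works fr)
    then have Wlin: "linear ?W" by (rule has_derivative_linear)
    define t where "t = (1 / k z) *\<^sub>R (v - (v \<bullet> Y z) *\<^sub>R p z)"
    have "((\<lambda>z. sgn (J z)) has_derivative (\<lambda>v. (1 / norm (J z)) *\<^sub>R (D v - (sgn (J z) \<bullet> D v) *\<^sub>R sgn (J z)))) (at z)"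
      by (rule has_derivative_compose[OF D has_derivative_sgn[OF Jnz[OF z]]])
    moreover have "((\<lambda>z. sgn (J z)) has_derivative (\<lambda>v. ?W ((1 / k z) *\<^sub>R (v - (v \<bullet> Y z) *\<^sub>R p z)))) (at z)"
      by (rule has_derivative_transform_within_open[OF \<nu>pder[OF z] open0]) (use z sgnJ in auto)
    ultimately have "(\<lambda>v. (1 / norm (J z)) *\<^sub>R (D v - (sgn (J z) \<bullet> D v) *\<^sub>R sgn (J z)))
        = (\<lambda>v. ?W ((1 / k z) *\<^sub>R (v - (v \<bullet> Y z) *\<^sub>R p z)))" by (rule has_derivative_unique)
    from fun_cong[OF this, of v] have Wt: "?W t = 0" by (simp add: Dv t_def)
    have tY: "t \<bullet> Y z = 0" using hY(2)[OF z] by (simp add: t_def inner_diff_left)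
    then have tu: "t \<bullet> ?u = 0" using \<nu>(2,3)[OF kp[OF z]] by (simp add: Y_def)
    define E where "E = (\<lambda>v. ?W (v - (v \<bullet> ?u) *\<^sub>R ?u) + (v \<bullet> ?u) *\<^sub>R ?u)"
    have Elin: "linear E"
      unfolding E_def by (intro linearI) (simp_all add: linear_add[OF Wlin] linear_scale[OF Wlin] linear_diff[OF Wlin] algebra_simps inner_add_left scaleR_add_left)
    have "gauss_curvature K (p z) = det (matrix E)"
      by (simp add: gauss_curvature_def Let_def E_def \<nu>_def)
    then have "det (matrix E) \<noteq> 0" using curv[of "p z"] kp[OF z] by (simp add: fr)
    then have "inj E" using det_nz_iff_inj[OF Elin] by simp
    moreover have "E t = 0" by (simp add: E_def tu Wt)
    ultimately have "t = 0" using linear_injective_0[OF Elin] by blast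
    then have v: "v = (v \<bullet> Y z) *\<^sub>R p z" using kpos[OF z] by (simp add: t_def)
    have Dz: "D z = J z"
    proof -
      have "((\<lambda>t::real. z + t *\<^sub>R z) has_derivative (\<lambda>t. t *\<^sub>R z)) (at 0)" by (auto intro!: derivative_eq_intros)
      from has_derivative_compose[OF this, of J D] D
      have "((\<lambda>t::real. J (z + t *\<^sub>R z)) has_derivative (\<lambda>t. D (t *\<^sub>R z))) (at 0)" by simp
      moreover have "((\<lambda>t::real. J (z + t *\<^sub>R z)) has_derivative (\<lambda>t. t *\<^sub>R J z)) (at 0)"
      proof (rule has_derivative_transform_within_open)
        show "((\<lambda>t::real. (1 + t) *\<^sub>R J z) has_derivative (\<lambda>t. t *\<^sub>R J z)) (at 0)" by (auto intro!: derivative_eq_intros)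
        show "open {-(1::real)<..}" by simp
        show "(1 + t) *\<^sub>R J z = J (z + t *\<^sub>R z)" if "t \<in> {-(1::real)<..}" for t :: real
          using J_scale[of "1 + t" z] that by (simp add: scaleR_add_left)
      qed auto
      ultimately have "(\<lambda>t::real. D (t *\<^sub>R z)) = (\<lambda>t. t *\<^sub>R J z)" by (rule has_derivative_unique)
      from fun_cong[OF this, of 1] show ?thesis by simp
    qed
    have "v = ((v \<bullet> Y z) / k z) *\<^sub>R z" using v by (simp add: p_def)
    then have "D v = ((v \<bullet> Y z) / k z) *\<^sub>R J z" using linear_scale[OF Dlin] Dz by metis
    then have "v \<bullet> Y z = 0" using Dv Jnz[OF z] kpos[OF z] by auto
    then show "v = 0" using v by simp
  qed
  have ex: "\<exists>z. dual_pair K z w" for w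
  proof (cases "w = 0")
    case True
    then show ?thesis using J_iff[of 0 0] J0 by auto
  next
    case False
    obtain x where x: "x \<in> K" "x \<bullet> w = h w"
      using support_fun_attained[OF compactK origin_bodyD(6)[OF ob], of w] by (auto simp: h_def)
    have "h w \<le> k x * h w" using inner_le[of x w] x by simp
    then have "k x = 1" using hpos[OF False] x(1) by (auto simp: memK)
    then have "dual_pair K (h w *\<^sub>R x) w"
      using x hpos[OF False] ks[of "h w" x] by (simp add: dual_pair_def k_def[symmetric] h_def[symmetric])
    then show ?thesis by blast
  qed
  \<comment> \<open>Two points dual to the same \<open>w\<close> would span a flat piece of a
    dilated boundary. On that segment \<open>J\<close> is constant, so its direction lies in the
    kernel of the derivative of \<open>J\<close>.\<close>
  have uniq: "z = z'" if d: "dual_pair K z w" "dual_pair K z' w" for z z' w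
  proof (cases "w = 0")
    case True
    then show ?thesis using d h0[of 0] k0[of z] k0[of z'] by (auto simp: dual_pair_def k_def[symmetric] h_def[symmetric])
  next
    case False
    have z: "k z = h w" "z \<bullet> w = h w * h w" "k z' = h w" "z' \<bullet> w = h w * h w"
      using d by (auto simp: dual_pair_def k_def[symmetric] h_def[symmetric])
    have zn: "z \<noteq> 0" using z(1) hpos[OF False] k0[of z] by auto
    define \<gamma> where "\<gamma> t = z + t *\<^sub>R (z' - z)" for t :: real
    have on: "J (\<gamma> t) = w" if t: "0 \<le> t" "t \<le> 1" for t
    proof -
      have "(1 / h w) *\<^sub>R z \<in> K" "(1 / h w) *\<^sub>R z' \<in> K" using z hpos[OF False] by (auto simp: memK ks)
      then have "(1 - t) *\<^sub>R ((1 / h w) *\<^sub>R z) + t *\<^sub>R ((1 / h w) *\<^sub>R z') \<in> K"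
        using origin_bodyD(1)[OF ob] t by (intro convexD) auto
      moreover have "(1 - t) *\<^sub>R ((1 / h w) *\<^sub>R z) + t *\<^sub>R ((1 / h w) *\<^sub>R z') = (1 / h w) *\<^sub>R \<gamma> t"
      proof -
        have "\<gamma> t = (1 - t) *\<^sub>R z + t *\<^sub>R z'" by (simp add: \<gamma>_def algebra_simps)
        then show ?thesis by (simp add: scaleR_add_right)
      qed
      ultimately have "k ((1 / h w) *\<^sub>R \<gamma> t) \<le> 1" by (simp add: memK)
      then have le: "k (\<gamma> t) \<le> h w" using hpos[OF False] by (simp add: ks field_simps)
      have in_w: "\<gamma> t \<bullet> w = h w * h w" using z by (simp add: \<gamma>_def inner_add_left inner_diff_left)
      have "h w * h w \<le> k (\<gamma> t) * h w" using inner_le[of "\<gamma> t" w] in_w by simp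
      then have "k (\<gamma> t) = h w" using le hpos[OF False] by simp
      then have "dual_pair K (\<gamma> t) w" using in_w by (simp add: dual_pair_def k_def[symmetric] h_def[symmetric])
      then show ?thesis by (simp add: J_iff)
    qed
    obtain D where D: "(J has_derivative D) (at z)" using Jdiff[OF zn] by (auto simp: differentiable_def)
    have "((\<lambda>t. J (\<gamma> t)) has_derivative (\<lambda>t. D (t *\<^sub>R (z' - z)))) (at 0)"
    proof -
      have "(\<gamma> has_derivative (\<lambda>t. t *\<^sub>R (z' - z))) (at 0)" unfolding \<gamma>_def[abs_def] by (auto intro!: derivative_eq_intros)
      from has_derivative_compose[OF this, of J D] D show ?thesis by (simp add: \<gamma>_def)
    qed
    \<comment> \<open>Constancy is known only for \<open>0 \<le> t \<le> 1\<close>, so the two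
      derivatives at 0 are compared one-sidedly.\<close>
    then have 1: "((\<lambda>t. J (\<gamma> t)) has_derivative (\<lambda>t. D (t *\<^sub>R (z' - z)))) (at 0 within {0..1})"
      by (rule has_derivative_at_withinI)
    have 2: "((\<lambda>t. J (\<gamma> t)) has_derivative (\<lambda>t. 0)) (at 0 within {0..1::real})"
      by (rule has_derivative_transform[of _ _ "\<lambda>t. J (\<gamma> t)" "\<lambda>t. w"]) (use on in auto)
    have "D (1 *\<^sub>R (z' - z)) = 0"
    proof -
      have "((\<lambda>t. J (\<gamma> t)) has_vector_derivative D (z' - z)) (at 0 within {0..1})"
        using 1 linear_scale[OF has_derivative_linear[OF D]] by (simp add: has_vector_derivative_def)
      moreover have "((\<lambda>t. J (\<gamma> t)) has_vector_derivative 0) (at 0 within {0..1::real})"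
        using 2 by (simp add: has_vector_derivative_def)
      ultimately show ?thesis
        using vector_derivative_unique_within_closed_interval[of 0 1 0 "\<lambda>t. J (\<gamma> t)"] by simp
    qed
    then show ?thesis using Jinj[OF zn D, of "z' - z"] by simp
  qed
  define Js where "Js w = (THE z. dual_pair K z w)" for w
  have Js_iff: "dual_pair K z w \<longleftrightarrow> z = Js w" for z w
  proof -
    have "dual_pair K (Js w) w" unfolding Js_def
    proof (rule theI')
      obtain z0 where "dual_pair K z0 w" using ex by blast
      then show "\<exists>!z. dual_pair K z w" using uniq by (intro ex1I[of _ z0]) 
    qed
    then show ?thesis using uniq[of z w "Js w"] by auto
  qed
  have JsJ: "Js (J z) = z" for z using J_iff[of z "J z"] Js_iff[of z "J z"] by simp
  have JJs: "J (Js w) = w" for w using J_iff[of "Js w" w] Js_iff[of "Js w" w] by simp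
  have "Js differentiable (at w)" if w: "w \<noteq> 0" for w
  proof -
    have zn: "Js w \<noteq> 0" using JJs[of w] J0 w by auto
    obtain D where D: "(J has_derivative D) (at (Js w))" using Jdiff[OF zn] by (auto simp: differentiable_def)
    have Dlin: "linear D" by (rule has_derivative_linear[OF D])
    have "inj D" using Jinj[OF zn D] linear_injective_0[OF Dlin] by blast
    then obtain D' where D': "linear D'" "\<forall>x. D' (D x) = x" "\<forall>x. D (D' x) = x"
      using linear_injective_isomorphism[OF Dlin] by blast
    \<comment> \<open>The inverse is already known globally, so continuity of \<open>J\<close> away
      from 0 and an invertible derivative at the single point \<open>Js w\<close> are
      enough.\<close>
    have "(Js has_derivative D') (at w)"
    proof (rule has_derivative_inverse_strong_x[where f=J and f'=D])
      show "continuous_on (-{0}) J"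
        using Jdiff by (intro continuous_at_imp_continuous_on ballI differentiable_imp_continuous_within) auto
      show "D \<circ> D' = id" using D'(3) by (simp add: fun_eq_iff)
    qed (use zn D JsJ JJs open0 in auto)
    then show ?thesis by (auto simp: differentiable_def)
  qed
  then have "regular_body K J Js"
    using ob J_iff Js_iff Jdiff by unfold_locales auto
  then show ?thesis by blast
qed

section \<open>The arithmetic-geometric mean bound\<close>

lemma convex_body_measure_pos:
  assumes "convex_body (K :: 'a::euclidean_space set)"
  shows "measure lborel K > 0"
proof -
  obtain c e where e: "e > 0" "cball c e \<subseteq> K"
    using assms by (auto simp: convex_body_def mem_interior_cball)
  have "emeasure lborel K < top"
    using assms emeasure_compact_finite[of K] by (simp add: convex_body_def less_top)
  then have "measure lborel (cball c e) \<le> measure lborel K"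
    using e assms by (intro measure_mono_fmeasurable) (auto simp: fmeasurable_def convex_body_def borel_compact)
  moreover have "measure lborel (cball c e) > 0" using e by (simp add: content_cball)
  ultimately show ?thesis by linarith
qed

lemma convex_body_integrable:
  assumes "convex_body (K :: 'a::euclidean_space set)"
  shows "integrable lborel (\<lambda>x. indicator K x *\<^sub>R x)"
  using assms borel_integrable_compact[of K "\<lambda>x. x"] by (auto simp: convex_body_def)

lemma centroid_zero_integral:
  assumes "convex_body (K :: 'a::euclidean_space set)" "centroid K = 0"
  shows "(LINT x:K|lborel. x) = 0"
  using assms convex_body_measure_pos[OF assms(1)] by (simp add: centroid_def)

text \<open>Otherwise some \<open>a \<noteq> 0\<close> has \<open>a \<bullet> x \<ge> 0\<close> on
  \<open>K\<close>. The integral of this function is 0, so it vanishes almost everywhere on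
  \<open>K\<close>; but the interior is open and nonempty and does not fit into a
  hyperplane.\<close>

lemma zero_in_interior_if_centroid_zero:
  assumes K: "convex_body (K :: 'a::euclidean_space set)" and c: "centroid K = 0"
  shows "0 \<in> interior K"
proof (rule ccontr)
  assume "0 \<notin> interior K"
  have cK: "convex K" "compact K" "interior K \<noteq> {}" using K by (auto simp: convex_body_def)
  obtain a where a: "a \<noteq> 0" "\<And>x. x \<in> interior K \<Longrightarrow> 0 \<le> a \<bullet> x"
    using separating_hyperplane_set_0[of "interior K"] \<open>0 \<notin> interior K\<close> convex_interior[OF cK(1)] by blast
  have cl: "closure (interior K) = K"
    using cK convex_closure_interior[of K] by (simp add: closure_closed compact_imp_closed)
  have "closed {x. 0 \<le> a \<bullet> x}" by (simp add: closed_halfspace_ge)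
  then have "closure (interior K) \<subseteq> {x. 0 \<le> a \<bullet> x}" using a(2) by (intro closure_minimal) auto
  then have nn: "0 \<le> a \<bullet> x" if "x \<in> K" for x using that cl by auto
  have int: "integrable lborel (\<lambda>x. indicator K x *\<^sub>R x)" by (rule convex_body_integrable[OF K])
  have int': "integrable lborel (\<lambda>x. a \<bullet> (indicator K x *\<^sub>R x))" using int by (intro integrable_inner_right) auto
  have "(LINT x|lborel. a \<bullet> (indicator K x *\<^sub>R x)) = a \<bullet> (LINT x|lborel. indicator K x *\<^sub>R x)"
    by (rule integral_inner_right) (use int in auto)
  also have "\<dots> = 0" using centroid_zero_integral[OF K c] by (simp add: set_lebesgue_integral_def)
  finally have 0: "(LINT x|lborel. a \<bullet> (indicator K x *\<^sub>R x)) = 0" .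
  have "AE x in lborel. a \<bullet> (indicator K x *\<^sub>R x) = 0"
    using integral_nonneg_eq_0_iff_AE[OF int'] 0 nn by (auto simp: indicator_def)
  then have "AE x in lborel. x \<notin> interior K \<inter> {x. a \<bullet> x \<noteq> 0}"
    by eventually_elim (use interior_subset[of K] in \<open>auto simp: indicator_def split: if_splits\<close>)
  moreover have op: "open (interior K \<inter> {x. a \<bullet> x \<noteq> 0})"
    by (intro open_Int open_interior open_Collect_neq continuous_intros)
  ultimately have "interior K \<inter> {x. a \<bullet> x \<noteq> 0} \<in> null_sets lborel"
    by (intro iffD2[OF AE_iff_null_sets]) auto
  then have "negligible (interior K \<inter> {x. a \<bullet> x \<noteq> 0})"
    by (simp add: negligible_iff_null_sets null_sets_completion_iff op)
  then have emp: "interior K \<inter> {x. a \<bullet> x \<noteq> 0} = {}" using open_not_negligible[OF op] by blast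
  obtain p where p: "p \<in> interior K" using cK by auto
  obtain e where e: "e > 0" "cball p e \<subseteq> interior K" using p open_contains_cball[of "interior K"] by auto
  have "p + (e / norm a) *\<^sub>R a \<in> interior K" using e a by (intro subsetD[OF e(2)]) (auto simp: dist_norm)
  then have "a \<bullet> p = 0" "a \<bullet> (p + (e / norm a) *\<^sub>R a) = 0" using emp p by auto
  then show False using e a by (simp add: inner_add_right)
qed

lemma weighted_am_gm4:
  fixes a b c d :: real
  assumes pos: "a > 0" "b > 0" "c > 0" "d > 0" and w: "w1 \<ge> 0" "w2 \<ge> 0" "w3 \<ge> 0" "w4 \<ge> 0" "w1 + w2 + w3 + w4 = 1"
  shows "a powr w1 * b powr w2 * c powr w3 * d powr w4 \<le> w1 * a + w2 * b + w3 * c + w4 * d"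
proof -
  define S where "S = w1 * a + w2 * b + w3 * c + w4 * d"
  have nn: "0 \<le> w1 * a" "0 \<le> w2 * b" "0 \<le> w3 * c" "0 \<le> w4 * d" using pos w by auto
  have "w1 > 0 \<or> w2 > 0 \<or> w3 > 0 \<or> w4 > 0" using w by linarith
  then have "0 < w1 * a \<or> 0 < w2 * b \<or> 0 < w3 * c \<or> 0 < w4 * d" using pos by auto
  then have S: "S > 0" unfolding S_def using nn by linarith
  have ln_le: "w * ln x \<le> w * (ln S + x / S - 1)" if "x > 0" "w \<ge> 0" for x w
  proof -
    have "ln (x / S) \<le> x / S - 1" using that S by (intro ln_le_minus_one) auto
    then have "ln x \<le> ln S + x / S - 1" using that S by (simp add: ln_div)
    then show ?thesis using that by (intro mult_left_mono)
  qed
  have "a powr w1 * b powr w2 * c powr w3 * d powr w4 = exp (w1 * ln a + w2 * ln b + w3 * ln c + w4 * ln d)"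
    using pos by (simp add: powr_def exp_add)
  also have "w1 * ln a + w2 * ln b + w3 * ln c + w4 * ln d
     \<le> w1 * (ln S + a / S - 1) + w2 * (ln S + b / S - 1) + w3 * (ln S + c / S - 1) + w4 * (ln S + d / S - 1)"
    by (intro add_mono ln_le pos w)
  also have "\<dots> = (w1 + w2 + w3 + w4) * (ln S - 1) + (w1 * a + w2 * b + w3 * c + w4 * d) / S"
    by (simp add: algebra_simps add_divide_distrib)
  also have "\<dots> = ln S" using S w(5) by (simp add: S_def[symmetric])
  finally show ?thesis using S by (simp add: S_def)
qed

section \<open>Integration over the sphere\<close>

lemma measurable_sgn_sphere:
  "sgn \<in> measurable (restrict_space lborel punctured_ball) (restrict_space borel (sphere (0::real^'n) 1))"
proof (rule measurable_restrict_space2)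
  show "sgn \<in> space (restrict_space lborel punctured_ball) \<rightarrow> sphere (0::real^'n) 1"
    by (auto simp: space_restrict_space norm_sgn)
  have "(\<lambda>x::real^'n. inverse (norm x) *\<^sub>R x) \<in> borel_measurable borel" by measurable
  then show "(sgn :: real^'n \<Rightarrow> _) \<in> borel_measurable (restrict_space lborel punctured_ball)"
    by (intro measurable_restrict_space1) (simp add: sgn_div_norm[abs_def])
qed

lemma nn_integral_sphere_measure:
  fixes F :: "real^'n \<Rightarrow> ennreal"
  assumes F: "F \<in> borel_measurable sphere_measure"
  shows "(\<integral>\<^sup>+u. F u \<partial>sphere_measure) = of_nat CARD('n) * (\<integral>\<^sup>+z. F (sgn z) * indicator punctured_ball z \<partial>lebesgue)"
proof -
  have F': "F \<in> borel_measurable (restrict_space borel (sphere 0 1))"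
    using F by (simp add: sphere_measure_def cong: measurable_cong_sets)
  have "(\<integral>\<^sup>+u. F u \<partial>sphere_measure)
      = of_nat CARD('n) * (\<integral>\<^sup>+u. F u \<partial>distr (restrict_space lborel punctured_ball) (restrict_space borel (sphere 0 1)) sgn)"
    unfolding sphere_measure_def using F' by (intro nn_integral_scale_measure) (simp cong: measurable_cong_sets)
  also have "(\<integral>\<^sup>+u. F u \<partial>distr (restrict_space lborel punctured_ball) (restrict_space borel (sphere 0 1)) sgn)
      = (\<integral>\<^sup>+z. F (sgn z) \<partial>restrict_space lborel punctured_ball)"
    by (rule nn_integral_distr[OF measurable_sgn_sphere]) (use F' in simp)
  also have "\<dots> = (\<integral>\<^sup>+z. F (sgn z) * indicator punctured_ball z \<partial>lborel)"
    using punctured_ball_sets by (intro nn_integral_restrict_space) auto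
  finally show ?thesis by (simp add: nn_integral_completion)
qed

text \<open>If \<open>F\<close> is not measurable, its Bochner integral is 0 by convention and the
  non-negative right-hand side still bounds it. The upper bound can thus be used before anything is
  known about measurability of the curvature.\<close>

lemma integral_sphere_le:
  fixes F G :: "real^'n \<Rightarrow> real"
  assumes F: "\<And>u. 0 \<le> F u" and G: "set_integrable lebesgue punctured_ball G"
    and le: "\<And>z. z \<in> punctured_ball \<Longrightarrow> F (sgn z) \<le> G z"
  shows "(LINT u|sphere_measure. F u) \<le> CARD('n) * (LINT z:punctured_ball|lebesgue. G z)"
proof -
  have G0: "0 \<le> G z" if "z \<in> punctured_ball" for z using F[of "sgn z"] le[OF that] by linarith
  then have I0: "0 \<le> (LINT z:punctured_ball|lebesgue. G z)"
    unfolding set_lebesgue_integral_def by (intro integral_nonneg_AE) (auto simp: indicator_def)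
  show ?thesis
  proof (cases "F \<in> borel_measurable sphere_measure")
    case True
    have "(\<integral>\<^sup>+z. ennreal (F (sgn z)) * indicator punctured_ball z \<partial>lebesgue) \<le> (\<integral>\<^sup>+z. ennreal (indicator punctured_ball z *\<^sub>R G z) \<partial>lebesgue)"
      using le by (intro nn_integral_mono) (auto simp: indicator_def intro!: ennreal_leI)
    also have "\<dots> = ennreal (LINT z:punctured_ball|lebesgue. G z)"
      using G G0 unfolding set_lebesgue_integral_def set_integrable_def
      by (intro nn_integral_eq_integral) (auto simp: indicator_def)
    finally have "(\<integral>\<^sup>+u. ennreal (F u) \<partial>sphere_measure) \<le> of_nat CARD('n) * ennreal (LINT z:punctured_ball|lebesgue. G z)"
      using True by (subst nn_integral_sphere_measure) (auto intro!: mult_left_mono)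
    also have "\<dots> = ennreal (CARD('n) * (LINT z:punctured_ball|lebesgue. G z))"
      using I0 by (simp add: ennreal_mult ennreal_of_nat_eq_real_of_nat)
    finally have "enn2real (\<integral>\<^sup>+u. ennreal (F u) \<partial>sphere_measure) \<le> CARD('n) * (LINT z:punctured_ball|lebesgue. G z)"
      using I0 by (intro enn2real_leI) auto
    then show ?thesis using True F by (simp add: integral_eq_nn_integral)
  next
    case False
    then have "\<not> integrable sphere_measure F" by (metis borel_measurable_integrable)
    then show ?thesis using I0 by (simp add: not_integrable_integral_eq)
  qed
qed

lemma integral_sphere_eq:
  fixes F G :: "real^'n \<Rightarrow> real"
  assumes F: "\<And>u. 0 \<le> F u" and Fm: "F \<in> borel_measurable sphere_measure" and G: "set_integrable lebesgue punctured_ball G"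
    and eq: "\<And>z. z \<in> punctured_ball \<Longrightarrow> F (sgn z) = G z"
  shows "(LINT u|sphere_measure. F u) = CARD('n) * (LINT z:punctured_ball|lebesgue. G z)"
proof -
  have G0: "0 \<le> G z" if "z \<in> punctured_ball" for z using F[of "sgn z"] eq[OF that] by simp
  then have I0: "0 \<le> (LINT z:punctured_ball|lebesgue. G z)"
    unfolding set_lebesgue_integral_def by (intro integral_nonneg_AE) (auto simp: indicator_def)
  have "(\<integral>\<^sup>+z. ennreal (F (sgn z)) * indicator punctured_ball z \<partial>lebesgue) = (\<integral>\<^sup>+z. ennreal (indicator punctured_ball z *\<^sub>R G z) \<partial>lebesgue)"
    using eq by (intro nn_integral_cong) (auto simp: indicator_def)
  also have "\<dots> = ennreal (LINT z:punctured_ball|lebesgue. G z)"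
    using G G0 unfolding set_lebesgue_integral_def set_integrable_def
    by (intro nn_integral_eq_integral) (auto simp: indicator_def)
  finally have "(\<integral>\<^sup>+u. ennreal (F u) \<partial>sphere_measure) = ennreal (CARD('n) * (LINT z:punctured_ball|lebesgue. G z))"
    using Fm I0 by (subst nn_integral_sphere_measure) (auto simp: ennreal_mult ennreal_of_nat_eq_real_of_nat)
  then show ?thesis using Fm F I0 by (simp add: integral_eq_nn_integral)
qed

text \<open>The geometric mean of the four volumes with the weights of the AM-GM step: each polar
  volume has \<open>p / n\<close> times the exponent of its body, and for
  \<open>0 \<le> i \<le> n\<close> and \<open>p \<ge> 0\<close> the exponents are non-negative and
  sum to 1.\<close>

definition mixed_volume_bound :: "real \<Rightarrow> real \<Rightarrow> (real^'n) set \<Rightarrow> (real^'n) set \<Rightarrow> real" where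
  "mixed_volume_bound p i K L =
     measure lborel K powr ((real CARD('n) - i) / (real CARD('n) + p)) *
     measure lborel (polar_body K) powr ((real CARD('n) - i) / (real CARD('n) + p) * (p / real CARD('n))) *
     measure lborel L powr (i / (real CARD('n) + p)) *
     measure lborel (polar_body L) powr (i / (real CARD('n) + p) * (p / real CARD('n)))"

text \<open>The factor \<open>h powr (- p * e)\<close> is written as a power of \<open>h\<close> to
  the \<open>-n\<close> with exponent \<open>e * (p / n)\<close>, which is non-negative for
  \<open>p \<ge> 0\<close> and \<open>e \<ge> 0\<close> and can therefore serve as a weight.\<close>

lemma p_curvature_powr:
  assumes h: "h > 0" and f: "f > 0" and n: "n > 0"
  shows "(h powr (1 - p) * f) powr e = (h * f) powr e * ((1 / h) ^ n) powr (e * (p / real n))"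
proof -
  have "(1 / h) ^ n = h powr (- real n)" using h by (simp add: powr_minus powr_realpow power_one_over inverse_eq_divide)
  then have "(h * f) powr e * ((1 / h) ^ n) powr (e * (p / real n)) = h powr e * f powr e * h powr (- e * p)"
    using h f n by (simp add: powr_mult powr_powr)
  also have "\<dots> = h powr (e + - e * p) * f powr e" by (simp only: powr_add) (simp add: ac_simps)
  also have "e + - e * p = (1 - p) * e" by (simp add: algebra_simps)
  finally show ?thesis using h f by (simp add: powr_mult powr_powr)
qed

lemma mixed_exponents:
  fixes n i p :: real
  assumes "n > 0" "0 \<le> i" "i \<le> n" "0 \<le> p"
  shows "(n - i) / (n + p) \<ge> 0" "(n - i) / (n + p) * (p / n) \<ge> 0" "i / (n + p) \<ge> 0" "i / (n + p) * (p / n) \<ge> 0"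
    "(n - i) / (n + p) + (n - i) / (n + p) * (p / n) + i / (n + p) + i / (n + p) * (p / n) = 1"
  using assms by (auto simp: divide_simps) (simp add: algebra_simps)

context
  fixes K L :: "(real^'n) set" and J Js J' Js' and p i :: real
  assumes K: "regular_body K J Js" and L: "regular_body L J' Js'"
    and p: "p \<ge> 0" and i: "0 \<le> i" "i \<le> real CARD('n)"
begin

interpretation K: regular_body K J Js by (rule K)
interpretation L: regular_body L J' Js' by (rule L)

lemma mixed_integrand:
  assumes u: "norm u = 1"
  shows "p_curvature_fun p K u powr ((real CARD('n) - i) / (real CARD('n) + p)) *
        p_curvature_fun p L u powr (i / (real CARD('n) + p))
    = (support_fun K u * curvature_fun K u) powr ((real CARD('n) - i) / (real CARD('n) + p)) *
      ((1 / support_fun K u) ^ CARD('n)) powr ((real CARD('n) - i) / (real CARD('n) + p) * (p / real CARD('n))) *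
      (support_fun L u * curvature_fun L u) powr (i / (real CARD('n) + p)) *
      ((1 / support_fun L u) ^ CARD('n)) powr (i / (real CARD('n) + p) * (p / real CARD('n)))"
proof -
  have u0: "u \<noteq> 0" using u by auto
  have n: "0 < CARD('n)" by simp
  show ?thesis
    unfolding p_curvature_fun_def p_curvature_powr[OF K.hpos[OF u0] K.curvature_fun_pos[OF u] n]
      p_curvature_powr[OF L.hpos[OF u0] L.curvature_fun_pos[OF u] n]
    by (simp only: mult.assoc)
qed

lemma volumes_pos:
  "measure lborel K > 0" "measure lborel (polar_body K) > 0" "measure lborel L > 0" "measure lborel (polar_body L) > 0"
  using K.ob L.ob origin_body_polar[OF K.ob] origin_body_polar[OF L.ob]
  by (auto intro!: convex_body_measure_pos simp: convex_body_def origin_body_def)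

lemma mixed_le_bound: "mixed_p_affine_surface_area p i K L \<le> CARD('n) * mixed_volume_bound p i K L"
proof -
  define w1 where "w1 = (real CARD('n) - i) / (real CARD('n) + p)"
  define w2 where "w2 = w1 * (p / real CARD('n))"
  define w3 where "w3 = i / (real CARD('n) + p)"
  define w4 where "w4 = w3 * (p / real CARD('n))"
  have w: "w1 \<ge> 0" "w2 \<ge> 0" "w3 \<ge> 0" "w4 \<ge> 0" "w1 + w2 + w3 + w4 = 1"
    using mixed_exponents[of "real CARD('n)" i p] i p by (auto simp: w1_def w2_def w3_def w4_def)
  define A where "A = measure lborel K"
  define B where "B = measure lborel (polar_body K)"
  define C where "C = measure lborel L"
  define D where "D = measure lborel (polar_body L)"
  have pos: "A > 0" "B > 0" "C > 0" "D > 0" using volumes_pos by (auto simp: A_def B_def C_def D_def)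
  define Q where "Q = A powr w1 * B powr w2 * C powr w3 * D powr w4"
  define a where "a u = support_fun K u * curvature_fun K u" for u
  define b where "b u = (1 / support_fun K u) ^ CARD('n)" for u
  define c where "c u = support_fun L u * curvature_fun L u" for u
  define d where "d u = (1 / support_fun L u) ^ CARD('n)" for u
  \<comment> \<open>The AM-GM majorant. Each of the four functions is divided by its own integral,
    so the bracket integrates to the sum of the weights, which is 1.\<close>
  define G where "G z = Q * (w1 / A * a (sgn z) + w2 / B * b (sgn z) + w3 / C * c (sgn z) + w4 / D * d (sgn z))" for z
  note ints = K.integral_support_curvature K.integral_support_power L.integral_support_curvature L.integral_support_power
  have si: "set_integrable lebesgue punctured_ball (\<lambda>z. a (sgn z))" "set_integrable lebesgue punctured_ball (\<lambda>z. b (sgn z))"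
    "set_integrable lebesgue punctured_ball (\<lambda>z. c (sgn z))" "set_integrable lebesgue punctured_ball (\<lambda>z. d (sgn z))"
    using ints by (simp_all add: a_def b_def c_def d_def)
  have iv: "(LINT z:punctured_ball|lebesgue. a (sgn z)) = A" "(LINT z:punctured_ball|lebesgue. b (sgn z)) = B"
    "(LINT z:punctured_ball|lebesgue. c (sgn z)) = C" "(LINT z:punctured_ball|lebesgue. d (sgn z)) = D"
    using ints by (simp_all add: a_def b_def c_def d_def A_def B_def C_def D_def)
  have Gint: "set_integrable lebesgue punctured_ball G"
    unfolding G_def using si by (intro set_integrable_mult_right set_integral_add) auto
  have "(LINT z:punctured_ball|lebesgue. G z) = Q * (w1 / A * A + w2 / B * B + w3 / C * C + w4 / D * D)"
    unfolding G_def using si iv by (simp add: set_integral_add set_integrable_mult_right)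
  also have "\<dots> = Q" using pos w by simp
  finally have GQ: "(LINT z:punctured_ball|lebesgue. G z) = Q" .
  have "mixed_p_affine_surface_area p i K L \<le> CARD('n) * (LINT z:punctured_ball|lebesgue. G z)"
    unfolding mixed_p_affine_surface_area_def
  proof (rule integral_sphere_le[OF _ Gint])
    fix z :: "real^'n" assume z: "z \<in> punctured_ball"
    define u where "u = sgn z"
    have u: "norm u = 1" "u \<noteq> 0" using z by (auto simp: u_def norm_sgn sgn_zero_iff)
    have up: "a u > 0" "b u > 0" "c u > 0" "d u > 0"
      using K.hpos[OF u(2)] L.hpos[OF u(2)] K.curvature_fun_pos[OF u(1)] L.curvature_fun_pos[OF u(1)]
      by (auto simp: a_def b_def c_def d_def)
    have "p_curvature_fun p K u powr ((real CARD('n) - i) / (real CARD('n) + p)) *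
        p_curvature_fun p L u powr (i / (real CARD('n) + p)) = a u powr w1 * b u powr w2 * c u powr w3 * d u powr w4"
      using mixed_integrand[OF u(1)] by (simp add: a_def b_def c_def d_def w1_def w2_def w3_def w4_def)
    also have "\<dots> = Q * ((a u / A) powr w1 * (b u / B) powr w2 * (c u / C) powr w3 * (d u / D) powr w4)"
      using pos up by (simp add: Q_def powr_divide)
    also have "\<dots> \<le> Q * (w1 * (a u / A) + w2 * (b u / B) + w3 * (c u / C) + w4 * (d u / D))"
      using pos up w by (intro mult_left_mono weighted_am_gm4) (auto simp: Q_def)
    also have "\<dots> = G z" by (simp add: G_def u_def)
    finally show "p_curvature_fun p K (sgn z) powr ((real CARD('n) - i) / (real CARD('n) + p)) *
        p_curvature_fun p L (sgn z) powr (i / (real CARD('n) + p)) \<le> G z" by (simp add: u_def)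
  qed auto
  then show ?thesis
    by (simp add: GQ) (simp add: Q_def mixed_volume_bound_def A_def B_def C_def D_def w1_def w2_def w3_def w4_def)
qed

text \<open>When the four functions are multiples of one function \<open>d\<close>, the integrand is
  exactly \<open>q * d\<close> and the volumes stand in the same proportions, so AM-GM loses
  nothing.\<close>

lemma mixed_eq_bound:
  assumes ratio: "\<And>u. norm u = 1 \<Longrightarrow> support_fun K u * curvature_fun K u = \<alpha> * (1 / support_fun L u) ^ CARD('n)"
    "\<And>u. norm u = 1 \<Longrightarrow> (1 / support_fun K u) ^ CARD('n) = \<beta> * (1 / support_fun L u) ^ CARD('n)"
    "\<And>u. norm u = 1 \<Longrightarrow> support_fun L u * curvature_fun L u = \<gamma> * (1 / support_fun L u) ^ CARD('n)"
  shows "mixed_p_affine_surface_area p i K L = CARD('n) * mixed_volume_bound p i K L"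
proof -
  define w1 where "w1 = (real CARD('n) - i) / (real CARD('n) + p)"
  define w2 where "w2 = w1 * (p / real CARD('n))"
  define w3 where "w3 = i / (real CARD('n) + p)"
  define w4 where "w4 = w3 * (p / real CARD('n))"
  have w: "w1 \<ge> 0" "w2 \<ge> 0" "w3 \<ge> 0" "w4 \<ge> 0" "w1 + w2 + w3 + w4 = 1"
    using mixed_exponents[of "real CARD('n)" i p] i p by (auto simp: w1_def w2_def w3_def w4_def)
  define d where "d u = (1 / support_fun L u) ^ CARD('n)" for u
  define D where "D = measure lborel (polar_body L)"
  have Dpos: "D > 0" using volumes_pos by (simp add: D_def)
  have dint: "set_integrable lebesgue punctured_ball (\<lambda>z. d (sgn z))" "(LINT z:punctured_ball|lebesgue. d (sgn z)) = D"
    using L.integral_support_power by (simp_all add: d_def D_def)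
  have n1: "norm (sgn z) = 1" if "z \<in> punctured_ball" for z :: "real^'n" using that by (simp add: norm_sgn)
  have vol: "measure lborel K = \<alpha> * D" "measure lborel (polar_body K) = \<beta> * D" "measure lborel L = \<gamma> * D"
  proof -
    have "measure lborel K = (LINT z:punctured_ball|lebesgue. \<alpha> * d (sgn z))"
      unfolding K.integral_support_curvature(2)[symmetric] using ratio(1)[OF n1]
      by (intro set_lebesgue_integral_cong) (auto simp: punctured_ball_sets d_def)
    then show "measure lborel K = \<alpha> * D" by (simp add: dint)
    have "measure lborel (polar_body K) = (LINT z:punctured_ball|lebesgue. \<beta> * d (sgn z))"
      unfolding K.integral_support_power(2)[symmetric] using ratio(2)[OF n1]
      by (intro set_lebesgue_integral_cong) (auto simp: punctured_ball_sets d_def)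
    then show "measure lborel (polar_body K) = \<beta> * D" by (simp add: dint)
    have "measure lborel L = (LINT z:punctured_ball|lebesgue. \<gamma> * d (sgn z))"
      unfolding L.integral_support_curvature(2)[symmetric] using ratio(3)[OF n1]
      by (intro set_lebesgue_integral_cong) (auto simp: punctured_ball_sets d_def)
    then show "measure lborel L = \<gamma> * D" by (simp add: dint)
  qed
  then have cpos: "\<alpha> > 0" "\<beta> > 0" "\<gamma> > 0" using volumes_pos Dpos by (auto simp: zero_less_mult_iff)
  define q where "q = \<alpha> powr w1 * \<beta> powr w2 * \<gamma> powr w3"
  define F where "F u = p_curvature_fun p K u powr ((real CARD('n) - i) / (real CARD('n) + p)) *
        p_curvature_fun p L u powr (i / (real CARD('n) + p))" for u
  have split: "(\<alpha> * x) powr w1 * (\<beta> * x) powr w2 * (\<gamma> * x) powr w3 * x powr w4 = q * x" if "x > 0" for x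
  proof -
    have "(\<alpha> * x) powr w1 * (\<beta> * x) powr w2 * (\<gamma> * x) powr w3 * x powr w4
      = q * (x powr w1 * x powr w2 * x powr w3 * x powr w4)"
      using cpos that by (simp add: powr_mult q_def)
    also have "x powr w1 * x powr w2 * x powr w3 * x powr w4 = x powr (w1 + w2 + w3 + w4)" by (simp add: powr_add)
    finally show ?thesis using w that by simp
  qed
  have Fq: "F u = q * d u" if u: "norm u = 1" for u
  proof -
    have "u \<noteq> 0" using u by auto
    then have "d u > 0" using L.hpos by (simp add: d_def)
    then show ?thesis
      using split[of "d u"] mixed_integrand[OF u] ratio[OF u] by (simp add: F_def d_def w1_def w2_def w3_def w4_def)
  qed
  \<comment> \<open>An equality cannot tolerate the value 0 of a non-measurable integrand;
    measurability is inherited from \<open>d\<close>, where the support function is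
    continuous.\<close>
  have Fm: "F \<in> borel_measurable sphere_measure"
  proof -
    have [measurable]: "support_fun L \<in> borel_measurable borel"
      by (rule borel_measurable_continuous_onI) (rule continuous_support_fun[OF origin_bodyD(2,6)[OF L.ob]])
    have "(\<lambda>u. q * d u) \<in> borel_measurable (restrict_space borel (sphere 0 1))"
      unfolding d_def by (intro measurable_restrict_space1) measurable
    then have "F \<in> borel_measurable (restrict_space borel (sphere 0 1))"
      by (subst measurable_cong[of _ F "\<lambda>u. q * d u"]) (auto simp: space_restrict_space Fq)
    then show ?thesis by (simp add: sphere_measure_def cong: measurable_cong_sets)
  qed
  have "mixed_p_affine_surface_area p i K L = (LINT u|sphere_measure. F u)"
    by (simp add: mixed_p_affine_surface_area_def F_def)
  also have "\<dots> = CARD('n) * (LINT z:punctured_ball|lebesgue. q * d (sgn z))"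
  proof (rule integral_sphere_eq[OF _ Fm])
    show "0 \<le> F u" for u by (simp add: F_def)
    show "set_integrable lebesgue punctured_ball (\<lambda>z. q * d (sgn z))" using dint(1) by simp
    show "F (sgn z) = q * d (sgn z)" if "z \<in> punctured_ball" for z using Fq[OF n1[OF that]] .
  qed
  also have "(LINT z:punctured_ball|lebesgue. q * d (sgn z)) = q * D" by (simp add: dint)
  also have "q * D = mixed_volume_bound p i K L"
    using split[OF Dpos] by (simp add: mixed_volume_bound_def vol D_def[symmetric] w1_def w2_def w3_def w4_def)
  finally show ?thesis .
qed

text \<open>Polarity exchanges the exponents of a body and of its polar. In the product each volume
  collects \<open>w1 + w2\<close> or \<open>w3 + w4\<close>, and \<open>p\<close> cancels from these
  sums.\<close>

lemma mixed_volume_bound_polar: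
  "mixed_volume_bound p i K L * mixed_volume_bound p i (polar_body K) (polar_body L)
   = (measure lborel K * measure lborel (polar_body K)) powr ((real CARD('n) - i) / real CARD('n)) *
     (measure lborel L * measure lborel (polar_body L)) powr (i / real CARD('n))"
proof -
  define w1 where "w1 = (real CARD('n) - i) / (real CARD('n) + p)"
  define w2 where "w2 = w1 * (p / real CARD('n))"
  define w3 where "w3 = i / (real CARD('n) + p)"
  define w4 where "w4 = w3 * (p / real CARD('n))"
  have n: "real CARD('n) > 0" by simp
  have "w1 + w2 = w1 * ((real CARD('n) + p) / real CARD('n))" "w3 + w4 = w3 * ((real CARD('n) + p) / real CARD('n))"
    using n by (simp_all add: w2_def w4_def add_divide_distrib algebra_simps)
  then have e: "(real CARD('n) - i) / real CARD('n) = w1 + w2" "i / real CARD('n) = w3 + w4"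
    using n p by (simp_all add: w1_def w3_def)
  show ?thesis
    unfolding e mixed_volume_bound_def polar_polar_body[OF K.ob] polar_polar_body[OF L.ob]
      w1_def[symmetric] w3_def[symmetric] w2_def[symmetric] w4_def[symmetric]
    using volumes_pos by (simp add: powr_mult powr_add)
qed

end

section \<open>Ellipsoids\<close>

lemma support_fun_linear_ball:
  fixes T :: "'a::euclidean_space \<Rightarrow> 'a"
  assumes T: "linear T"
  shows "support_fun (T ` cball 0 1) u = norm (adjoint T u)"
proof (cases "adjoint T u = 0")
  case True
  have 0: "T x \<bullet> u = 0" for x using adjoint_works[OF T, of x u] True by simp
  have "support_fun (T ` cball 0 1) u = T 0 \<bullet> u"
  proof (rule support_fun_eqI)
    show "y \<bullet> u \<le> T 0 \<bullet> u" if "y \<in> T ` cball 0 1" for y using that 0 by fastforce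
  qed simp
  then show ?thesis using 0 True by simp
next
  case False
  let ?s = "sgn (adjoint T u)"
  have "support_fun (T ` cball 0 1) u = T ?s \<bullet> u"
  proof (rule support_fun_eqI)
    show "T ?s \<in> T ` cball 0 1" using False by (auto simp: norm_sgn)
    fix y assume "y \<in> T ` cball 0 1"
    then obtain x where x: "norm x \<le> 1" "y = T x" by auto
    have "y \<bullet> u = x \<bullet> adjoint T u" using x adjoint_works[OF T] by simp
    also have "\<dots> \<le> norm x * norm (adjoint T u)" by (rule norm_cauchy_schwarz)
    also have "\<dots> \<le> 1 * norm (adjoint T u)" using x by (intro mult_right_mono) auto
    also have "\<dots> = ?s \<bullet> adjoint T u" using False by (simp add: sgn_div_norm dot_square_norm power2_eq_square)
    also have "\<dots> = T ?s \<bullet> u" by (rule adjoint_works[OF T])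
    finally show "y \<bullet> u \<le> T ?s \<bullet> u" .
  qed
  also have "\<dots> = ?s \<bullet> adjoint T u" by (rule adjoint_works[OF T, symmetric])
  also have "\<dots> = norm (adjoint T u)" using False by (simp add: sgn_div_norm dot_square_norm power2_eq_square)
  finally show ?thesis .
qed

lemma adjoint_inv_linear:
  fixes T :: "'a::euclidean_space \<Rightarrow> 'a"
  assumes T: "linear T" "bij T"
  shows "linear (inv T)" "adjoint (inv T) (adjoint T u) = u" "adjoint T (adjoint (inv T) u) = u"
proof -
  show lin: "linear (inv T)" using T by (simp add: bij_is_inj bij_is_surj inj_linear_imp_inv_linear)
  have 1: "v \<bullet> adjoint (inv T) (adjoint T u) = v \<bullet> u" for v
    using T by (simp add: adjoint_works[OF lin] adjoint_works[OF T(1)] bij_is_surj surj_f_inv_f)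
  have 2: "v \<bullet> adjoint T (adjoint (inv T) u) = v \<bullet> u" for v
    using T by (simp add: adjoint_works[OF lin] adjoint_works[OF T(1)] bij_is_inj)
  show "adjoint (inv T) (adjoint T u) = u" "adjoint T (adjoint (inv T) u) = u"
    using 1 2 vector_eq_ldot by blast+
qed

lemma polar_linear_ball:
  fixes T :: "'a::euclidean_space \<Rightarrow> 'a"
  assumes T: "linear T" "bij T"
  shows "polar_body (T ` cball 0 1) = adjoint (inv T) ` cball 0 1"
proof -
  have c: "compact (T ` cball 0 1)" "T ` cball 0 1 \<noteq> {}"
    using T by (auto intro!: compact_continuous_image linear_continuous_on simp: linear_conv_bounded_linear)
  note inv = adjoint_inv_linear[OF T]
  show ?thesis
  proof (rule set_eqI)
    fix y
    have "y \<in> polar_body (T ` cball 0 1) \<longleftrightarrow> norm (adjoint T y) \<le> 1"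
      by (simp add: mem_polar_body_iff[OF c] support_fun_linear_ball[OF T(1)])
    also have "\<dots> \<longleftrightarrow> y \<in> adjoint (inv T) ` cball 0 1"
    proof
      assume "norm (adjoint T y) \<le> 1"
      then show "y \<in> adjoint (inv T) ` cball 0 1"
        by (intro image_eqI[of _ _ "adjoint T y"]) (simp_all add: inv(2))
    next
      assume "y \<in> adjoint (inv T) ` cball 0 1"
      then obtain x where "norm x \<le> 1" "y = adjoint (inv T) x" by (auto simp: image_iff)
      then show "norm (adjoint T y) \<le> 1" by (simp add: inv(3))
    qed
    finally show "y \<in> polar_body (T ` cball 0 1) \<longleftrightarrow> y \<in> adjoint (inv T) ` cball 0 1" .
  qed
qed

lemma origin_body_linear_ball:
  fixes T :: "'a::euclidean_space \<Rightarrow> 'a"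
  assumes T: "linear T" "bij T"
  shows "origin_body (T ` cball 0 1)"
proof -
  have "T ` ball 0 1 \<subseteq> interior (T ` cball 0 1)"
    using T open_bijective_linear_image_eq[of T "ball 0 1"] by (intro interior_maximal) auto
  moreover have "0 \<in> T ` ball 0 1" using linear_0[OF T(1)] by (intro image_eqI[of _ _ 0]) auto
  ultimately show ?thesis
    using T by (auto simp: origin_body_def linear_conv_bounded_linear intro!: compact_continuous_image linear_continuous_on convex_linear_image bounded_linear.linear)
qed

text \<open>For an ellipsoid \<open>X w\<close> is \<open>T (adjoint T w)\<close> divided by
  \<open>h w\<close>, so \<open>radial_X\<close> is the linear map \<open>S\<close> after the radial
  scaling onto the polar body. The chain rule compares the two Jacobians, with
  \<open>det (matrix S)\<close> the square of \<open>det (matrix T)\<close>.\<close>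

lemma (in regular_body) ellipsoid_curvature:
  fixes T :: "real^'n \<Rightarrow> real^'n"
  assumes KT: "K = T ` cball 0 1" and T: "linear T" "bij T" and u: "norm u = 1"
  shows "h u * curvature_fun K u = (det (matrix T))\<^sup>2 * (1 / h u) ^ CARD('n)"
proof -
  have u0: "u \<noteq> 0" and su: "sgn u = u" using u by (auto simp: sgn_div_norm)
  have hT: "h w = norm (adjoint T w)" for w using support_fun_linear_ball[OF T(1)] KT by simp
  have X: "X w = (1 / h w) *\<^sub>R T (adjoint T w)" if "w \<noteq> 0" for w
  proof (rule X_unique[OF that, symmetric])
    have hw: "h w > 0" by (rule hpos[OF that])
    have "(1 / h w) *\<^sub>R T (adjoint T w) = T ((1 / h w) *\<^sub>R adjoint T w)" by (simp add: linear_scale[OF T(1)])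
    moreover have "(1 / h w) *\<^sub>R adjoint T w \<in> cball 0 1" using hw by (simp add: hT)
    ultimately show "(1 / h w) *\<^sub>R T (adjoint T w) \<in> K" unfolding KT by blast
    have "T (adjoint T w) \<bullet> w = adjoint T w \<bullet> adjoint T w" by (rule adjoint_works[OF T(1), symmetric])
    then show "((1 / h w) *\<^sub>R T (adjoint T w)) \<bullet> w = h w"
      using hw by (simp add: hT dot_square_norm power2_eq_square)
  qed
  obtain D where D: "(radial_X has_derivative D) (at u)" "det (matrix D) = h (sgn u) * curvature_fun K (sgn u)"
    using radial_X_jacobian[OF u0] .
  obtain E where E: "((\<lambda>z. (norm z / h z) *\<^sub>R z) has_derivative E) (at u)" "det (matrix E) = (1 / h (sgn u)) ^ CARD('n)"
    using radial_scaling_jacobian[OF u0] .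
  define S where "S = (\<lambda>v. T (adjoint T v))"
  have lS: "linear S" unfolding S_def using linear_compose[OF adjoint_linear[OF T(1)] T(1)] by (simp add: comp_def)
  have "((\<lambda>z. S ((norm z / h z) *\<^sub>R z)) has_derivative (\<lambda>v. S (E v))) (at u)"
    by (rule has_derivative_compose[OF E(1)]) (rule linear_imp_has_derivative[OF lS])
  moreover have "(radial_X has_derivative (\<lambda>v. S (E v))) (at u)"
  proof (rule has_derivative_transform_within_open[OF calculation])
    show "open (-{0::real^'n})" by auto
    show "S ((norm z / h z) *\<^sub>R z) = radial_X z" if "z \<in> -{0}" for z
      using X[of z] that by (simp add: radial_X_def linear_scale[OF lS]) (simp add: S_def)
  qed (use u0 in simp)
  ultimately have "D = (\<lambda>v. S (E v))" using D(1) has_derivative_unique by blast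
  then have "det (matrix D) = det (matrix S) * det (matrix E)"
    using det_matrix_compose[OF lS has_derivative_linear[OF E(1)]] by simp
  moreover have "det (matrix S) = (det (matrix T))\<^sup>2"
    using det_matrix_compose[OF T(1) adjoint_linear[OF T(1)]] by (simp add: S_def matrix_adjoint[OF T(1)] power2_eq_square)
  ultimately show ?thesis using D(2) E(2) su by simp
qed

lemma measure_linear_ball:
  fixes T :: "real^'n \<Rightarrow> real^'n"
  assumes T: "linear T" "bij T"
  shows "measure lborel (T ` cball 0 1) = \<bar>det (matrix T)\<bar> * measure lborel (cball (0::real^'n) 1)"
proof -
  have c: "compact (T ` cball 0 1)" by (rule origin_bodyD(2)[OF origin_body_linear_ball[OF T]])
  have "(LINT x:cball (0::real^'n) 1|lebesgue. \<bar>det (matrix T)\<bar>) = measure lebesgue (T ` cball 0 1)"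
  proof (rule integral_abs_det_eq_measure_image(2)[where f=T and f'="\<lambda>_. T"])
    show "inj_on T (cball 0 1)" by (rule inj_on_subset[OF bij_is_inj[OF T(2)] subset_UNIV])
    show "T ` cball 0 1 \<in> lmeasurable" by (rule lmeasurable_compact[OF c])
  qed (auto intro: linear_imp_has_derivative[OF T(1)])
  moreover have "(LINT x:cball (0::real^'n) 1|lebesgue. \<bar>det (matrix T)\<bar>) = measure lebesgue (cball (0::real^'n) 1) * \<bar>det (matrix T)\<bar>"
    unfolding set_lebesgue_integral_def by simp
  ultimately show ?thesis using borel_compact[OF c] by (simp add: mult.commute)
qed

text \<open>\<open>T\<close> and the adjoint of its inverse, which describes the polar, have
  reciprocal determinants up to sign, and these cancel in the product.\<close>

lemma volume_product_ellipsoid: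
  fixes T :: "real^'n \<Rightarrow> real^'n"
  assumes T: "linear T" "bij T"
  shows "measure lborel (T ` cball 0 1) * measure lborel (polar_body (T ` cball 0 1)) = (measure lborel (cball (0::real^'n) 1))\<^sup>2"
proof -
  note inv = adjoint_inv_linear[OF T]
  have lin': "linear (adjoint (inv T))" by (rule adjoint_linear[OF inv(1)])
  have bij': "bij (adjoint (inv T))"
    by (rule o_bij[where g="adjoint T"]) (auto simp: fun_eq_iff inv)
  have "det (matrix T) * det (matrix (inv T)) = det (matrix (\<lambda>v :: real^'n. v))"
    using det_matrix_compose[OF T(1) inv(1)] T by (simp add: bij_is_surj surj_f_inv_f)
  also have "\<dots> = 1" using matrix_id by (simp add: id_def)
  finally have "\<bar>det (matrix T)\<bar> * \<bar>det (matrix (adjoint (inv T)))\<bar> = 1"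
    by (simp add: matrix_adjoint[OF inv(1)] flip: abs_mult)
  then show ?thesis
    unfolding polar_linear_ball[OF T] measure_linear_ball[OF T] measure_linear_ball[OF lin' bij']
    by (simp add: power2_eq_square ac_simps)
qed

lemma support_fun_image_scaleR:
  fixes L :: "'a::euclidean_space set"
  assumes L: "compact L" "L \<noteq> {}" and r: "r > 0"
  shows "support_fun (scaleR r ` L) u = r * support_fun L u"
proof -
  obtain x where x: "x \<in> L" "x \<bullet> u = support_fun L u" using support_fun_attained[OF L] .
  have "support_fun (scaleR r ` L) u = (r *\<^sub>R x) \<bullet> u"
    using x support_fun_upper[OF L(1)] r by (intro support_fun_eqI) auto
  then show ?thesis using x by simp
qed

lemma polar_image_scaleR:
  fixes L :: "'a::euclidean_space set"
  assumes r: "r > 0"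
  shows "polar_body (scaleR r ` L) = scaleR (1 / r) ` polar_body L"
proof
  show "polar_body (scaleR r ` L) \<subseteq> scaleR (1 / r) ` polar_body L"
  proof
    fix y assume "y \<in> polar_body (scaleR r ` L)"
    then have "r *\<^sub>R y \<in> polar_body L" by (auto simp: polar_body_def)
    then show "y \<in> scaleR (1 / r) ` polar_body L" using r by (intro image_eqI[of _ _ "r *\<^sub>R y"]) auto
  qed
  show "scaleR (1 / r) ` polar_body L \<subseteq> polar_body (scaleR r ` L)" using r by (auto simp: polar_body_def)
qed

lemma mixed_eq_bound_ellipsoid:
  fixes K L :: "(real^'n) set" and T :: "real^'n \<Rightarrow> real^'n"
  assumes K: "regular_body K J Js" and L: "regular_body L J' Js'"
    and p: "p \<ge> 0" and i: "0 \<le> i" "i \<le> real CARD('n)"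
    and T: "L = T ` cball 0 1" "linear T" "bij T" and r: "r > 0" "K = scaleR r ` L"
  shows "mixed_p_affine_surface_area p i K L = CARD('n) * mixed_volume_bound p i K L"
proof -
  interpret K: regular_body K J Js by (rule K)
  interpret L: regular_body L J' Js' by (rule L)
  let ?rT = "\<lambda>v :: real^'n. r *\<^sub>R T v"
  have rT: "K = ?rT ` cball 0 1" using T(1) r(2) by (simp add: image_image)
  have lin: "linear ?rT" using T(2) by (rule linear_compose_scale_right)
  have bij: "bij ?rT"
  proof -
    have "bij (scaleR r :: real^'n \<Rightarrow> _)"
      using r(1) by (intro o_bij[where g="scaleR (1 / r)"]) (auto simp: fun_eq_iff)
    from bij_comp[OF T(3) this] show ?thesis by (simp add: comp_def)
  qed
  have h: "support_fun K u = r * support_fun L u" for u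
    unfolding r(2) by (rule support_fun_image_scaleR[OF origin_bodyD(2,6)[OF L.ob] r(1)])
  have hh: "(1 / support_fun K u) ^ CARD('n) = (1 / r) ^ CARD('n) * (1 / support_fun L u) ^ CARD('n)" for u
    by (simp add: h flip: power_mult_distrib)
  show ?thesis
  proof (rule mixed_eq_bound[OF K L p i])
    fix u :: "real^'n" assume u: "norm u = 1"
    show "support_fun K u * curvature_fun K u = (det (matrix ?rT))\<^sup>2 * (1 / r) ^ CARD('n) * (1 / support_fun L u) ^ CARD('n)"
      unfolding K.ellipsoid_curvature[OF rT lin bij u] hh by (simp only: mult.assoc)
    show "(1 / support_fun K u) ^ CARD('n) = (1 / r) ^ CARD('n) * (1 / support_fun L u) ^ CARD('n)" by (rule hh)
    show "support_fun L u * curvature_fun L u = (det (matrix T))\<^sup>2 * (1 / support_fun L u) ^ CARD('n)"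
      by (rule L.ellipsoid_curvature[OF T u])
  qed
qed

section \<open>The unit ball and centred ellipsoids\<close>

lemma support_fun_unit_ball: "support_fun (cball (0::'a::euclidean_space) 1) u = norm u"
proof -
  have "adjoint (\<lambda>x::'a. x) = (\<lambda>x. x)" by (rule adjoint_unique) simp
  then show ?thesis using support_fun_linear_ball[of "\<lambda>x::'a. x" u] by (simp add: linear_ident)
qed

lemma polar_unit_ball: "polar_body (cball (0::'a::euclidean_space) 1) = cball 0 1"
proof (rule set_eqI)
  fix y :: 'a
  show "y \<in> polar_body (cball 0 1) \<longleftrightarrow> y \<in> cball 0 1"
    by (subst mem_polar_body_iff) (auto simp: support_fun_unit_ball)
qed

lemma regular_body_unit_ball: "regular_body (cball (0::real^'n) 1) (\<lambda>z. z) (\<lambda>z. z)"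
proof -
  have d: "dual_pair (cball (0::real^'n) 1) z w \<longleftrightarrow> z = w" for z w
  proof
    assume "dual_pair (cball (0::real^'n) 1) z w"
    then have "z \<bullet> w = norm z * norm w" "norm z = norm w"
      by (auto simp: dual_pair_def polar_unit_ball support_fun_unit_ball)
    then have "(norm (z - w))\<^sup>2 = 0" using dot_norm_neg[of z w] by (simp add: power2_eq_square)
    then show "z = w" by simp
  qed (auto simp: dual_pair_def polar_unit_ball support_fun_unit_ball dot_square_norm power2_eq_square)
  have "origin_body (cball (0::real^'n) 1)" by (auto simp: origin_body_def)
  then show ?thesis using d by unfold_locales auto
qed

lemma p_affine_surface_area_unit_ball:
  assumes p: "p \<ge> 0"
  shows "p_affine_surface_area p (cball (0::real^'n) 1) = CARD('n) * measure lborel (cball (0::real^'n) 1)"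
proof -
  let ?B = "cball (0::real^'n) 1"
  interpret B: regular_body ?B "\<lambda>z. z" "\<lambda>z. z" by (rule regular_body_unit_ball)
  \<comment> \<open>For \<open>i = 0\<close> the second factor has exponent 0. It equals 1 only at a
    non-zero base, because \<open>0 powr 0 = 0\<close>.\<close>
  have pc: "p_curvature_fun p ?B u \<noteq> 0" if "norm u = 1" for u
  proof -
    have "u \<noteq> 0" using that by auto
    then show ?thesis using B.hpos[of u] B.curvature_fun_pos[OF that] by (simp add: p_curvature_fun_def)
  qed
  have "p_affine_surface_area p ?B = mixed_p_affine_surface_area p 0 ?B ?B"
    unfolding p_affine_surface_area_def mixed_p_affine_surface_area_def
    using pc by (intro Bochner_Integration.integral_cong)
      (auto simp: sphere_measure_def space_scale_measure space_restrict_space)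
  also have "\<dots> = CARD('n) * mixed_volume_bound p 0 ?B ?B"
    by (rule mixed_eq_bound_ellipsoid[OF regular_body_unit_ball regular_body_unit_ball p, where T="\<lambda>x. x" and r=1])
       (auto simp: linear_ident bij_id[unfolded id_def])
  also have "mixed_volume_bound p 0 ?B ?B = measure lborel ?B"
  proof -
    have "real CARD('n) / (real CARD('n) + p) + real CARD('n) / (real CARD('n) + p) * (p / real CARD('n)) = 1"
      using mixed_exponents(5)[of "real CARD('n)" 0 p] p by simp
    moreover have "0 < measure lborel ?B" by (simp add: content_cball)
    ultimately show ?thesis by (simp add: mixed_volume_bound_def polar_unit_ball flip: powr_add)
  qed
  finally show ?thesis .
qed

lemma integral_lborel_reflect:
  fixes f :: "'a::euclidean_space \<Rightarrow> 'a"
  assumes [measurable]: "f \<in> borel_measurable borel"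
  shows "(LINT x|lborel. f x) = (LINT x|lborel. f (t - x))"
  by (subst lborel_affine[of "-1" t]) (auto simp: density_1 integral_distr)

text \<open>Reflection in the centre \<open>a\<close> preserves \<open>L\<close>, so the first
  moment is \<open>a\<close> times the volume; a centroid at the origin forces
  \<open>a = 0\<close>.\<close>

lemma ellipsoid_centered:
  fixes L :: "'a::euclidean_space set"
  assumes "ellipsoid L" and body: "convex_body L" and c: "centroid L = 0"
  obtains T :: "'a \<Rightarrow> 'a" where "linear T" "bij T" "L = T ` cball 0 1"
proof -
  obtain T :: "'a \<Rightarrow> 'a" and a where T: "linear T" "bij T" and L: "L = (\<lambda>x. a + T x) ` cball 0 1"
    using assms by (auto simp: ellipsoid_def)
  have sub: "2 *\<^sub>R a - x \<in> L" if x: "x \<in> L" for x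
  proof -
    obtain y where y: "norm y \<le> 1" "x = a + T y" using x unfolding L by auto
    have "2 *\<^sub>R a - x = a + T (- y)" using y linear_neg[OF T(1), of y] by (simp add: scaleR_2)
    then show ?thesis using y L by (auto intro!: image_eqI[of _ _ "- y"])
  qed
  have sym: "2 *\<^sub>R a - x \<in> L \<longleftrightarrow> x \<in> L" for x using sub[of x] sub[of "2 *\<^sub>R a - x"] by auto
  have clL: "L \<in> sets borel" using body by (simp add: convex_body_def borel_compact)
  have 0: "(LINT x|lborel. indicator L x *\<^sub>R x) = 0"
    using centroid_zero_integral[OF body c] by (simp add: set_lebesgue_integral_def)
  have int: "integrable lborel (\<lambda>x. indicator L x *\<^sub>R x)" by (rule convex_body_integrable[OF body])
  have fin: "emeasure lborel L < \<infinity>" using body emeasure_compact_finite[of L] by (simp add: convex_body_def)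
  have int': "integrable lborel (\<lambda>x. indicator L x *\<^sub>R (2 *\<^sub>R a))"
    using fin clL by (intro integrable_scaleR_left) auto
  have "(LINT x|lborel. indicator L x *\<^sub>R x) = (LINT x|lborel. indicator L (2 *\<^sub>R a - x) *\<^sub>R (2 *\<^sub>R a - x))"
    by (rule integral_lborel_reflect) (use clL in measurable)
  also have "\<dots> = (LINT x|lborel. indicator L x *\<^sub>R (2 *\<^sub>R a) - indicator L x *\<^sub>R x)"
    by (intro Bochner_Integration.integral_cong) (auto simp: indicator_def sym)
  also have "\<dots> = (LINT x|lborel. indicator L x *\<^sub>R (2 *\<^sub>R a)) - (LINT x|lborel. indicator L x *\<^sub>R x)"
    by (rule Bochner_Integration.integral_diff[OF int' int])
  also have "(LINT x|lborel. indicator L x *\<^sub>R (2 *\<^sub>R a)) = measure lborel L *\<^sub>R (2 *\<^sub>R a)"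
    using fin clL by (subst integral_scaleR_left) auto
  finally have "measure lborel L *\<^sub>R (2 *\<^sub>R a) = 0" using 0 by simp
  then have "a = 0" using convex_body_measure_pos[OF body] by auto
  then show ?thesis using that[OF T] L by simp
qed

theorem proposition2p9:
  fixes K L :: "(real^'n) set" and p i :: real
  assumes "C2_plus K" and "C2_plus L"
    and "centroid K = 0" and "centroid L = 0"
    and "p \<ge> 0" and "0 \<le> i" and "i \<le> real CARD('n)"
  shows "mixed_p_affine_surface_area p i K L *
           mixed_p_affine_surface_area p i (polar_body K) (polar_body L)
             \<le> (p_affine_surface_area p (cball 0 1 :: (real^'n) set))\<^sup>2 \<and>
         (ellipsoid K \<and> ellipsoid L \<and> dilates K L \<longrightarrow>
           mixed_p_affine_surface_area p i K L *
           mixed_p_affine_surface_area p i (polar_body K) (polar_body L)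
             = (p_affine_surface_area p (cball 0 1 :: (real^'n) set))\<^sup>2)"
proof -
  note p = \<open>p \<ge> 0\<close> and i = \<open>0 \<le> i\<close> \<open>i \<le> real CARD('n)\<close>
  have bodyK: "convex_body K" and bodyL: "convex_body L" using assms(1,2) by (auto simp: C2_plus_def)
  have K0: "0 \<in> interior K" and L0: "0 \<in> interior L"
    using zero_in_interior_if_centroid_zero bodyK bodyL assms(3,4) by auto
  obtain J Js where K: "regular_body K J Js" using C2_plus_regular_body[OF assms(1) K0] by blast
  obtain J' Js' where L: "regular_body L J' Js'" using C2_plus_regular_body[OF assms(2) L0] by blast
  interpret K: regular_body K J Js by (rule K)
  interpret L: regular_body L J' Js' by (rule L)
  \<comment> \<open>\<open>C2_plus\<close> is given for the original bodies; the polars obtain the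
    required regularity by duality.\<close>
  note Kp = regular_body_polar[OF K] and Lp = regular_body_polar[OF L]
  let ?n = "real CARD('n)"
  define \<beta> where "\<beta> = measure lborel (cball (0::real^'n) 1)"
  have \<beta>: "\<beta> > 0" by (simp add: \<beta>_def content_cball)
  have rhs: "(p_affine_surface_area p (cball 0 1 :: (real^'n) set))\<^sup>2 = ?n\<^sup>2 * \<beta>\<^sup>2"
    by (simp add: p_affine_surface_area_unit_ball[OF p] \<beta>_def power_mult_distrib)
  define VK where "VK = measure lborel K * measure lborel (polar_body K)"
  define VL where "VL = measure lborel L * measure lborel (polar_body L)"
  have V0: "0 \<le> VK" "0 \<le> VL" by (auto simp: VK_def VL_def)
  have bound: "mixed_volume_bound p i K L * mixed_volume_bound p i (polar_body K) (polar_body L)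
      = VK powr ((?n - i) / ?n) * VL powr (i / ?n)"
    unfolding VK_def VL_def by (rule mixed_volume_bound_polar[OF K L p i])
  \<comment> \<open>The exponents sum to 1, so replacing both volume products by that of the ball
    reproduces the right-hand side.\<close>
  have full: "(\<beta>\<^sup>2) powr ((?n - i) / ?n) * (\<beta>\<^sup>2) powr (i / ?n) = \<beta>\<^sup>2"
    using \<beta> by (simp flip: powr_add add_divide_distrib)
  have "mixed_p_affine_surface_area p i K L * mixed_p_affine_surface_area p i (polar_body K) (polar_body L)
      \<le> (?n * mixed_volume_bound p i K L) * (?n * mixed_volume_bound p i (polar_body K) (polar_body L))"
  proof (rule mult_mono)
    show "0 \<le> mixed_p_affine_surface_area p i (polar_body K) (polar_body L)"
      unfolding mixed_p_affine_surface_area_def by (intro integral_nonneg_AE) auto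
    show "0 \<le> ?n * mixed_volume_bound p i K L" by (simp add: mixed_volume_bound_def)
  qed (rule mixed_le_bound[OF K L p i] mixed_le_bound[OF Kp Lp p i])+
  also have "\<dots> = ?n\<^sup>2 * (VK powr ((?n - i) / ?n) * VL powr (i / ?n))"
    by (simp add: bound[symmetric] power2_eq_square)
  also have "\<dots> \<le> ?n\<^sup>2 * ((\<beta>\<^sup>2) powr ((?n - i) / ?n) * (\<beta>\<^sup>2) powr (i / ?n))"
  proof (intro mult_left_mono mult_mono powr_mono2)
    show "VK \<le> \<beta>\<^sup>2" unfolding VK_def \<beta>_def
      by (rule blaschke_santalo[OF K.ob centroid_zero_integral[OF bodyK assms(3)]])
    show "VL \<le> \<beta>\<^sup>2" unfolding VL_def \<beta>_def
      by (rule blaschke_santalo[OF L.ob centroid_zero_integral[OF bodyL assms(4)]])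
  qed (use i V0 in auto)
  finally have ineq: "mixed_p_affine_surface_area p i K L * mixed_p_affine_surface_area p i (polar_body K) (polar_body L)
      \<le> ?n\<^sup>2 * \<beta>\<^sup>2" unfolding full .
  have eq: "mixed_p_affine_surface_area p i K L * mixed_p_affine_surface_area p i (polar_body K) (polar_body L) = ?n\<^sup>2 * \<beta>\<^sup>2"
    if E: "ellipsoid K" "ellipsoid L" "dilates K L"
  proof -
    obtain T :: "real^'n \<Rightarrow> real^'n" where T: "linear T" "bij T" "L = T ` cball 0 1"
      using ellipsoid_centered[OF E(2) bodyL assms(4)] by metis
    obtain S :: "real^'n \<Rightarrow> real^'n" where S: "linear S" "bij S" "K = S ` cball 0 1"
      using ellipsoid_centered[OF E(1) bodyK assms(3)] by metis
    obtain r where r: "r > 0" "K = scaleR r ` L" using E(3) unfolding dilates_def by blast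
    note inv = adjoint_inv_linear[OF T(1,2)]
    have bij': "bij (adjoint (inv T))" by (rule o_bij[where g="adjoint T"]) (auto simp: fun_eq_iff inv)
    have V: "VK = \<beta>\<^sup>2" "VL = \<beta>\<^sup>2"
      using volume_product_ellipsoid[OF S(1,2)] volume_product_ellipsoid[OF T(1,2)] S(3) T(3)
      by (simp_all add: VK_def VL_def \<beta>_def)
    have "mixed_p_affine_surface_area p i K L = ?n * mixed_volume_bound p i K L"
      by (rule mixed_eq_bound_ellipsoid[OF K L p i T(3,1,2) r])
    \<comment> \<open>The polars are again images of the ball, under the adjoint of an inverse, and
      dilates of each other with factor \<open>1 / r\<close>, so the equality case covers them
      too.\<close>
    moreover have "mixed_p_affine_surface_area p i (polar_body K) (polar_body L) = ?n * mixed_volume_bound p i (polar_body K) (polar_body L)"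
    proof (rule mixed_eq_bound_ellipsoid[OF Kp Lp p i])
      show "polar_body L = adjoint (inv T) ` cball 0 1" unfolding T(3) by (rule polar_linear_ball[OF T(1,2)])
      show "linear (adjoint (inv T))" by (rule adjoint_linear[OF inv(1)])
      show "polar_body K = scaleR (1 / r) ` polar_body L" unfolding r(2) by (rule polar_image_scaleR[OF r(1)])
    qed (use bij' r in auto)
    ultimately have "mixed_p_affine_surface_area p i K L * mixed_p_affine_surface_area p i (polar_body K) (polar_body L)
      = ?n\<^sup>2 * (VK powr ((?n - i) / ?n) * VL powr (i / ?n))"
      by (simp add: bound[symmetric] power2_eq_square)
    then show ?thesis unfolding V full .
  qed
  show ?thesis unfolding rhs using ineq eq by blast
qed

end
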